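(* (1) Let $X$ be a separable reflexive Banach space. Then $X$ is asymptotic-$c_0$ if and only if for every normalized $1$-suppression unconditional basic sequence $\bar e=(e_j)_{j\in\mathbb N}$ such that $\lim_{k\to\infty}\operatorname{diam}\big([\mathbb N]^k,d^{(k)}_{\bar e}\big)=\infty$ one has $\sup_{k\in\mathbb N}c_X\big([\mathbb N]^k,d^{(k)}_{\bar e}\big)=\infty$. (2) Moreover, if $X$ is a separable Banach space which is not asymptotic-$c_0$, then there is a normalized $1$-suppression unconditional basic sequence $\bar e=(e_j)_{j\in\mathbb N}$ with $\lim_{k\to\infty}\operatorname{diam}\big([\mathbb N]^k,d^{(k)}_{\bar e}\big)=\infty$ such that for every $k\in\mathbb N$ the metric space $\big([\mathbb N]^k,d^{(k)}_{\bar e}\big)$ bi-Lipschitzly embeds into $X$ with distortion at most $3$.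
   Context: $[\mathbb N]^k$ denotes the set of $k$-element subsets of $\mathbb N$; elements are written in increasing order $\bar m=\{m_1<\dots<m_k\}$. A basic sequence $(e_j)$ is $1$-suppression unconditional if $\|\sum_{j\in A}a_je_j\|\le\|\sum_j a_je_j\|$ for all finitely supported scalars $(a_j)$ and all $A\subset\mathbb N$. For such a normalized $\bar e$ and $k\in\mathbb N$, define $d^{(k)}_{\bar e}(\bar m,\bar n)=\|\sum_{j\in F}e_j\|$ where $F=\{j\le k: m_j\ne n_j\}$; this is a metric on $[\mathbb N]^k$. For metric spaces $M,Y$, the $Y$-distortion $c_Y(M)$ is the infimum of $D\ge1$ such that there are $s>0$ and $f:M\to Y$ with $s\,d_M(x,y)\le d_Y(f(x),f(y))\le sD\,d_M(x,y)$ for all $x,y$; $M$ bi-Lipschitzly embeds into $Y$ with distortion at most $D$ if such $s,f$ exist for $D$. Two finite or infinite basic sequences $(x_i),(y_i)$ are $C$-equivalent if there are $A,B>0$ with $AB\le C$ and $\frac1A\|\sum a_ix_i\|\le\|\sum a_iy_i\|\le B\|\sum a_ix_i\|$ for all finitely supported scalars. For a Banach space $X$ and $k\in\mathbb N$, the $k$-th asymptotic structure $\{X\}_k$ is the set of norms $E$ on $\mathbb R^k$ for which the unit vector basis $(e_j)_{j=1}^k$ is a normalized monotone basis and such that: for every $\varepsilon>0$, for every closed finite-codimensional subspace $X_1$ there is $x_1\in S_{X_1}$, for every closed finite-codimensional $X_2$ there is $x_2\in S_{X_2}$, ..., for every closed finite-codimensional $X_k$ there is $x_k\in S_{X_k}$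 with $(x_j)_{j=1}^k$ $(1+\varepsilon)$-equivalent to $(e_j)_{j=1}^k$. $X$ is asymptotic-$c_0$ if there is $c\ge1$ such that for all $k$ and all $E\in\{X\}_k$ the basis $(e_j)_{j=1}^k$ is $c$-equivalent to the unit vector basis of $\ell_\infty^k$. *)

theory Defs
  imports "HOL-Analysis.Analysis"
begin

definition separable_X :: "'a::real_normed_vector itself \<Rightarrow> bool" where
  "separable_X _ \<longleftrightarrow> (\<exists>D::'a set. countable D \<and> closure D = UNIV)"

definition reflexive_X :: "'a::real_normed_vector itself \<Rightarrow> bool" where
  "reflexive_X _ \<longleftrightarrow>
     (\<forall>\<phi>::('a \<Rightarrow>\<^sub>L real) \<Rightarrow>\<^sub>L real. \<exists>x::'a. \<forall>f. blinfun_apply \<phi> f = blinfun_apply f x)"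

definition cofin_subspace :: "'a::real_normed_vector set \<Rightarrow> bool" where
  "cofin_subspace Y \<longleftrightarrow> subspace Y \<and> closed Y \<and> (\<exists>B. finite B \<and> span (Y \<union> B) = UNIV)"

definition fin_supp :: "(nat \<Rightarrow> real) \<Rightarrow> bool" where
  "fin_supp a \<longleftrightarrow> finite {j. a j \<noteq> 0}"

definition supp_in :: "nat \<Rightarrow> (nat \<Rightarrow> real) \<Rightarrow> bool" where
  "supp_in k a \<longleftrightarrow> (\<forall>j\<ge>k. a j = 0)"

definition unitv :: "nat \<Rightarrow> nat \<Rightarrow> real" where
  "unitv j = (\<lambda>i. if i = j then 1 else 0)"

text \<open>(x_j)_{j<k} and (y_j)_{j<k}, given through the norms N1, N2 of their linear
  combinations, are C-equivalent.\<close>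
definition fin_equiv :: "nat \<Rightarrow> real \<Rightarrow> ((nat \<Rightarrow> real) \<Rightarrow> real) \<Rightarrow> ((nat \<Rightarrow> real) \<Rightarrow> real) \<Rightarrow> bool" where
  "fin_equiv k C N1 N2 \<longleftrightarrow> (\<exists>A B. A > 0 \<and> B > 0 \<and> A * B \<le> C \<and>
      (\<forall>a. supp_in k a \<longrightarrow> N1 a / A \<le> N2 a \<and> N2 a \<le> B * N1 a))"

definition linf_norm :: "nat \<Rightarrow> (nat \<Rightarrow> real) \<Rightarrow> real" where
  "linf_norm k a = Max (insert 0 ((\<lambda>j. \<bar>a j\<bar>) ` {..<k}))"

definition norm_Rk_normalized_monotone :: "nat \<Rightarrow> ((nat \<Rightarrow> real) \<Rightarrow> real) \<Rightarrow> bool" where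
  "norm_Rk_normalized_monotone k E \<longleftrightarrow>
     (\<forall>a b. supp_in k a \<longrightarrow> supp_in k b \<longrightarrow> E (\<lambda>j. a j + b j) \<le> E a + E b) \<and>
     (\<forall>a c. supp_in k a \<longrightarrow> E (\<lambda>j. c * a j) = \<bar>c\<bar> * E a) \<and>
     (\<forall>a. supp_in k a \<longrightarrow> E a = 0 \<longrightarrow> a = (\<lambda>_. 0)) \<and>
     (\<forall>j<k. E (unitv j) = 1) \<and>
     (\<forall>a m. supp_in k a \<longrightarrow> m \<le> k \<longrightarrow> E (\<lambda>j. if j < m then a j else 0) \<le> E a)"

text \<open>asym_game E eps k xs n: the remaining n rounds of the game, vectors xs already
  chosen (x_1 is xs!0).\<close>
fun asym_game :: "((nat \<Rightarrow> real) \<Rightarrow> real) \<Rightarrow> real \<Rightarrow> nat \<Rightarrow> 'a::real_normed_vector list \<Rightarrow> nat \<Rightarrow> bool" where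
  "asym_game E \<epsilon> k xs 0 = fin_equiv k (1 + \<epsilon>) E (\<lambda>a. norm (\<Sum>j<k. a j *\<^sub>R xs ! j))"
| "asym_game E \<epsilon> k xs (Suc n) =
     (\<forall>Y. cofin_subspace Y \<longrightarrow> (\<exists>x\<in>Y. norm x = 1 \<and> asym_game E \<epsilon> k (xs @ [x]) n))"

definition asym_struct :: "'a::real_normed_vector itself \<Rightarrow> nat \<Rightarrow> ((nat \<Rightarrow> real) \<Rightarrow> real) set" where
  "asym_struct _ k = {E. norm_Rk_normalized_monotone k E \<and>
      (\<forall>\<epsilon>>0. asym_game E \<epsilon> k ([]::'a list) k)}"

definition asymptotic_c0 :: "'a::real_normed_vector itself \<Rightarrow> bool" where
  "asymptotic_c0 T \<longleftrightarrow> (\<exists>c\<ge>1. \<forall>k. \<forall>E\<in>asym_struct T k. fin_equiv k c E (linf_norm k))"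

section \<open>Basic sequences, encoded by the norm of their finitely supported combinations\<close>

text \<open>N a = norm (sum_j a_j e_j) for finitely supported a. N is a norm on c00, e_j are
  normalized and 1-suppression unconditional (hence basic).\<close>
definition norm_1supp_unc :: "((nat \<Rightarrow> real) \<Rightarrow> real) \<Rightarrow> bool" where
  "norm_1supp_unc N \<longleftrightarrow>
     (\<forall>a b. fin_supp a \<longrightarrow> fin_supp b \<longrightarrow> N (\<lambda>j. a j + b j) \<le> N a + N b) \<and>
     (\<forall>a c. fin_supp a \<longrightarrow> N (\<lambda>j. c * a j) = \<bar>c\<bar> * N a) \<and>
     (\<forall>a. fin_supp a \<longrightarrow> N a = 0 \<longrightarrow> a = (\<lambda>_. 0)) \<and>
     (\<forall>j. N (unitv j) = 1) \<and>
     (\<forall>a A. fin_supp a \<longrightarrow> N (\<lambda>j. if j \<in> A then a j else 0) \<le> N a)"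

definition kset :: "nat \<Rightarrow> nat set set" where
  "kset k = {m. finite m \<and> card m = k}"

text \<open>m_j (1-based) is sorted_list_of_set m ! (j-1); we index from 0.\<close>
definition dk :: "((nat \<Rightarrow> real) \<Rightarrow> real) \<Rightarrow> nat \<Rightarrow> nat set \<Rightarrow> nat set \<Rightarrow> real" where
  "dk N k m n = N (\<lambda>j. if j < k \<and> sorted_list_of_set m ! j \<noteq> sorted_list_of_set n ! j then 1 else 0)"

definition diam_k :: "((nat \<Rightarrow> real) \<Rightarrow> real) \<Rightarrow> nat \<Rightarrow> real" where
  "diam_k N k = (SUP p \<in> kset k \<times> kset k. dk N k (fst p) (snd p))"

definition embeds_with :: "'b set \<Rightarrow> ('b \<Rightarrow> 'b \<Rightarrow> real) \<Rightarrow> 'a::metric_space set \<Rightarrow> real \<Rightarrow> bool" where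
  "embeds_with M d Y D \<longleftrightarrow> (\<exists>s>0. \<exists>f. f ` M \<subseteq> Y \<and>
      (\<forall>x\<in>M. \<forall>y\<in>M. s * d x y \<le> dist (f x) (f y) \<and> dist (f x) (f y) \<le> s * D * d x y))"

definition distortion :: "'a::metric_space set \<Rightarrow> 'b set \<Rightarrow> ('b \<Rightarrow> 'b \<Rightarrow> real) \<Rightarrow> ereal" where
  "distortion Y M d = Inf {ereal D | D. D \<ge> 1 \<and> embeds_with M d Y D}"

end

theory Submission
  imports Defs "HOL-Library.Sublist"
begin

text \<open>
  All limits are taken along one ultrafilter on an index set whose points \<sigma> carry a finite list
  lab \<sigma> of functionals, so that a vector chosen in the common kernel of lab \<sigma> is eventually
  annihilated by every functional. This replaces countable weakly null trees and arrays, and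
  Ramsey-type stabilisation, by iterated limits.

  If X is asymptotic-c0 with constant c, the iterated limit along a tree of unit vectors is a
  norm in the asymptotic structure. Hence the vector player cannot force sums of norm above 2c from
  vectors of the unit ball. In a reflexive space a 1-Lipschitz map on k-subsets is a sum of k weakly null
  increments of norm at most 1, so it has two values at pairwise distinct coordinates whose distance is at most
  4c + 2, while the distance of the two arguments is the whole diameter.

  If X is not asymptotic-c0, there are trees with long branch sums. Norming functionals of the
  branches have iterated weak* limits, and the functional increments are biorthogonal to the tree nodes up
  to small errors. Were all iterated norms of arrays bounded by C, then the sums of all nodes that belong to one
  index would form an array of norm at most C + 1 on which a branch functional still sees
  a whole branch, so branch sums would be bounded by (C + 1)^2 + 1. Thus arrays with unbounded iterated norms exist;
  put next to each other they define the unconditional norm N. Unconditionality is automatic since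
  a null vector cannot decrease the norm in the limit. A rapidly chosen sub-array gives the
  embedding m \<mapsto> sum of the x_j indexed by m_j: the triangle inequality costs the factor 2 and suppressing the
  vectors of one of the two points gives the lower bound.
\<close>

section \<open>The Hahn--Banach theorem\<close>

text \<open>The obstacle is that a node of a tree depends on its whole history, whereas the
  embedding needs vectors that depend only on a row and one index. No single child serves all
  histories, so an array entry adds up one child of every node in a finite set attached to its
  index, and a functional that follows one branch must be nearly blind to the other summands. This
  works because its values are weak-star limits of the values one level further on: a new increment
  can be made small on finitely many given vectors, while vectors chosen later can be taken in the
  kernels of increments fixed earlier. One order of choice thus yields both halves of
  biorthogonality.

  The number \<open>2 * c\<close> arises as follows: the limit norm of coefficients of modulus at
  most 1 is at most \<open>c\<close>, and a suitable branch realises the limit norm up to the factor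
  2. Two points whose images lie within \<open>2 * c + 1\<close> of one common iterated weak limit
  then give \<open>4 * c + 2\<close>.\<close>

definition sublinear :: "('a::real_vector \<Rightarrow> real) \<Rightarrow> bool" where
  "sublinear p \<longleftrightarrow> (\<forall>x y. p (x + y) \<le> p x + p y) \<and> (\<forall>c x. c \<ge> 0 \<longrightarrow> p (c *\<^sub>R x) = c * p x)"

lemma sublinear_add: "sublinear p \<Longrightarrow> p (x + y) \<le> p x + p y"
  and sublinear_scale: "sublinear p \<Longrightarrow> c \<ge> 0 \<Longrightarrow> p (c *\<^sub>R x) = c * p x"
  by (auto simp: sublinear_def)

lemma sublinear_zero: "sublinear p \<Longrightarrow> p 0 = 0"
  using sublinear_scale[of p 0 0] by simp

lemma sublinear_minus: "sublinear p \<Longrightarrow> - p (- x) \<le> p x"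
  using sublinear_add[of p x "- x"] sublinear_zero[of p] by simp

lemma sublinear_norm: "sublinear (norm :: 'a::real_normed_vector \<Rightarrow> real)"
  by (auto simp: sublinear_def norm_triangle_ineq)

text \<open>For sublinear \<open>p\<close> this is the largest sublinear functional below
  \<open>p\<close> whose value at \<open>- w\<close> is at most \<open>- p w\<close>. A minimal
  sublinear functional therefore coincides with all its shifts.\<close>

definition sublinear_shift :: "('a::real_vector \<Rightarrow> real) \<Rightarrow> 'a \<Rightarrow> 'a \<Rightarrow> real" where
  "sublinear_shift p w x = (INF t\<in>{0..}. p (x + t *\<^sub>R w) - t * p w)"

lemma sublinear_shift_bdd:
  assumes "sublinear p"
  shows "bdd_below ((\<lambda>t. p (x + t *\<^sub>R w) - t * p w) ` {0..})"
proof (rule bdd_belowI2[where m = "- p (- x)"])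
  fix t :: real assume "t \<in> {0..}"
  then have "t * p w = p ((x + t *\<^sub>R w) + (- x))"
    using sublinear_scale[OF assms] by simp
  also have "\<dots> \<le> p (x + t *\<^sub>R w) + p (- x)" by (rule sublinear_add[OF assms])
  finally show "- p (- x) \<le> p (x + t *\<^sub>R w) - t * p w" by simp
qed

lemma sublinear_shift_le:
  assumes "sublinear p" "t \<ge> 0"
  shows "sublinear_shift p w x \<le> p (x + t *\<^sub>R w) - t * p w"
  unfolding sublinear_shift_def
  by (rule cINF_lower[OF sublinear_shift_bdd[OF assms(1)]]) (use assms in auto)

lemma sublinear_shift_le_self: "sublinear p \<Longrightarrow> sublinear_shift p w x \<le> p x"
  using sublinear_shift_le[of p 0 w x] by simp

lemma sublinear_shift_greatest:
  assumes "\<And>t. t \<ge> 0 \<Longrightarrow> m \<le> p (x + t *\<^sub>R w) - t * p w"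
  shows "m \<le> sublinear_shift p w x"
  unfolding sublinear_shift_def by (rule cINF_greatest) (use assms in auto)

lemma sublinear_shift_sublinear:
  assumes p: "sublinear p"
  shows "sublinear (sublinear_shift p w)"
proof -
  let ?q = "sublinear_shift p w"
  have add: "?q (x + y) \<le> ?q x + ?q y" for x y
  proof -
    have 1: "?q (x + y) - (p (y + s *\<^sub>R w) - s * p w) \<le> p (x + t *\<^sub>R w) - t * p w"
      if "t \<ge> 0" "s \<ge> 0" for s t
    proof -
      have "?q (x + y) \<le> p ((x + y) + (t + s) *\<^sub>R w) - (t + s) * p w"
        using that by (intro sublinear_shift_le[OF p]) auto
      also have "(x + y) + (t + s) *\<^sub>R w = (x + t *\<^sub>R w) + (y + s *\<^sub>R w)"
        by (simp add: algebra_simps)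
      also have "p \<dots> \<le> p (x + t *\<^sub>R w) + p (y + s *\<^sub>R w)" by (rule sublinear_add[OF p])
      finally show ?thesis by (simp add: algebra_simps)
    qed
    have 2: "?q (x + y) - (p (y + s *\<^sub>R w) - s * p w) \<le> ?q x" if "s \<ge> 0" for s
      by (rule sublinear_shift_greatest) (use 1 that in auto)
    have "?q (x + y) - ?q x \<le> ?q y"
      by (rule sublinear_shift_greatest) (use 2 in \<open>auto simp: algebra_simps\<close>)
    then show ?thesis by simp
  qed
  have le: "?q (c *\<^sub>R x) \<le> c * ?q x" if c: "c > 0" for c x
  proof -
    have "?q (c *\<^sub>R x) / c \<le> ?q x"
    proof (rule sublinear_shift_greatest)
      fix t :: real assume t: "t \<ge> 0"
      have "?q (c *\<^sub>R x) \<le> p (c *\<^sub>R x + (c * t) *\<^sub>R w) - (c * t) * p w"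
        using t c by (intro sublinear_shift_le[OF p]) auto
      also have "c *\<^sub>R x + (c * t) *\<^sub>R w = c *\<^sub>R (x + t *\<^sub>R w)" by (simp add: algebra_simps)
      also have "p \<dots> = c * p (x + t *\<^sub>R w)" using c by (intro sublinear_scale[OF p]) auto
      finally show "?q (c *\<^sub>R x) / c \<le> p (x + t *\<^sub>R w) - t * p w"
        using c by (simp add: field_simps)
    qed
    then show ?thesis using c by (simp add: field_simps)
  qed
  have q0: "?q 0 = 0"
  proof (rule antisym)
    show "?q 0 \<le> 0" using sublinear_shift_le_self[OF p, of w 0] sublinear_zero[OF p] by simp
    show "0 \<le> ?q 0"
      by (rule sublinear_shift_greatest) (simp add: sublinear_scale[OF p])
  qed
  have "?q (c *\<^sub>R x) = c * ?q x" if "c \<ge> 0" for c x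
  proof (cases "c = 0")
    case True then show ?thesis using q0 by simp
  next
    case False
    then have c: "c > 0" using that by simp
    have "?q x = ?q ((1 / c) *\<^sub>R (c *\<^sub>R x))" using c by simp
    also have "\<dots> \<le> (1 / c) * ?q (c *\<^sub>R x)" by (rule le) (use c in auto)
    finally have "c * ?q x \<le> ?q (c *\<^sub>R x)" using c by (simp add: field_simps)
    then show ?thesis using le[OF c, of x] by simp
  qed
  then show ?thesis using add by (auto simp: sublinear_def)
qed

text \<open>Infima of sublinear functionals need not be subadditive. In a chain the smaller of two
  members \<open>q\<close>, \<open>r\<close> gives \<open>u (x + y) \<le> q x + r y\<close>, and
  \<open>- p (- x)\<close> keeps the infimum finite. This provides the bound for Zorn's
  lemma.\<close>

lemma sublinear_INF:
  assumes "C \<noteq> {}" "\<And>q. q \<in> C \<Longrightarrow> sublinear q" "\<And>q x. q \<in> C \<Longrightarrow> q x \<le> p x"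
    and chain: "\<And>q r. q \<in> C \<Longrightarrow> r \<in> C \<Longrightarrow> (\<forall>x. q x \<le> r x) \<or> (\<forall>x. r x \<le> q x)"
  defines "u \<equiv> \<lambda>x. INF q\<in>C. q x"
  shows "sublinear u" and "\<And>q x. q \<in> C \<Longrightarrow> u x \<le> q x"
proof -
  have bdd: "bdd_below ((\<lambda>q. q x) ` C)" for x
  proof (rule bdd_belowI2[where m = "- p (- x)"])
    fix q assume "q \<in> C"
    then show "- p (- x) \<le> q x"
      using sublinear_minus[of q x] assms(2,3)[of q] by (smt (verit, best))
  qed
  show lower: "u x \<le> q x" if "q \<in> C" for q x
    unfolding u_def by (rule cINF_lower[OF bdd that])
  have greatest: "m \<le> u x" if "\<And>q. q \<in> C \<Longrightarrow> m \<le> q x" for m x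
    unfolding u_def by (rule cINF_greatest[OF assms(1)]) (use that in auto)
  have add: "u (x + y) \<le> u x + u y" for x y
  proof -
    have 1: "u (x + y) \<le> q x + r y" if "q \<in> C" "r \<in> C" for q r
      using chain[OF that] lower[OF that(1), of "x + y"] lower[OF that(2), of "x + y"]
        sublinear_add[OF assms(2)[OF that(1)], of x y] sublinear_add[OF assms(2)[OF that(2)], of x y]
      by (smt (verit))
    have "u (x + y) - r y \<le> u x" if "r \<in> C" for r
      by (rule greatest) (use 1 that in \<open>auto simp: algebra_simps\<close>)
    then have "u (x + y) - u x \<le> u y"
      by (intro greatest) (auto simp: algebra_simps)
    then show ?thesis by simp
  qed
  have "u (c *\<^sub>R x) = c * u x" if c: "c \<ge> 0" for c x
  proof (cases "c = 0")
    case True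
    have "(\<lambda>q. q 0) ` C = (\<lambda>q. 0) ` C"
      by (rule image_cong) (use sublinear_zero[OF assms(2)] in auto)
    then show ?thesis using True assms(1) by (simp add: u_def image_constant_conv)
  next
    case False
    then have c: "c > 0" using that by simp
    have sc: "q (c *\<^sub>R x) = c * q x" if "q \<in> C" for q
      using sublinear_scale[OF assms(2)[OF that]] c by simp
    show ?thesis
    proof (rule antisym)
      have "u (c *\<^sub>R x) / c \<le> u x"
      proof (rule greatest)
        fix q assume "q \<in> C"
        then show "u (c *\<^sub>R x) / c \<le> q x"
          using lower[of q "c *\<^sub>R x"] sc[of q] c by (simp add: divide_le_eq mult.commute)
      qed
      then show "u (c *\<^sub>R x) \<le> c * u x" using c by (simp add: divide_le_eq mult.commute)
      show "c * u x \<le> u (c *\<^sub>R x)"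
      proof (rule greatest)
        fix q assume q: "q \<in> C"
        have "c * u x \<le> c * q x" using lower[OF q] c by (intro mult_left_mono) auto
        then show "c * u x \<le> q (c *\<^sub>R x)" using sc[OF q] by simp
      qed
    qed
  qed
  then show "sublinear u" using add by (auto simp: sublinear_def)
qed

text \<open>A minimal sublinear functional is odd, since it equals its own shift in every direction;
  odd and sublinear together mean linear. No extension from a subspace takes place.\<close>

lemma hahn_banach:
  fixes p :: "'a::real_vector \<Rightarrow> real"
  assumes p: "sublinear p"
  shows "\<exists>f. linear f \<and> (\<forall>x. f x \<le> p x)"
proof -
  define A where "A = {q. sublinear q \<and> (\<forall>x. q x \<le> p x)}"
  define P where "P = (\<lambda>q r :: 'a \<Rightarrow> real. \<forall>x. r x \<le> q x)"
  have "\<exists>m\<in>A. \<forall>a\<in>A. P m a \<longrightarrow> a = m"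
  proof (rule predicate_Zorn)
    show "partial_order_on A (relation_of P A)"
      by (rule partial_order_on_relation_ofI) (auto simp: P_def fun_eq_iff intro: order_trans antisym)
  next
    fix C assume C: "C \<in> Chains (relation_of P A)"
    then have CA: "C \<subseteq> A" by (rule Chains_relation_of)
    show "\<exists>u\<in>A. \<forall>a\<in>C. P a u"
    proof (cases "C = {}")
      case True
      then show ?thesis using p by (auto simp: A_def)
    next
      case False
      let ?u = "\<lambda>x. INF q\<in>C. q x"
      have ch: "(\<forall>x. q x \<le> r x) \<or> (\<forall>x. r x \<le> q x)" if "q \<in> C" "r \<in> C" for q r
        using C that by (auto simp: Chains_def relation_of_def P_def)
      have 1: "sublinear q" "q x \<le> p x" if "q \<in> C" for q x
        using CA that by (auto simp: A_def)
      have "sublinear ?u" "\<And>q x. q \<in> C \<Longrightarrow> ?u x \<le> q x"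
        by (rule sublinear_INF[of C p]; use False 1 ch in blast)+
      moreover from this(2) have "?u x \<le> p x" for x
        using False 1(2) by (meson ex_in_conv order_trans)
      ultimately show ?thesis by (intro bexI[of _ ?u]) (auto simp: A_def P_def)
    qed
  qed
  then obtain m where m: "sublinear m" "\<And>x. m x \<le> p x"
    and min: "\<And>q. sublinear q \<Longrightarrow> (\<And>x. q x \<le> m x) \<Longrightarrow> q = m"
    unfolding A_def P_def by (auto, meson order_trans)
  have neg: "m (- w) = - m w" for w
  proof -
    have "sublinear_shift m w = m"
      by (rule min) (simp_all add: m(1) sublinear_shift_sublinear sublinear_shift_le_self)
    then have "m (- w) \<le> m (- w + 1 *\<^sub>R w) - 1 * m w"
      using sublinear_shift_le[OF m(1), of 1 w "- w"] by simp
    then show ?thesis using sublinear_zero[OF m(1)] sublinear_minus[OF m(1), of w] by simp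
  qed
  have "m (x + y) = m x + m y" for x y
    using sublinear_add[OF m(1), of x y] sublinear_add[OF m(1), of "- x" "- y"] neg[of x] neg[of y]
      neg[of "x + y"] by simp
  moreover have "m (c *\<^sub>R x) = c *\<^sub>R m x" for c x
    using sublinear_scale[OF m(1), of c x] sublinear_scale[OF m(1), of "- c" x] neg[of "c *\<^sub>R x"]
    by (cases "c \<ge> 0") auto
  ultimately have "linear m" by (intro linearI)
  then show ?thesis using m(2) by blast
qed

text \<open>Domination by the shift of the norm at \<open>v\<close>, instead of the norm itself,
  forces \<open>f (- v) \<le> - norm v\<close>.\<close>

lemma norming_functional:
  fixes v :: "'a::real_normed_vector"
  shows "\<exists>f :: 'a \<Rightarrow>\<^sub>L real. f v = norm v \<and> (\<forall>x. \<bar>f x\<bar> \<le> norm x)"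
proof -
  obtain f where f: "linear f" "\<And>x. f x \<le> sublinear_shift norm v x"
    using hahn_banach[OF sublinear_shift_sublinear[OF sublinear_norm, of v]] by auto
  have le: "f x \<le> norm x" for x
    using f(2)[of x] sublinear_shift_le_self[OF sublinear_norm, of v x] by simp
  have abs_le: "\<bar>f x\<bar> \<le> norm x" for x
    using le[of x] le[of "- x"] linear_neg[OF f(1), of x] by (simp add: abs_le_iff)
  have "f (- v) \<le> - norm v"
    using f(2)[of "- v"] sublinear_shift_le[OF sublinear_norm, of 1 v "- v"] by simp
  then have "f v = norm v"
    using le[of v] linear_neg[OF f(1), of v] by simp
  moreover have "bounded_linear f"
    using f(1) abs_le by (intro bounded_linear_intro[of _ 1]) (auto simp: linear_add linear_scale)
  ultimately show ?thesis
    using abs_le by (intro exI[of _ "Blinfun f"]) (simp add: bounded_linear_Blinfun_apply)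
qed

section \<open>Ultrafilters and their iterated products on lists\<close>

definition ultra :: "'i filter \<Rightarrow> bool" where
  "ultra U \<longleftrightarrow> U \<noteq> bot \<and> (\<forall>P. eventually P U \<or> eventually (\<lambda>x. \<not> P x) U)"

text \<open>Zorn's lemma gives a minimal proper filter. Restricted to the complement of a set it
  becomes trivial or stays the same, and either outcome decides the set.\<close>

lemma ultra_exists:
  fixes F :: "'i filter"
  assumes "F \<noteq> bot"
  shows "\<exists>U. U \<le> F \<and> ultra U"
proof -
  define A where "A = {G. G \<le> F \<and> G \<noteq> bot}"
  define P where "P = (\<lambda>G H :: 'i filter. H \<le> G)"
  have *: "\<exists>m\<in>A. \<forall>a\<in>A. P m a \<longrightarrow> a = m"
  proof (rule predicate_Zorn)
    show "partial_order_on A (relation_of P A)"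
      by (rule partial_order_on_relation_ofI) (auto simp: P_def)
  next
    fix C assume C: "C \<in> Chains (relation_of P A)"
    then have CA: "C \<subseteq> A" by (rule Chains_relation_of)
    show "\<exists>u\<in>A. \<forall>a\<in>C. P a u"
    proof (cases "C = {}")
      case True
      then show ?thesis using assms by (auto simp: A_def)
    next
      case False
      have "\<exists>x\<in>C. x \<le> inf G H" if "G \<in> C" "H \<in> C" for G H
        using C that by (auto simp: Chains_def relation_of_def P_def)
      then have *: "eventually Q (Inf C) \<longleftrightarrow> (\<exists>b\<in>C. eventually Q b)" for Q
        using False by (intro eventually_Inf_base) auto
      have "Inf C \<noteq> bot"
        using CA by (auto simp: trivial_limit_def * A_def)
      moreover have "Inf C \<le> F"
        using False CA by (auto simp: A_def intro: Inf_lower2)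
      ultimately show ?thesis by (intro bexI[of _ "Inf C"]) (auto simp: A_def P_def Inf_lower)
    qed
  qed
  obtain U where U: "U \<le> F" "U \<noteq> bot"
    and min: "\<And>G. G \<le> U \<Longrightarrow> G \<noteq> bot \<Longrightarrow> G = U"
  proof -
    obtain m where "m \<in> A" "\<And>a. a \<in> A \<Longrightarrow> a \<le> m \<Longrightarrow> a = m"
      using * unfolding P_def by blast
    then show thesis
      by (intro that[of m]) (auto simp: A_def intro: order_trans)
  qed
  have "eventually Q U \<or> eventually (\<lambda>x. \<not> Q x) U" for Q
  proof (cases "inf U (principal {x. \<not> Q x}) = bot")
    case True
    then show ?thesis by (auto simp: trivial_limit_def eventually_inf_principal elim: eventually_mono)
  next
    case False
    then have "inf U (principal {x. \<not> Q x}) = U" by (intro min) auto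
    then have "U \<le> principal {x. \<not> Q x}" by (metis inf.cobounded2)
    then show ?thesis by (simp add: le_principal)
  qed
  then show ?thesis using U unfolding ultra_def by blast
qed

lemma ultra_not_bot: "ultra U \<Longrightarrow> U \<noteq> bot"
  by (simp add: ultra_def)

lemma ultra_not_eventually: "ultra U \<Longrightarrow> \<not> eventually P U \<longleftrightarrow> eventually (\<lambda>x. \<not> P x) U"
  unfolding ultra_def trivial_limit_def using eventually_conj[of P U "\<lambda>x. \<not> P x"] by fastforce

text \<open>The limit is the supremum of the eventual lower bounds: an ultrafilter turns the failure
  of a lower bound into an eventual upper bound.\<close>

lemma ultra_tendsto:
  fixes h :: "'i \<Rightarrow> real"
  assumes U: "ultra U" and b: "\<forall>\<^sub>F x in U. \<bar>h x\<bar> \<le> B"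
  shows "\<exists>L. (h \<longlongrightarrow> L) U"
proof -
  define S where "S = {t. \<forall>\<^sub>F x in U. t \<le> h x}"
  have S: "- B \<in> S" unfolding S_def using b by (auto elim: eventually_mono)
  have ub: "t \<le> B" if "t \<in> S" for t
  proof -
    have "\<forall>\<^sub>F x in U. t \<le> B"
      using that b unfolding S_def by (auto elim: eventually_elim2)
    then show ?thesis using ultra_not_bot[OF U] by simp
  qed
  then have bdd: "bdd_above S" by (rule bdd_aboveI)
  have "(h \<longlongrightarrow> Sup S) U"
  proof (rule order_tendstoI)
    fix a assume "a < Sup S"
    then obtain t where "t \<in> S" "a < t" using less_cSup_iff[OF _ bdd] S by auto
    then show "\<forall>\<^sub>F x in U. a < h x" unfolding S_def by (auto elim: eventually_mono)
  next
    fix a assume "Sup S < a"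
    then have "a \<notin> S" using cSup_upper[OF _ bdd] by force
    then show "\<forall>\<^sub>F x in U. h x < a"
      using ultra_not_eventually[OF U] unfolding S_def by (auto simp: not_le)
  qed
  then show ?thesis ..
qed

lemma ultra_tendsto_Lim:
  fixes h :: "'i \<Rightarrow> real"
  assumes "ultra U" "\<forall>\<^sub>F x in U. \<bar>h x\<bar> \<le> B"
  shows "(h \<longlongrightarrow> Lim U h) U"
  using ultra_tendsto[OF assms] tendsto_Lim ultra_not_bot[OF assms(1)] by metis

text \<open>The n-fold power of \<open>U\<close>, with the head of the list as outermost variable:
  eventual truth along it is a nest of n quantifiers over \<open>U\<close>, and limits along it are
  iterated limits.\<close>

fun iter :: "'i filter \<Rightarrow> nat \<Rightarrow> 'i list filter" where
  "iter U 0 = principal {[]}"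
| "iter U (Suc n) = Abs_filter (\<lambda>P. \<forall>\<^sub>F x in U. \<forall>\<^sub>F s in iter U n. P (x # s))"

lemma eventually_iter_0: "eventually P (iter U 0) \<longleftrightarrow> P []"
  by (simp add: eventually_principal)

lemma eventually_iter_Suc:
  fixes U :: "'i filter"
  shows "eventually P (iter U (Suc n)) \<longleftrightarrow> (\<forall>\<^sub>F x in U. \<forall>\<^sub>F s in iter U n. P (x # s))"
  unfolding iter.simps
proof (subst eventually_Abs_filter, rule is_filter.intro)
  fix P Q :: "'i list \<Rightarrow> bool"
  assume "\<forall>\<^sub>F x in U. \<forall>\<^sub>F s in iter U n. P (x # s)" "\<forall>\<^sub>F x in U. \<forall>\<^sub>F s in iter U n. Q (x # s)"
  then show "\<forall>\<^sub>F x in U. \<forall>\<^sub>F s in iter U n. P (x # s) \<and> Q (x # s)"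
    by eventually_elim (rule eventually_conj)
next
  fix P Q :: "'i list \<Rightarrow> bool"
  assume PQ: "\<forall>x. P x \<longrightarrow> Q x" and "\<forall>\<^sub>F x in U. \<forall>\<^sub>F s in iter U n. P (x # s)"
  then show "\<forall>\<^sub>F x in U. \<forall>\<^sub>F s in iter U n. Q (x # s)"
    by (auto elim!: eventually_mono)
qed auto

declare iter.simps [simp del]

lemma ultra_iter: "ultra U \<Longrightarrow> ultra (iter U n)"
proof (induction n)
  case 0
  then show ?case by (auto simp: ultra_def trivial_limit_def eventually_iter_0)
next
  case (Suc n)
  then have IH: "ultra (iter U n)" by simp
  have "\<not> eventually (\<lambda>_. False) (iter U (Suc n))"
    using ultra_not_bot[OF IH] ultra_not_bot[OF Suc.prems]
    by (simp add: eventually_iter_Suc trivial_limit_def)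
  moreover have "eventually P (iter U (Suc n)) \<or> eventually (\<lambda>x. \<not> P x) (iter U (Suc n))" for P
    unfolding eventually_iter_Suc ultra_not_eventually[OF IH, symmetric]
    using Suc.prems by (auto simp: ultra_def)
  ultimately show ?case by (auto simp: ultra_def trivial_limit_def)
qed

text \<open>The main device for making choices: the condition on an entry may depend on all entries
  before it, as long as almost every next entry satisfies it.\<close>

lemma eventually_iter_step:
  assumes "\<And>s. length s < n \<Longrightarrow> \<forall>\<^sub>F \<sigma> in U. P s \<sigma>"
  shows "\<forall>\<^sub>F t in iter U n. length t = n \<and> (\<forall>i<n. P (take i t) (t ! i))"
  using assms
proof (induction n arbitrary: P)
  case 0
  then show ?case by (simp add: eventually_iter_0)
next
  case (Suc n)
  have 1: "\<forall>\<^sub>F \<sigma> in U. P [] \<sigma>" using Suc.prems[of "[]"] by simp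
  have 2: "\<forall>\<^sub>F t in iter U n. length t = n \<and> (\<forall>i<n. P (\<sigma> # take i t) (t ! i))" for \<sigma>
    by (rule Suc.IH) (use Suc.prems in auto)
  show ?case
    unfolding eventually_iter_Suc
    using 1
  proof eventually_elim
    case (elim \<sigma>)
    show ?case
      using 2[of \<sigma>]
    proof eventually_elim
      case (elim t)
      then show ?case using \<open>P [] \<sigma>\<close> by (auto simp: less_Suc_eq_0_disj)
    qed
  qed
qed

lemma eventually_iter_length: "\<forall>\<^sub>F t in iter U n. length t = n"
  using eventually_iter_step[of n "\<lambda>_ _. True" U] by simp

text \<open>Peels off the outermost limit, which is what makes induction on the number of limits
  possible.\<close>

lemma tendsto_iter_Suc:
  fixes h :: "'i list \<Rightarrow> real"
  assumes U: "ultra U" and lim: "(h \<longlongrightarrow> L) (iter U (Suc n))"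
    and g: "\<And>\<sigma>. ((\<lambda>s. h (\<sigma> # s)) \<longlongrightarrow> g \<sigma>) (iter U n)"
  shows "(g \<longlongrightarrow> L) U"
proof (rule tendstoI)
  fix e :: real assume e: "e > 0"
  then have "\<forall>\<^sub>F s in iter U (Suc n). dist (h s) L < e / 2" by (intro tendstoD[OF lim]) auto
  then have "\<forall>\<^sub>F \<sigma> in U. \<forall>\<^sub>F s in iter U n. dist (h (\<sigma> # s)) L < e / 2"
    by (simp add: eventually_iter_Suc)
  then show "\<forall>\<^sub>F \<sigma> in U. dist (g \<sigma>) L < e"
  proof eventually_elim
    case (elim \<sigma>)
    have "dist (g \<sigma>) L \<le> e / 2"
      by (rule tendsto_upperbound[OF tendsto_dist[OF g tendsto_const]])
        (use elim ultra_not_bot[OF ultra_iter[OF U]] in \<open>auto elim: eventually_mono\<close>)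
    then show ?case using e by simp
  qed
qed

section \<open>Common kernels and subspaces of finite codimension\<close>

definition common_kernel :: "('a::real_normed_vector \<Rightarrow>\<^sub>L real) list \<Rightarrow> 'a set" where
  "common_kernel \<Phi> = {x. \<forall>f\<in>set \<Phi>. blinfun_apply f x = 0}"

lemma common_kernel_Nil [simp]: "common_kernel [] = UNIV"
  and common_kernel_Cons: "common_kernel (f # \<Phi>) = {x \<in> common_kernel \<Phi>. blinfun_apply f x = 0}"
  by (auto simp: common_kernel_def)

lemma subspace_common_kernel: "subspace (common_kernel \<Phi>)"
  by (auto simp: common_kernel_def subspace_def blinfun.add_right blinfun.scaleR_right)

lemma closed_common_kernel: "closed (common_kernel \<Phi>)"
proof -
  have "common_kernel \<Phi> = (\<Inter>f\<in>set \<Phi>. (\<lambda>x. blinfun_apply f x) -` {0})"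
    by (auto simp: common_kernel_def)
  moreover have "closed ((\<lambda>x. blinfun_apply f x) -` {0})" for f :: "'a \<Rightarrow>\<^sub>L real"
    by (intro closed_vimage continuous_intros)
  ultimately show ?thesis by auto
qed

text \<open>Converts weakly null increments into legal moves of the game: a vector on which finitely
  many functionals are small is close to their common kernel. Each new functional \<open>f\<close>
  is corrected along a vector \<open>b\<close> of the previous kernel with
  \<open>f b = 1\<close>.\<close>

lemma common_kernel_approx:
  "\<exists>K\<ge>0. \<forall>z. \<exists>y\<in>common_kernel \<Phi>. norm (z - y) \<le> K * (\<Sum>f\<leftarrow>\<Phi>. \<bar>blinfun_apply f z\<bar>)"
proof (induction \<Phi>)
  case Nil
  then show ?case by (intro exI[of _ 0]) auto
next
  case (Cons f \<Phi>)
  then obtain K where K: "K \<ge> 0"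
    "\<And>z. \<exists>y\<in>common_kernel \<Phi>. norm (z - y) \<le> K * (\<Sum>f\<leftarrow>\<Phi>. \<bar>blinfun_apply f z\<bar>)" by auto
  show ?case
  proof (cases "\<forall>b\<in>common_kernel \<Phi>. blinfun_apply f b = 0")
    case True
    then have eq: "common_kernel (f # \<Phi>) = common_kernel \<Phi>" by (auto simp: common_kernel_Cons)
    have le: "K * (\<Sum>g\<leftarrow>\<Phi>. \<bar>blinfun_apply g z\<bar>) \<le> K * (\<Sum>g\<leftarrow>f # \<Phi>. \<bar>blinfun_apply g z\<bar>)" for z
      using K(1) by (intro mult_left_mono) auto
    have "\<exists>y\<in>common_kernel (f # \<Phi>). norm (z - y) \<le> K * (\<Sum>g\<leftarrow>f # \<Phi>. \<bar>blinfun_apply g z\<bar>)" for z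
    proof -
      obtain y where "y \<in> common_kernel \<Phi>" "norm (z - y) \<le> K * (\<Sum>g\<leftarrow>\<Phi>. \<bar>blinfun_apply g z\<bar>)"
        using K(2) by blast
      then show ?thesis using le[of z] by (intro bexI[of _ y]) (auto simp: eq)
    qed
    then show ?thesis using K(1) by blast
  next
    case False
    then obtain b0 where b0: "b0 \<in> common_kernel \<Phi>" "blinfun_apply f b0 \<noteq> 0" by auto
    define b where "b = (1 / blinfun_apply f b0) *\<^sub>R b0"
    have b: "b \<in> common_kernel \<Phi>" "blinfun_apply f b = 1"
      using b0 subspace_scale[OF subspace_common_kernel b0(1)] by (auto simp: b_def blinfun.scaleR_right)
    define K' where "K' = K + (norm f * K + 1) * norm b"
    have K': "K' \<ge> 0" using K(1) by (simp add: K'_def)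
    have "\<exists>y\<in>common_kernel (f # \<Phi>). norm (z - y) \<le> K' * (\<Sum>g\<leftarrow>f # \<Phi>. \<bar>blinfun_apply g z\<bar>)" for z
    proof -
      obtain y where y: "y \<in> common_kernel \<Phi>" "norm (z - y) \<le> K * (\<Sum>f\<leftarrow>\<Phi>. \<bar>blinfun_apply f z\<bar>)"
        using K(2) by blast
      let ?S = "\<Sum>f\<leftarrow>\<Phi>. \<bar>blinfun_apply f z\<bar>"
      let ?T = "\<bar>blinfun_apply f z\<bar> + ?S"
      have S: "?S \<ge> 0" by (rule sum_list_nonneg) auto
      define y' where "y' = y - blinfun_apply f y *\<^sub>R b"
      have "y' \<in> common_kernel (f # \<Phi>)"
        using y b subspace_common_kernel[of \<Phi>]
        by (auto simp: common_kernel_Cons y'_def subspace_diff subspace_scale blinfun.diff_right blinfun.scaleR_right)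
      moreover have "norm (z - y') \<le> K' * ?T"
      proof -
        have "\<bar>blinfun_apply f y\<bar> \<le> \<bar>blinfun_apply f z\<bar> + \<bar>blinfun_apply f (z - y)\<bar>"
          by (simp add: blinfun.diff_right)
        also have "\<bar>blinfun_apply f (z - y)\<bar> \<le> norm f * norm (z - y)"
          using norm_blinfun[of f "z - y"] by simp
        also have "\<dots> \<le> norm f * (K * ?S)" by (intro mult_left_mono y) auto
        also have "\<dots> \<le> norm f * (K * ?T)" using K(1) by (intro mult_left_mono) auto
        finally have fy: "\<bar>blinfun_apply f y\<bar> \<le> (norm f * K + 1) * ?T"
          using S by (simp add: algebra_simps)
        have "norm (z - y') = norm ((z - y) + blinfun_apply f y *\<^sub>R b)" by (simp add: y'_def algebra_simps)
        also have "\<dots> \<le> norm (z - y) + \<bar>blinfun_apply f y\<bar> * norm b"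
          by (metis norm_scaleR norm_triangle_ineq)
        also have "\<dots> \<le> K * ?T + ((norm f * K + 1) * ?T) * norm b"
        proof (intro add_mono mult_right_mono)
          have "K * ?S \<le> K * ?T" using K(1) by (intro mult_left_mono) auto
          then show "norm (z - y) \<le> K * ?T" using y(2) by simp
        qed (use fy in auto)
        also have "\<dots> = K' * ?T" by (simp add: K'_def algebra_simps)
        finally show ?thesis .
      qed
      ultimately show ?thesis by auto
    qed
    then show ?thesis using K' by blast
  qed
qed

lemma cofin_subspace_common_kernel: "cofin_subspace (common_kernel \<Phi>)"
proof -
  have "\<exists>B. finite B \<and> span (common_kernel \<Phi> \<union> B) = UNIV"
  proof (induction \<Phi>)
    case Nil
    then show ?case by (intro exI[of _ "{}"]) auto
  next
    case (Cons f \<Phi>)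
    then obtain B where B: "finite B" "span (common_kernel \<Phi> \<union> B) = UNIV" by auto
    show ?case
    proof (cases "\<forall>b\<in>common_kernel \<Phi>. blinfun_apply f b = 0")
      case True
      then have "common_kernel (f # \<Phi>) = common_kernel \<Phi>" by (auto simp: common_kernel_Cons)
      then show ?thesis using B by auto
    next
      case False
      then obtain b where b: "b \<in> common_kernel \<Phi>" "blinfun_apply f b \<noteq> 0" by auto
      let ?S = "span (common_kernel (f # \<Phi>) \<union> insert b B)"
      have "y \<in> ?S" if "y \<in> common_kernel \<Phi>" for y
      proof -
        let ?t = "blinfun_apply f y / blinfun_apply f b"
        have "y - ?t *\<^sub>R b \<in> common_kernel (f # \<Phi>)"
          using that b subspace_common_kernel[of \<Phi>]
          by (auto simp: common_kernel_Cons subspace_diff subspace_scale blinfun.diff_right blinfun.scaleR_right)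
        then have "(y - ?t *\<^sub>R b) + ?t *\<^sub>R b \<in> ?S"
          by (intro span_add span_scale) (auto intro: span_base)
        then show ?thesis by simp
      qed
      then have "common_kernel \<Phi> \<union> B \<subseteq> ?S" by (auto intro: span_base)
      then have "span (common_kernel \<Phi> \<union> B) \<subseteq> ?S" by (rule span_minimal) auto
      then show ?thesis using B by (intro exI[of _ "insert b B"]) auto
    qed
  qed
  then show ?thesis
    by (simp add: cofin_subspace_def subspace_common_kernel closed_common_kernel)
qed

lemma coord_bounded:
  fixes Z :: "'a::real_normed_vector set"
  assumes Z: "subspace Z" "closed Z" and b: "b \<notin> Z"
  shows "\<exists>d>0. \<forall>y\<in>Z. \<forall>t. \<bar>t\<bar> * d \<le> norm (y + t *\<^sub>R b)"
proof -
  have "Z \<noteq> {}" using subspace_0[OF Z(1)] by auto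
  then have d: "infdist b Z > 0"
    using b Z(2) by (simp add: infdist_pos_not_in_closed)
  have "\<bar>t\<bar> * infdist b Z \<le> norm (y + t *\<^sub>R b)" if "y \<in> Z" for y t
  proof (cases "t = 0")
    case False
    have "(- 1 / t) *\<^sub>R y \<in> Z" using that Z(1) by (rule subspace_scale[rotated])
    then have "infdist b Z \<le> dist b ((- 1 / t) *\<^sub>R y)" by (rule infdist_le)
    also have "\<dots> = norm ((1 / t) *\<^sub>R (y + t *\<^sub>R b))"
      using False by (simp add: dist_norm algebra_simps)
    also have "\<dots> = norm (y + t *\<^sub>R b) / \<bar>t\<bar>" by simp
    finally show ?thesis using False by (simp add: pos_le_divide_eq mult.commute)
  qed auto
  then show ?thesis using d by blast
qed

text \<open>The coefficient of \<open>b\<close> is controlled by the norm, so the coefficients of a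
  convergent sequence form a Cauchy sequence.\<close>

lemma closed_span_insert:
  fixes Z :: "'a::banach set"
  assumes Z: "subspace Z" "closed Z" and b: "b \<notin> Z"
  shows "closed (span (insert b Z))"
proof -
  obtain d where d: "d > 0" "\<And>y t. y \<in> Z \<Longrightarrow> \<bar>t\<bar> * d \<le> norm (y + t *\<^sub>R b)"
    using coord_bounded[OF assms] by blast
  have sp: "\<exists>t. w - t *\<^sub>R b \<in> Z" if "w \<in> span (insert b Z)" for w
    using that Z(1) by (simp add: span_insert span_eq_iff[THEN iffD2])
  show ?thesis
    unfolding closed_sequential_limits
  proof (intro allI impI, elim conjE)
    fix w l assume w: "\<forall>n. w n \<in> span (insert b Z)" and lim: "w \<longlonglongrightarrow> l"
    have "\<forall>n. \<exists>t. w n - t *\<^sub>R b \<in> Z" using sp w by blast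
    then obtain t where t: "\<And>n. w n - t n *\<^sub>R b \<in> Z" by metis
    have "Cauchy t"
    proof (rule metric_CauchyI)
      fix e :: real assume e: "e > 0"
      have "e * d > 0" using e d(1) by simp
      from metric_CauchyD[OF LIMSEQ_imp_Cauchy[OF lim] this]
      obtain M where M: "\<forall>m\<ge>M. \<forall>n\<ge>M. dist (w m) (w n) < e * d" by blast
      have "dist (t m) (t n) < e" if "m \<ge> M" "n \<ge> M" for m n
      proof -
        have "(w m - t m *\<^sub>R b) - (w n - t n *\<^sub>R b) \<in> Z" using t Z(1) by (simp add: subspace_diff)
        from d(2)[OF this, of "t m - t n"]
        have "\<bar>t m - t n\<bar> * d \<le> norm (w m - w n)" by (simp add: algebra_simps)
        also have "\<dots> < e * d" using M that by (simp add: dist_norm)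
        finally show ?thesis using d(1) by (simp add: dist_real_def)
      qed
      then show "\<exists>M. \<forall>m\<ge>M. \<forall>n\<ge>M. dist (t m) (t n) < e" by blast
    qed
    then obtain s where "t \<longlonglongrightarrow> s" unfolding Cauchy_convergent_iff convergent_def ..
    then have "(\<lambda>n. w n - t n *\<^sub>R b) \<longlonglongrightarrow> l - s *\<^sub>R b" by (intro tendsto_intros lim)
    then have "l - s *\<^sub>R b \<in> Z" by (rule closed_sequentially[OF Z(2) t])
    then have "(l - s *\<^sub>R b) + s *\<^sub>R b \<in> span (insert b Z)"
      by (intro span_add span_scale) (auto intro: span_base)
    then show "l \<in> span (insert b Z)" by simp
  qed
qed

lemma cofin_subspace_contains_kernel:
  fixes Y :: "'a::banach set"
  assumes "cofin_subspace Y"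
  shows "\<exists>\<Phi>. common_kernel \<Phi> \<subseteq> Y"
proof -
  obtain B where B: "finite B" "span (Y \<union> B) = UNIV" and Y: "subspace Y" "closed Y"
    using assms by (auto simp: cofin_subspace_def)
  \<comment> \<open>The claim is strengthened by a bounded map \<open>Q\<close> into
    \<open>Y\<close>: the coefficient of \<open>b\<close> makes sense only on \<open>?Z\<close>, and
    composing it with \<open>Q\<close> gives a functional on the whole space without an extension
    theorem.\<close>
  have "\<exists>\<Phi> Q. bounded_linear Q \<and> range Q \<subseteq> Y \<and> (\<forall>z\<in>common_kernel \<Phi>. Q z = z)"
    using B Y
  proof (induction B arbitrary: Y rule: finite_induct)
    case empty
    then have "Y = UNIV" by (metis span_eq_iff sup_bot_right)
    then show ?case
      by (intro exI[of _ "[]"] exI[of _ "\<lambda>x. x"]) (auto simp: bounded_linear_ident)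
  next
    case (insert b B)
    show ?case
    proof (cases "b \<in> Y")
      case True
      then have "Y \<union> insert b B = Y \<union> B" by auto
      then show ?thesis using insert.prems by (intro insert.IH) auto
    next
      case False
      obtain d where d: "d > 0" "\<And>y t. y \<in> Y \<Longrightarrow> \<bar>t\<bar> * d \<le> norm (y + t *\<^sub>R b)"
        using coord_bounded[OF insert.prems(2,3) False] by blast
      let ?Z = "span (insert b Y)"
      have "Y \<union> insert b B \<subseteq> span (?Z \<union> B)" by (auto intro!: span_base)
      then have "UNIV \<subseteq> span (?Z \<union> B)"
        using span_minimal[of "Y \<union> insert b B" "span (?Z \<union> B)"] insert.prems(1) by auto
      then have "\<exists>\<Phi> Q. bounded_linear Q \<and> range Q \<subseteq> ?Z \<and> (\<forall>z\<in>common_kernel \<Phi>. Q z = z)"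
        using closed_span_insert[OF insert.prems(2,3) False] by (intro insert.IH) auto
      then obtain \<Phi> Q where Q: "bounded_linear Q" "range Q \<subseteq> ?Z" "\<And>z. z \<in> common_kernel \<Phi> \<Longrightarrow> Q z = z"
        by blast
      have "\<exists>t. Q z - t *\<^sub>R b \<in> Y" for z
      proof -
        have "Q z \<in> ?Z" using Q(2) by auto
        then show ?thesis
          using insert.prems(2) by (simp add: span_insert span_eq_iff[THEN iffD2])
      qed
      then obtain t where t: "\<And>z. Q z - t z *\<^sub>R b \<in> Y" by metis
      have uniq: "s = t z" if "Q z - s *\<^sub>R b \<in> Y" for s z
      proof -
        have "(Q z - s *\<^sub>R b) - (Q z - t z *\<^sub>R b) \<in> Y"
          by (rule subspace_diff[OF insert.prems(2) that t])
        from d(2)[OF this, of "s - t z"] show ?thesis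
          using d(1) by (simp add: algebra_simps mult_le_0_iff)
      qed
      obtain K where K: "\<And>z. norm (Q z) \<le> norm z * K" "K \<ge> 0"
        using bounded_linear.nonneg_bounded[OF Q(1)] by blast
      interpret Q: bounded_linear Q by (rule Q(1))
      have bl: "bounded_linear t"
      proof (rule bounded_linear_intro)
        fix x y
        have "(Q x - t x *\<^sub>R b) + (Q y - t y *\<^sub>R b) \<in> Y"
          using t insert.prems(2) by (simp add: subspace_add)
        then have "Q (x + y) - (t x + t y) *\<^sub>R b \<in> Y" by (simp add: Q.add algebra_simps)
        then show "t (x + y) = t x + t y" using uniq by simp
      next
        fix r x
        have "r *\<^sub>R (Q x - t x *\<^sub>R b) \<in> Y"
          using t insert.prems(2) by (simp add: subspace_scale)
        then have "Q (r *\<^sub>R x) - (r * t x) *\<^sub>R b \<in> Y" by (simp add: Q.scaleR algebra_simps)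
        then show "t (r *\<^sub>R x) = r *\<^sub>R t x" using uniq by simp
      next
        fix x
        have "\<bar>t x\<bar> * d \<le> norm (Q x)" using d(2)[OF t[of x], of "t x"] by simp
        also have "\<dots> \<le> norm x * K" by (rule K)
        finally show "norm (t x) \<le> norm x * (K / d)" using d(1) by (simp add: field_simps)
      qed
      show ?thesis
      proof (intro exI[of _ "Blinfun t # \<Phi>"] exI[of _ "\<lambda>z. Q z - t z *\<^sub>R b"] conjI)
        show "bounded_linear (\<lambda>z. Q z - t z *\<^sub>R b)"
          by (intro bounded_linear_sub Q(1) bounded_linear_compose[OF bounded_linear_scaleR_left bl])
      qed (use t Q(3) bl in \<open>auto simp: common_kernel_Cons bounded_linear_Blinfun_apply\<close>)
    qed
  qed
  then obtain \<Phi> Q where "range Q \<subseteq> Y" and Q: "\<forall>z\<in>common_kernel \<Phi>. Q z = z" by blast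
  then have "common_kernel \<Phi> \<subseteq> range Q" by (metis rangeI subsetI)
  then show ?thesis using \<open>range Q \<subseteq> Y\<close> by blast
qed

section \<open>Strategies in the asymptotic game\<close>

text \<open>A tree is a function on histories: \<open>x s\<close> is the node reached by the moves
  \<open>s\<close>. The value at the empty history never lies on a path.\<close>

definition tree_path :: "('l list \<Rightarrow> 'a) \<Rightarrow> 'l list \<Rightarrow> 'a list" where
  "tree_path x s = map (\<lambda>i. x (take (Suc i) s)) [0..<length s]"

lemma tree_path_Nil [simp]: "tree_path x [] = []"
  and tree_path_snoc: "tree_path x (s @ [\<Phi>]) = tree_path x s @ [x (s @ [\<Phi>])]"
  and length_tree_path [simp]: "length (tree_path x s) = length s"
  and nth_tree_path: "i < length s \<Longrightarrow> tree_path x s ! i = x (take (Suc i) s)"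
  by (auto simp: tree_path_def)

text \<open>The label \<open>\<Phi>\<close> is the move of the subspace player,
  \<open>S \<Phi>\<close> the set of permitted answers, and \<open>P\<close> the winning condition
  of the vector player. The parameter \<open>S\<close> allows both the unit sphere and the unit ball
  of a kernel.\<close>

fun game :: "('a list \<Rightarrow> bool) \<Rightarrow> ('l \<Rightarrow> 'a set) \<Rightarrow> 'a list \<Rightarrow> nat \<Rightarrow> bool" where
  "game P S ys 0 = P ys"
| "game P S ys (Suc n) = (\<forall>\<Phi>. \<exists>y\<in>S \<Phi>. game P S (ys @ [y]) n)"

lemma game_strategy:
  assumes "game P S [] k"
  shows "\<exists>x. (\<forall>s \<Phi>. length s < k \<longrightarrow> x (s @ [\<Phi>]) \<in> S \<Phi>) \<and> (\<forall>s. length s = k \<longrightarrow> P (tree_path x s))"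
proof -
  define pick where "pick ys \<Phi> = (SOME y. y \<in> S \<Phi> \<and> game P S (ys @ [y]) (k - Suc (length ys)))" for ys \<Phi>
  define p where "p = foldl (\<lambda>ys \<Phi>. ys @ [pick ys \<Phi>]) []"
  define x where "x s = last (p s)" for s
  have p_snoc: "p (s @ [\<Phi>]) = p s @ [pick (p s) \<Phi>]" for s \<Phi> by (simp add: p_def)
  have len: "length (p s) = length s" for s
    by (induction s rule: rev_induct) (auto simp: p_snoc, simp add: p_def)
  have pick: "pick (p s) \<Phi> \<in> S \<Phi> \<and> game P S (p s @ [pick (p s) \<Phi>]) (k - Suc (length s))"
    if "length s < k" "game P S (p s) (k - length s)" for s \<Phi>
  proof -
    have "k - length s = Suc (k - Suc (length s))" using that by simp
    then have "\<exists>y. y \<in> S \<Phi> \<and> game P S (p s @ [y]) (k - Suc (length (p s)))"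
      using that(2) by (auto simp: len)
    from someI_ex[OF this] show ?thesis by (simp add: pick_def len)
  qed
  have game_p: "length s \<le> k \<Longrightarrow> game P S (p s) (k - length s)" for s
  proof (induction s rule: rev_induct)
    case Nil
    then show ?case using assms by (simp add: p_def)
  next
    case (snoc \<Phi> s)
    then show ?case using pick[of s \<Phi>] by (simp add: p_snoc)
  qed
  have tree_path: "tree_path x s = p s" for s
    by (induction s rule: rev_induct) (auto simp: tree_path_snoc x_def p_snoc, simp add: p_def)
  show ?thesis
  proof (intro exI[of _ x] conjI allI impI)
    fix s :: "'b list" and \<Phi> assume "length s < k"
    then show "x (s @ [\<Phi>]) \<in> S \<Phi>" using pick[of s \<Phi>] game_p[of s] by (simp add: x_def p_snoc)
  next
    fix s :: "'b list" assume "length s = k"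
    then show "P (tree_path x s)" using game_p[of s] by (simp add: tree_path)
  qed
qed

lemma eventually_ex_ultra: "ultra U \<Longrightarrow> eventually P U \<Longrightarrow> \<exists>x. P x"
  using ultra_not_bot eventually_happens' by blast

text \<open>A coordinate is a difference of two consecutive initial projections, hence the factor 2.
  The properties of \<open>E\<close> are separate hypotheses so that the bound applies to limit
  norms before they are known to be definite.\<close>

lemma monotone_coord_le:
  assumes add: "\<And>a b. supp_in k a \<Longrightarrow> supp_in k b \<Longrightarrow> E (\<lambda>j. a j + b j) \<le> E a + E b"
    and scale: "\<And>a c. supp_in k a \<Longrightarrow> E (\<lambda>j. c * a j) = \<bar>c\<bar> * E a"
    and unit: "E (unitv j) = 1"
    and mono: "\<And>m. m \<le> k \<Longrightarrow> E (\<lambda>i. if i < m then a i else 0) \<le> E a"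
    and a: "supp_in k a" and j: "j < k"
  shows "\<bar>a j\<bar> \<le> 2 * E a"
proof -
  let ?t = "\<lambda>m i. if i < m then a i else (0::real)"
  have supp: "supp_in k (?t m)" "supp_in k (unitv j)" "supp_in k (\<lambda>i. (- 1) * ?t m i)" for m
    using a j by (auto simp: supp_in_def unitv_def)
  have "\<bar>a j\<bar> = E (\<lambda>i. a j * unitv j i)" by (simp add: scale[OF supp(2)] unit)
  also have "(\<lambda>i. a j * unitv j i) = (\<lambda>i. ?t (Suc j) i + (- 1) * ?t j i)"
    by (auto simp: unitv_def fun_eq_iff less_Suc_eq)
  also have "E \<dots> \<le> E (?t (Suc j)) + E (\<lambda>i. (- 1) * ?t j i)"
    by (rule add[OF supp(1) supp(3)])
  also have "E (\<lambda>i. (- 1) * ?t j i) = E (?t j)" by (subst scale[OF supp(1)]) simp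
  also have "E (?t (Suc j)) + E (?t j) \<le> E a + E a"
    using j by (intro add_mono mono) auto
  finally show ?thesis by simp
qed

section \<open>Limit norms of trees and the asymptotic structure\<close>

locale null_ultrafilter =
  fixes U :: "'j filter" and lab :: "'j \<Rightarrow> ('a::banach \<Rightarrow>\<^sub>L real) list"
  assumes ultra: "ultra U" and lab: "\<And>f. \<forall>\<^sub>F \<sigma> in U. f \<in> set (lab \<sigma>)"
begin

lemmas ultra_it = ultra_iter[OF ultra]

text \<open>Lets a single ultrafilter answer all subspaces of finite codimension at once.\<close>

lemma eventually_kernel_le:
  assumes "cofin_subspace Y"
  shows "\<forall>\<^sub>F \<sigma> in U. common_kernel (lab \<sigma>) \<subseteq> Y"
proof -
  obtain \<Phi> where "common_kernel \<Phi> \<subseteq> Y" using cofin_subspace_contains_kernel[OF assms] ..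
  moreover have "\<forall>\<^sub>F \<sigma> in U. \<forall>f\<in>set \<Phi>. f \<in> set (lab \<sigma>)"
    by (intro eventually_ball_finite) (auto simp: lab)
  ultimately show ?thesis
    by (auto simp: common_kernel_def elim!: eventually_mono)
qed

definition branch_norm :: "(('a \<Rightarrow>\<^sub>L real) list list \<Rightarrow> 'a) \<Rightarrow> nat \<Rightarrow> (nat \<Rightarrow> real) \<Rightarrow> 'j list \<Rightarrow> real" where
  "branch_norm x k a t = norm (\<Sum>j<k. a j *\<^sub>R tree_path x (map lab t) ! j)"

definition branch_lim :: "(('a \<Rightarrow>\<^sub>L real) list list \<Rightarrow> 'a) \<Rightarrow> nat \<Rightarrow> (nat \<Rightarrow> real) \<Rightarrow> real" where
  "branch_lim x k a = Lim (iter U k) (branch_norm x k a)"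

definition unit_tree :: "(('a \<Rightarrow>\<^sub>L real) list list \<Rightarrow> 'a) \<Rightarrow> nat \<Rightarrow> bool" where
  "unit_tree x k \<longleftrightarrow> (\<forall>s \<Phi>. length s < k \<longrightarrow> x (s @ [\<Phi>]) \<in> common_kernel \<Phi> \<and> norm (x (s @ [\<Phi>])) = 1)"

lemma unit_tree_norm:
  assumes "unit_tree x k" "length s \<le> k" "i < length s"
  shows "norm (tree_path x s ! i) = 1"
  using assms by (simp add: nth_tree_path take_Suc_conv_app_nth unit_tree_def)

lemma branch_norm_Lipschitz:
  assumes "unit_tree x k" "length t = k"
  shows "branch_norm x k a t \<le> branch_norm x k b t + (\<Sum>j<k. \<bar>a j - b j\<bar>)"
proof -
  let ?y = "\<lambda>j. tree_path x (map lab t) ! j"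
  have "norm (\<Sum>j<k. (a j - b j) *\<^sub>R ?y j) \<le> (\<Sum>j<k. norm ((a j - b j) *\<^sub>R ?y j))"
    by (rule norm_sum)
  also have "\<dots> = (\<Sum>j<k. \<bar>a j - b j\<bar>)"
    using assms by (intro sum.cong) (auto simp: unit_tree_norm)
  finally have 1: "norm (\<Sum>j<k. (a j - b j) *\<^sub>R ?y j) \<le> (\<Sum>j<k. \<bar>a j - b j\<bar>)" .
  have "(\<Sum>j<k. a j *\<^sub>R ?y j) = (\<Sum>j<k. b j *\<^sub>R ?y j) + (\<Sum>j<k. (a j - b j) *\<^sub>R ?y j)"
    by (simp add: sum.distrib[symmetric] scaleR_diff_left)
  then show ?thesis
    using 1 norm_triangle_ineq[of "\<Sum>j<k. b j *\<^sub>R ?y j" "\<Sum>j<k. (a j - b j) *\<^sub>R ?y j"]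
    by (simp add: branch_norm_def)
qed

lemma branch_norm_le:
  assumes "unit_tree x k" "length t = k"
  shows "branch_norm x k a t \<le> (\<Sum>j<k. \<bar>a j\<bar>)"
  using branch_norm_Lipschitz[OF assms, of a "\<lambda>_. 0"] by (simp add: branch_norm_def)

lemma branch_lim_tendsto:
  assumes "unit_tree x k"
  shows "(branch_norm x k a \<longlongrightarrow> branch_lim x k a) (iter U k)"
  unfolding branch_lim_def
proof (rule ultra_tendsto_Lim[OF ultra_it])
  show "\<forall>\<^sub>F t in iter U k. \<bar>branch_norm x k a t\<bar> \<le> (\<Sum>j<k. \<bar>a j\<bar>)"
    using eventually_iter_length
    by eventually_elim (use branch_norm_le[OF assms] in \<open>simp add: branch_norm_def\<close>)
qed

lemma branch_lim_le:
  assumes "unit_tree x k" "\<forall>\<^sub>F t in iter U k. branch_norm x k a t \<le> c * branch_norm x k b t + d"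
  shows "branch_lim x k a \<le> c * branch_lim x k b + d"
  by (rule tendsto_le[OF ultra_not_bot[OF ultra_it] _ branch_lim_tendsto[OF assms(1)] assms(2)])
    (intro tendsto_intros branch_lim_tendsto[OF assms(1)])

lemma branch_lim_Lipschitz:
  assumes "unit_tree x k"
  shows "branch_lim x k a \<le> branch_lim x k b + (\<Sum>j<k. \<bar>a j - b j\<bar>)"
proof -
  have "\<forall>\<^sub>F t in iter U k. branch_norm x k a t \<le> 1 * branch_norm x k b t + (\<Sum>j<k. \<bar>a j - b j\<bar>)"
    using eventually_iter_length by eventually_elim (use branch_norm_Lipschitz[OF assms] in simp)
  from branch_lim_le[OF assms this] show ?thesis by simp
qed

lemma branch_norm_triangle:
  "branch_norm x k (\<lambda>j. a j + b j) t \<le> branch_norm x k a t + branch_norm x k b t"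
  by (simp add: branch_norm_def scaleR_add_left sum.distrib norm_triangle_ineq)

lemma branch_norm_scale: "branch_norm x k (\<lambda>j. c * a j) t = \<bar>c\<bar> * branch_norm x k a t"
proof -
  have "(\<Sum>j<k. (c * a j) *\<^sub>R tree_path x (map lab t) ! j) = c *\<^sub>R (\<Sum>j<k. a j *\<^sub>R tree_path x (map lab t) ! j)"
    by (simp add: scaleR_sum_right)
  then show ?thesis by (simp add: branch_norm_def)
qed

lemma branch_lim_triangle:
  assumes "unit_tree x k"
  shows "branch_lim x k (\<lambda>j. a j + b j) \<le> branch_lim x k a + branch_lim x k b"
  by (rule tendsto_le[OF ultra_not_bot[OF ultra_it] tendsto_add[OF branch_lim_tendsto[OF assms] branch_lim_tendsto[OF assms]]
        branch_lim_tendsto[OF assms]]) (simp add: branch_norm_triangle)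

lemma branch_lim_scale:
  assumes "unit_tree x k"
  shows "branch_lim x k (\<lambda>j. c * a j) = \<bar>c\<bar> * branch_lim x k a"
  by (rule tendsto_unique[OF ultra_not_bot[OF ultra_it] branch_lim_tendsto[OF assms]])
    (simp add: branch_norm_scale[abs_def] tendsto_mult_left branch_lim_tendsto[OF assms])

lemma branch_lim_unitv:
  assumes "unit_tree x k" "j < k"
  shows "branch_lim x k (unitv j) = 1"
proof (rule tendsto_unique[OF ultra_not_bot[OF ultra_it] branch_lim_tendsto[OF assms(1)]])
  have "\<forall>\<^sub>F t in iter U k. branch_norm x k (unitv j) t = 1"
    using eventually_iter_length
  proof eventually_elim
    case (elim t)
    have "(\<Sum>i<k. unitv j i *\<^sub>R tree_path x (map lab t) ! i) = (\<Sum>i<k. if i = j then tree_path x (map lab t) ! i else 0)"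
      by (intro sum.cong) (auto simp: unitv_def)
    then show ?case using assms elim by (simp add: branch_norm_def unit_tree_norm)
  qed
  then show "(branch_norm x k (unitv j) \<longlongrightarrow> 1) (iter U k)"
    by (rule tendsto_eventually)
qed

text \<open>A functional that norms the initial part \<open>v\<close> belongs to almost all later
  labels, so it vanishes on the later nodes and still sees \<open>norm v\<close> in the full sum.
  The condition on an entry is void until the first \<open>m\<close> entries, and with them
  \<open>v\<close>, are fixed.\<close>

lemma branch_lim_monotone:
  assumes x: "unit_tree x k" and m: "m \<le> k"
  shows "branch_lim x k (\<lambda>j. if j < m then a j else 0) \<le> branch_lim x k a"
proof -
  let ?b = "\<lambda>j. if j < m then a j else 0"
  have "\<exists>h :: 'a \<Rightarrow> 'a \<Rightarrow>\<^sub>L real. \<forall>v. blinfun_apply (h v) v = norm v \<and> (\<forall>u. \<bar>blinfun_apply (h v) u\<bar> \<le> norm u)"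
    using norming_functional by (intro choice) blast
  then obtain h :: "'a \<Rightarrow> 'a \<Rightarrow>\<^sub>L real" where
    h: "\<And>v. blinfun_apply (h v) v = norm v" "\<And>v u. \<bar>blinfun_apply (h v) u\<bar> \<le> norm u" by blast
  define v where "v t = (\<Sum>j<m. a j *\<^sub>R tree_path x (map lab t) ! j)" for t
  have "\<forall>\<^sub>F t in iter U k. length t = k \<and>
      (\<forall>i<k. m \<le> length (take i t) \<longrightarrow> blinfun_apply (h (v (take i t))) (x (map lab (take i t) @ [lab (t ! i)])) = 0)"
  proof (rule eventually_iter_step)
    fix s :: "'j list" assume s: "length s < k"
    show "\<forall>\<^sub>F \<sigma> in U. m \<le> length s \<longrightarrow> blinfun_apply (h (v s)) (x (map lab s @ [lab \<sigma>])) = 0"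
      using lab[of "h (v s)"] by eventually_elim (use x s in \<open>auto simp: unit_tree_def common_kernel_def\<close>)
  qed
  then have "\<forall>\<^sub>F t in iter U k. branch_norm x k ?b t \<le> 1 * branch_norm x k a t + 0"
  proof eventually_elim
    case (elim t)
    have path_take: "tree_path x (map lab (take i t)) ! j = tree_path x (map lab t) ! j" if "j < i" "i < k" for i j
      using that elim by (simp add: nth_tree_path take_map min_def)
    have v_take: "v (take i t) = v t" if "m \<le> i" "i < k" for i
      unfolding v_def using that by (intro sum.cong) (auto simp: path_take)
    have zero: "blinfun_apply (h (v t)) (tree_path x (map lab t) ! i) = 0" if "m \<le> i" "i < k" for i
    proof -
      have "tree_path x (map lab t) ! i = x (map lab (take i t) @ [lab (t ! i)])"
        using that elim by (simp add: nth_tree_path take_map take_Suc_conv_app_nth)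
      then show ?thesis using elim that v_take[OF that] by auto
    qed
    have split: "{..<k} = {..<m} \<union> {m..<k}" using m by auto
    have "(\<Sum>j<k. a j *\<^sub>R tree_path x (map lab t) ! j) = v t + (\<Sum>j=m..<k. a j *\<^sub>R tree_path x (map lab t) ! j)"
      unfolding split v_def by (rule sum.union_disjoint) auto
    then have "blinfun_apply (h (v t)) (\<Sum>j<k. a j *\<^sub>R tree_path x (map lab t) ! j) = norm (v t)"
      by (simp add: blinfun.add_right blinfun.sum_right blinfun.scaleR_right h zero)
    then have "norm (v t) \<le> branch_norm x k a t"
      using h(2)[of "v t" "\<Sum>j<k. a j *\<^sub>R tree_path x (map lab t) ! j"] by (simp add: branch_norm_def)
    moreover have "branch_norm x k ?b t = norm (v t)"
    proof -
      have "(\<Sum>j<k. ?b j *\<^sub>R tree_path x (map lab t) ! j) = (\<Sum>j<k. if j < m then a j *\<^sub>R tree_path x (map lab t) ! j else 0)"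
        by (intro sum.cong) auto
      also have "\<dots> = v t"
        unfolding v_def using m by (subst sum.inter_filter[symmetric]) (auto intro!: sum.cong)
      finally show ?thesis by (simp add: branch_norm_def)
    qed
    ultimately show ?case by simp
  qed
  from branch_lim_le[OF x this] show ?thesis by simp
qed

lemma coord_le_branch_lim:
  assumes x: "unit_tree x k" and j: "j < k"
  shows "\<bar>a j\<bar> \<le> 2 * branch_lim x k a"
proof -
  define b where "b = (\<lambda>i. if i < k then a i else 0)"
  have "\<bar>b j\<bar> \<le> 2 * branch_lim x k b"
    by (rule monotone_coord_le[where E = "branch_lim x k", OF branch_lim_triangle[OF x] branch_lim_scale[OF x]
          branch_lim_unitv[OF x j] branch_lim_monotone[OF x] _ j]) (simp_all add: b_def supp_in_def)
  then show ?thesis using branch_lim_monotone[OF x order_refl, of a] j by (simp add: b_def)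
qed

lemma norm_Rk_branch_lim:
  assumes x: "unit_tree x k"
  shows "norm_Rk_normalized_monotone k (branch_lim x k)"
  unfolding norm_Rk_normalized_monotone_def
proof (intro conjI allI impI)
  fix a assume a: "supp_in k a" "branch_lim x k a = 0"
  show "a = (\<lambda>_. 0)"
  proof
    fix j show "a j = 0"
      using a coord_le_branch_lim[OF x, of j a] by (cases "j < k") (auto simp: supp_in_def)
  qed
qed (auto simp: branch_lim_triangle[OF x] branch_lim_scale[OF x] branch_lim_unitv[OF x] branch_lim_monotone[OF x])

text \<open>Convergence at each coefficient vector becomes uniform by means of a finite grid in the
  cube, as both norms are 1-Lipschitz for the sum norm. An absolute error is also a relative one
  because the limit norm is at least 1/2 where the sup norm is 1.\<close>

lemma eventually_branch_equiv:
  assumes x: "unit_tree x k" and e: "e > 0"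
  shows "\<forall>\<^sub>F t in iter U k. fin_equiv k (1 + e) (branch_lim x k) (\<lambda>a. branch_norm x k a t)"
proof -
  \<comment> \<open>The equivalence constants will be \<open>1 / (1 - q)\<close> and
    \<open>1 + q\<close>, whose product is at most \<open>1 + e\<close>. The absolute error
    \<open>q / 2\<close> matches the lower bound 1/2 of the limit norm.\<close>
  define q where "q = min e 1 / 4"
  have q: "q > 0" "q \<le> 1 / 4" "q \<le> e / 4" using e by (auto simp: q_def)
  define \<eta> where "\<eta> = q / 2"
  have \<eta>: "\<eta> > 0" using q by (simp add: \<eta>_def)
  \<comment> \<open>Mesh \<open>1 / M\<close> puts every point of the cube within
    \<open>\<eta> / 3\<close> of the grid in the sum norm; the other two thirds are the error at the
    grid point and the return from it.\<close>
  obtain M :: nat where M: "M > 0" "3 * real k / \<eta> < real M"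
    using reals_Archimedean2[of "max 1 (3 * real k / \<eta>)"] by (metis max_less_iff_conj of_nat_0_less_iff zero_less_one less_trans)
  define V where "V = (\<lambda>i::int. of_int i / real M) ` {- int M..int M}"
  define G where "G = {g. \<forall>i. (i \<in> {..<k} \<longrightarrow> g i \<in> V) \<and> (i \<notin> {..<k} \<longrightarrow> g i = 0)}"
  have fin: "finite G" unfolding G_def V_def by (intro finite_set_of_finite_funs) auto
  have "\<forall>\<^sub>F t in iter U k. \<forall>g\<in>G. dist (branch_norm x k g t) (branch_lim x k g) < \<eta> / 3"
    using \<eta> by (intro eventually_ball_finite fin ballI tendstoD[OF branch_lim_tendsto[OF x]]) auto
  then show ?thesis
    using eventually_iter_length[of k U]
  proof eventually_elim
    case (elim t)
    have approx: "\<bar>branch_norm x k a t - branch_lim x k a\<bar> \<le> \<eta>" if a: "\<And>j. j < k \<Longrightarrow> \<bar>a j\<bar> \<le> 1" for a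
    proof -
      define g where "g j = (if j < k then of_int \<lfloor>a j * real M\<rfloor> / real M else 0)" for j
      have "g \<in> G"
      proof -
        have "of_int \<lfloor>a j * real M\<rfloor> / real M \<in> V" if j: "j < k" for j
        proof -
          have "- real M \<le> a j * real M" "a j * real M \<le> real M"
            using a[OF j] M(1) mult_right_mono[of "-1" "a j" "real M"] mult_right_mono[of "a j" 1 "real M"] by auto
          then have "\<lfloor>a j * real M\<rfloor> \<in> {- int M..int M}" by (auto simp: le_floor_iff) linarith
          then show ?thesis by (auto simp: V_def)
        qed
        then show ?thesis by (auto simp: G_def g_def)
      qed
      have close: "\<bar>a j - g j\<bar> \<le> 1 / real M" if "j < k" for j
      proof -
        have "\<bar>a j * real M - of_int \<lfloor>a j * real M\<rfloor>\<bar> \<le> 1" by linarith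
        then have "\<bar>a j * real M - of_int \<lfloor>a j * real M\<rfloor>\<bar> / real M \<le> 1 / real M"
          by (rule divide_right_mono) auto
        moreover have "a j - g j = (a j * real M - of_int \<lfloor>a j * real M\<rfloor>) / real M"
          using that M(1) by (simp add: g_def field_simps)
        ultimately show ?thesis by simp
      qed
      have "(\<Sum>j<k. \<bar>a j - g j\<bar>) \<le> (\<Sum>j<k. 1 / real M)" by (intro sum_mono) (auto simp: close)
      also have "\<dots> = real k / real M" by simp
      also have "\<dots> \<le> \<eta> / 3" using M \<eta> by (simp add: field_simps)
      finally have s: "(\<Sum>j<k. \<bar>a j - g j\<bar>) \<le> \<eta> / 3" .
      then have s': "(\<Sum>j<k. \<bar>g j - a j\<bar>) \<le> \<eta> / 3" by (simp add: abs_minus_commute)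
      have "\<bar>branch_norm x k g t - branch_lim x k g\<bar> < \<eta> / 3"
        using elim(1) \<open>g \<in> G\<close> by (simp add: dist_real_def)
      then show ?thesis
        using s s' branch_lim_Lipschitz[OF x, of a g] branch_lim_Lipschitz[OF x, of g a]
          branch_norm_Lipschitz[OF x elim(2), of a g] branch_norm_Lipschitz[OF x elim(2), of g a]
        by linarith
    qed
    have rel: "\<bar>branch_norm x k a t - branch_lim x k a\<bar> \<le> q * branch_lim x k a" for a
    proof (cases "\<forall>j<k. a j = 0")
      case True
      have "branch_norm x k a t = 0" using True by (simp add: branch_norm_def)
      moreover have "branch_lim x k a = 0"
      proof (rule tendsto_unique[OF ultra_not_bot[OF ultra_it] branch_lim_tendsto[OF x]])
        have "branch_norm x k a = (\<lambda>_. 0)" using True by (simp add: branch_norm_def fun_eq_iff)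
        then show "(branch_norm x k a \<longlongrightarrow> 0) (iter U k)" by simp
      qed
      ultimately show ?thesis by simp
    next
      case False
      define c where "c = Max ((\<lambda>j. \<bar>a j\<bar>) ` {..<k})"
      have fin: "finite ((\<lambda>j. \<bar>a j\<bar>) ` {..<k})" "(\<lambda>j. \<bar>a j\<bar>) ` {..<k} \<noteq> {}" using False by auto
      have le: "\<bar>a j\<bar> \<le> c" if "j < k" for j
        unfolding c_def by (rule Max_ge) (use that in auto)
      obtain i where i: "i < k" "c = \<bar>a i\<bar>" using Max_in[OF fin] unfolding c_def by auto
      have c: "c > 0" using False le by fastforce
      define b where "b j = (1 / c) * a j" for j
      have ab: "a = (\<lambda>j. c * b j)" using c by (auto simp: b_def)
      have b1: "\<bar>b j\<bar> \<le> 1" if "j < k" for j using le[OF that] c by (simp add: b_def abs_mult field_simps)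
      have "\<bar>b i\<bar> = 1" using i c by (simp add: b_def abs_mult)
      then have "1 \<le> 2 * branch_lim x k b" using coord_le_branch_lim[OF x i(1), of b] by simp
      then have "\<eta> \<le> q * branch_lim x k b" using q by (simp add: \<eta>_def field_simps)
      then have "\<bar>branch_norm x k b t - branch_lim x k b\<bar> \<le> q * branch_lim x k b"
        using approx[of b] b1 by (meson order_trans)
      then have "c * \<bar>branch_norm x k b t - branch_lim x k b\<bar> \<le> c * (q * branch_lim x k b)"
        using c by (intro mult_left_mono) auto
      moreover have "branch_norm x k a t - branch_lim x k a = c * (branch_norm x k b t - branch_lim x k b)"
        unfolding ab branch_norm_scale branch_lim_scale[OF x] using c by (simp add: algebra_simps)
      moreover have "branch_lim x k a = c * branch_lim x k b"
        unfolding ab branch_lim_scale[OF x] using c by simp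
      ultimately show ?thesis using c by (simp add: abs_mult mult.left_commute)
    qed
    show ?case
      unfolding fin_equiv_def
    proof (rule exI[of _ "1 / (1 - q)"], rule exI[of _ "1 + q"], intro conjI allI impI)
      have "1 + q \<le> (1 + e) * (1 - q)"
      proof -
        have "e * q \<le> e / 4" using mult_left_mono[OF q(2), of e] e by simp
        moreover have "(1 + e) * (1 - q) = 1 + e - q - e * q" by (simp add: algebra_simps)
        ultimately show ?thesis using q(3) e by linarith
      qed
      then show "1 / (1 - q) * (1 + q) \<le> 1 + e" using q by (simp add: field_simps)
    next
      fix a
      show "branch_lim x k a / (1 / (1 - q)) \<le> branch_norm x k a t"
        using rel[of a] by (simp add: algebra_simps)
      show "branch_norm x k a t \<le> (1 + q) * branch_lim x k a"
        using rel[of a] by (simp add: algebra_simps)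
    qed (use q in auto)
  qed
qed

text \<open>Almost all indices preserve the remaining condition and almost all have their kernel
  inside the subspace just played; any index with both properties supplies the answer.\<close>

lemma eventually_asym_game:
  assumes x: "unit_tree x k"
    and ev: "\<forall>\<^sub>F t in iter U n. fin_equiv k (1 + e) E (\<lambda>a. branch_norm x k a (s @ t))"
    and n: "length s + n = k"
  shows "asym_game E e k (tree_path x (map lab s)) n"
  using ev n
proof (induction n arbitrary: s)
  case 0
  then show ?case by (simp add: eventually_iter_0 branch_norm_def)
next
  case (Suc n)
  show ?case
    unfolding asym_game.simps
  proof (intro allI impI)
    fix Y :: "'a set" assume "cofin_subspace Y"
    then have "\<forall>\<^sub>F \<sigma> in U. common_kernel (lab \<sigma>) \<subseteq> Y" by (rule eventually_kernel_le)
    with Suc.prems(1)[unfolded eventually_iter_Suc]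
    have "\<forall>\<^sub>F \<sigma> in U. (\<forall>\<^sub>F t in iter U n. fin_equiv k (1 + e) E (\<lambda>a. branch_norm x k a (s @ \<sigma> # t))) \<and>
        common_kernel (lab \<sigma>) \<subseteq> Y"
      by (rule eventually_conj)
    then obtain \<sigma> where \<sigma>: "\<forall>\<^sub>F t in iter U n. fin_equiv k (1 + e) E (\<lambda>a. branch_norm x k a (s @ \<sigma> # t))"
      "common_kernel (lab \<sigma>) \<subseteq> Y" using eventually_ex_ultra[OF ultra] by blast
    have "asym_game E e k (tree_path x (map lab (s @ [\<sigma>]))) n"
      by (rule Suc.IH) (use \<sigma> Suc.prems in auto)
    then show "\<exists>y\<in>Y. norm y = 1 \<and> asym_game E e k (tree_path x (map lab s) @ [y]) n"
      using x \<sigma>(2) Suc.prems(2)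
      by (intro bexI[of _ "x (map lab s @ [lab \<sigma>])"]) (auto simp: tree_path_snoc unit_tree_def)
  qed
qed

lemma branch_lim_asym_struct:
  assumes x: "unit_tree x k"
  shows "branch_lim x k \<in> asym_struct TYPE('a) k"
  using norm_Rk_branch_lim[OF x] eventually_asym_game[OF x, where n = k and s = "[]" and E = "branch_lim x k"]
    eventually_branch_equiv[OF x] by (auto simp: asym_struct_def)

end

section \<open>The game in asymptotic-c0 spaces\<close>

lemma linf_norm_unitv: "j < k \<Longrightarrow> linf_norm k (unitv j) = 1"
  unfolding linf_norm_def by (rule Max_eqI) (auto simp: unitv_def intro!: rev_image_eqI[of j])

lemma linf_norm_le: "c \<ge> 0 \<Longrightarrow> (\<And>j. j < k \<Longrightarrow> \<bar>a j\<bar> \<le> c) \<Longrightarrow> linf_norm k a \<le> c"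
  by (auto simp: linf_norm_def)

lemma linf_norm_ge: "j < k \<Longrightarrow> \<bar>a j\<bar> \<le> linf_norm k a"
  unfolding linf_norm_def by (rule Max_ge) auto

lemma linf_norm_nonneg: "0 \<le> linf_norm k a"
  unfolding linf_norm_def by (rule Max_ge) auto

text \<open>A winning strategy is normalised to a tree of unit vectors, whose limit norm lies in the
  asymptotic structure. The lengths removed by normalisation become coefficients that depend on the
  branch; hence the need for an equivalence on one branch that is uniform in the
  coefficients.\<close>

lemma (in null_ultrafilter) asymptotic_c0_game:
  assumes c: "c \<ge> 1" "\<And>E. E \<in> asym_struct TYPE('a) k \<Longrightarrow> fin_equiv k c E (linf_norm k)"
  shows "\<not> game (\<lambda>ys. 2 * c < norm (sum_list ys)) (\<lambda>\<Phi>. common_kernel \<Phi> \<inter> cball (0::'a) 1) [] k"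
proof
  assume "game (\<lambda>ys. 2 * c < norm (sum_list ys)) (\<lambda>\<Phi>. common_kernel \<Phi> \<inter> cball (0::'a) 1) [] k"
  from game_strategy[OF this] obtain y where
    y: "\<And>s \<Phi>. length s < k \<Longrightarrow> y (s @ [\<Phi>]) \<in> common_kernel \<Phi> \<inter> cball (0::'a) 1" and
    big: "\<And>s. length s = k \<Longrightarrow> 2 * c < norm (sum_list (tree_path y s))" by blast
  have sum_path: "sum_list (tree_path z s) = (\<Sum>j<length s. tree_path z s ! j)" for z :: "('a \<Rightarrow>\<^sub>L real) list list \<Rightarrow> 'a" and s
    by (simp add: sum_list_sum_nth atLeast0LessThan)
  \<comment> \<open>Against a trivial kernel, played in every round, the strategy could only answer
    0.\<close>
  have unit: "\<exists>u\<in>common_kernel \<Phi>. norm (u::'a) = 1" for \<Phi>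
  proof (rule ccontr)
    assume no: "\<not> ?thesis"
    have zero: "u = 0" if "u \<in> common_kernel \<Phi>" for u
    proof (rule ccontr)
      assume "u \<noteq> 0"
      then show False using no subspace_scale[OF subspace_common_kernel that, of "1 / norm u"] by auto
    qed
    have "tree_path y (replicate k \<Phi>) ! i = 0" if "i < k" for i
    proof -
      have "tree_path y (replicate k \<Phi>) ! i = y (replicate i \<Phi> @ [\<Phi>])"
        using that by (simp add: nth_tree_path min_def replicate_append_same)
      then show ?thesis using y[of "replicate i \<Phi>" \<Phi>] that zero by auto
    qed
    then show False using big[of "replicate k \<Phi>"] c(1) by (simp add: sum_path)
  qed
  define u where "u \<Phi> = (SOME v::'a. v \<in> common_kernel \<Phi> \<and> norm v = 1)" for \<Phi>
  have u: "u \<Phi> \<in> common_kernel \<Phi>" "norm (u \<Phi>) = 1" for \<Phi>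
    using someI_ex[of "\<lambda>v. v \<in> common_kernel \<Phi> \<and> norm v = 1"] unit[of \<Phi>] unfolding u_def by auto
  \<comment> \<open>At a zero node any unit vector of the kernel will do, as it enters with
    coefficient 0.\<close>
  define x where "x s = (if y s = 0 then u (last s) else (1 / norm (y s)) *\<^sub>R y s)" for s
  have yx: "y s = norm (y s) *\<^sub>R x s" for s by (simp add: x_def)
  have x: "unit_tree x k"
    unfolding unit_tree_def
  proof (intro allI impI)
    fix s :: "('a \<Rightarrow>\<^sub>L real) list list" and \<Phi> assume "length s < k"
    then show "x (s @ [\<Phi>]) \<in> common_kernel \<Phi> \<and> norm (x (s @ [\<Phi>])) = 1"
      using u y[of s \<Phi>] by (auto simp: x_def intro: subspace_scale[OF subspace_common_kernel])
  qed
  let ?E = "branch_lim x k"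
  have "k \<noteq> 0"
  proof
    assume "k = 0" then show False using big[of "[]"] c(1) by simp
  qed
  obtain t where t: "length t = k" "fin_equiv k (1 + 1) ?E (\<lambda>a. branch_norm x k a t)"
    using eventually_ex_ultra[OF ultra_it eventually_conj[OF eventually_iter_length eventually_branch_equiv[OF x]]]
    by (metis zero_less_one)
  define a where "a j = (if j < k then norm (y (take (Suc j) (map lab t))) else 0)" for j
  have a1: "\<bar>a j\<bar> \<le> 1" for j
    using y[of "take j (map lab t)" "lab (t ! j)"] t(1) by (auto simp: a_def take_Suc_conv_app_nth)
  have supp: "supp_in k a" "supp_in k (unitv 0)"
    using \<open>k \<noteq> 0\<close> by (auto simp: supp_in_def a_def unitv_def)
  have "2 * c < branch_norm x k a t"
  proof -
    have "(\<Sum>j<k. a j *\<^sub>R tree_path x (map lab t) ! j) = (\<Sum>j<k. tree_path y (map lab t) ! j)"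
      using t(1) by (intro sum.cong) (auto simp: a_def nth_tree_path yx[symmetric])
    then show ?thesis using big[of "map lab t"] t(1) by (simp add: branch_norm_def sum_path)
  qed
  \<comment> \<open>The first unit vector has limit norm 1 and branch norm at most 1, so
    \<open>A \<ge> 1\<close>, and \<open>A * B \<le> 2\<close> bounds \<open>B\<close>
    alone.\<close>
  moreover have "branch_norm x k a t \<le> 2 * ?E a"
  proof -
    obtain A B where AB: "A > 0" "B > 0" "A * B \<le> 2"
      "\<And>a. supp_in k a \<Longrightarrow> ?E a / A \<le> branch_norm x k a t \<and> branch_norm x k a t \<le> B * ?E a"
      using t(2) by (auto simp: fin_equiv_def)
    have "branch_norm x k (unitv 0) t \<le> 1"
    proof -
      have "(\<Sum>j<k. \<bar>unitv 0 j\<bar>) = (\<Sum>j<k. if j = 0 then 1 else 0)"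
        by (intro sum.cong) (auto simp: unitv_def)
      then show ?thesis using branch_norm_le[OF x t(1), of "unitv 0"] \<open>k \<noteq> 0\<close> by simp
    qed
    then have "1 / A \<le> 1" using AB(4)[OF supp(2)] branch_lim_unitv[OF x, of 0] \<open>k \<noteq> 0\<close> by simp
    then have "A \<ge> 1" using AB(1) by (simp add: field_simps)
    then have "1 * B \<le> A * B" using AB(2) by (intro mult_right_mono) auto
    then have "B \<le> 2" using AB(3) by simp
    moreover have "?E a \<ge> 0" using coord_le_branch_lim[OF x, of 0 a] \<open>k \<noteq> 0\<close> by simp
    ultimately show ?thesis using AB(4)[OF supp(1)] mult_right_mono[of B 2 "?E a"] by linarith
  qed
  moreover have "?E a \<le> c"
  proof -
    obtain A B where AB: "A > 0" "B > 0" "A * B \<le> c"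
      "\<And>a. supp_in k a \<Longrightarrow> ?E a / A \<le> linf_norm k a \<and> linf_norm k a \<le> B * ?E a"
      using c(2)[OF branch_lim_asym_struct[OF x]] by (auto simp: fin_equiv_def)
    have "1 \<le> B" using AB(4)[OF supp(2)] branch_lim_unitv[OF x, of 0] linf_norm_unitv[of 0 k] \<open>k \<noteq> 0\<close> by simp
    then have "A * 1 \<le> A * B" using AB(1) by (intro mult_left_mono) auto
    then have "A \<le> c" using AB(3) by simp
    have "?E a \<le> A * linf_norm k a" using AB(4)[OF supp(1)] AB(1) by (simp add: field_simps)
    also have "\<dots> \<le> A * 1" using AB(1) a1 by (intro mult_left_mono linf_norm_le) auto
    finally show ?thesis using \<open>A \<le> c\<close> by simp
  qed
  ultimately show False by linarith
qed

section \<open>Concentration in reflexive asymptotic-c0 spaces\<close>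

text \<open>The limits of \<open>f (v n)\<close> form a bounded functional of \<open>f\<close>, an
  element of the bidual, which reflexivity represents by a vector.\<close>

lemma weak_limit_exists:
  fixes v :: "nat \<Rightarrow> 'a::real_normed_vector"
  assumes refl: "reflexive_X TYPE('a)" and W: "ultra W" and R: "\<And>n. norm (v n) \<le> R"
  shows "\<exists>x. \<forall>f :: 'a \<Rightarrow>\<^sub>L real. ((\<lambda>n. blinfun_apply f (v n)) \<longlongrightarrow> blinfun_apply f x) W"
proof -
  define \<phi> where "\<phi> f = Lim W (\<lambda>n. blinfun_apply f (v n))" for f :: "'a \<Rightarrow>\<^sub>L real"
  have b: "\<bar>blinfun_apply f (v n)\<bar> \<le> norm f * R" for f :: "'a \<Rightarrow>\<^sub>L real" and n
    using norm_blinfun[of f "v n"] mult_left_mono[OF R[of n], of "norm f"] by simp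
  have lim: "((\<lambda>n. blinfun_apply f (v n)) \<longlongrightarrow> \<phi> f) W" for f
    unfolding \<phi>_def by (rule ultra_tendsto_Lim[OF W]) (use b in \<open>auto intro: always_eventually\<close>)
  note W0 = ultra_not_bot[OF W]
  have "bounded_linear \<phi>"
  proof (rule bounded_linear_intro)
    fix f g
    show "\<phi> (f + g) = \<phi> f + \<phi> g"
      by (rule tendsto_unique[OF W0 lim]) (simp add: blinfun.add_left tendsto_add lim)
  next
    fix r f
    show "\<phi> (r *\<^sub>R f) = r *\<^sub>R \<phi> f"
      by (rule tendsto_unique[OF W0 lim]) (simp add: blinfun.scaleR_left tendsto_mult_left lim)
  next
    fix f
    show "norm (\<phi> f) \<le> norm f * R"
      by (rule tendsto_upperbound[OF tendsto_norm[OF lim] _ W0]) (use b in \<open>auto intro: always_eventually\<close>)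
  qed
  then obtain x where "\<And>f. blinfun_apply (Blinfun \<phi>) f = blinfun_apply f x"
    using refl unfolding reflexive_X_def by metis
  then have "\<phi> f = blinfun_apply f x" for f
    using \<open>bounded_linear \<phi>\<close> by (simp add: bounded_linear_Blinfun_apply)
  then show ?thesis using lim by auto
qed

lemma weak_limit_norm_le:
  fixes x :: "'a::real_normed_vector"
  assumes "W \<noteq> bot" "\<And>f :: 'a \<Rightarrow>\<^sub>L real. ((\<lambda>n. blinfun_apply f (v n)) \<longlongrightarrow> blinfun_apply f x) W"
    and "\<forall>\<^sub>F n in W. norm (v n) \<le> L"
  shows "norm x \<le> L"
proof -
  obtain f :: "'a \<Rightarrow>\<^sub>L real" where f: "blinfun_apply f x = norm x" "\<And>u. \<bar>blinfun_apply f u\<bar> \<le> norm u"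
    using norming_functional by blast
  have "\<forall>\<^sub>F n in W. blinfun_apply f (v n) \<le> L"
    using assms(3) by eventually_elim (use f(2) in \<open>smt (verit)\<close>)
  then show ?thesis using tendsto_upperbound[OF assms(2)[of f] _ assms(1)] f(1) by simp
qed

text \<open>The iterated weak limit of \<open>F\<close> over the \<open>n\<close> entries that
  follow the prefix \<open>s\<close>. Passing from \<open>s\<close> to \<open>s @ [p]\<close> at one
  level less changes it by an increment that is weakly null in \<open>p\<close>, and these
  increments telescope to \<open>F m - weak_tree W F k []\<close>.\<close>

primrec weak_tree :: "nat filter \<Rightarrow> (nat list \<Rightarrow> 'a::real_normed_vector) \<Rightarrow> nat \<Rightarrow> nat list \<Rightarrow> 'a" where
  "weak_tree W F 0 s = F s"
| "weak_tree W F (Suc n) s = (SOME x. \<forall>f :: 'a \<Rightarrow>\<^sub>L real.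
     ((\<lambda>p. blinfun_apply f (weak_tree W F n (s @ [p]))) \<longlongrightarrow> blinfun_apply f x) W)"

declare weak_tree.simps(2) [simp del]

context
  fixes W :: "nat filter" and F :: "nat list \<Rightarrow> 'a::real_normed_vector" and R :: real
  assumes refl: "reflexive_X TYPE('a)" and W: "ultra W" "W \<le> sequentially"
    and R: "\<And>s. norm (F s) \<le> R"
begin

lemma weak_tree_tendsto:
    "((\<lambda>p. blinfun_apply (f :: 'a \<Rightarrow>\<^sub>L real) (weak_tree W F n (s @ [p]))) \<longlongrightarrow> blinfun_apply f (weak_tree W F (Suc n) s)) W"
proof -
  have lim: "((\<lambda>p. blinfun_apply f (weak_tree W F n (s @ [p]))) \<longlongrightarrow> blinfun_apply f (weak_tree W F (Suc n) s)) W"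
    if "\<And>s. norm (weak_tree W F n s) \<le> R" for n s and f :: "'a \<Rightarrow>\<^sub>L real"
    using someI_ex[OF weak_limit_exists[OF refl W(1), of "\<lambda>p. weak_tree W F n (s @ [p])" R]] that
    by (simp add: weak_tree.simps(2))
  have bound: "norm (weak_tree W F n s) \<le> R" for n s
  proof (induction n arbitrary: s)
    case 0
    then show ?case using R by simp
  next
    case (Suc n)
    show ?case
      by (rule weak_limit_norm_le[OF ultra_not_bot[OF W(1)] lim[OF Suc]]) (simp add: Suc)
  qed
  show "((\<lambda>p. blinfun_apply f (weak_tree W F n (s @ [p]))) \<longlongrightarrow> blinfun_apply f (weak_tree W F (Suc n) s)) W"
    by (rule lim[OF bound])
qed

lemma eventually_greater: "finite S \<Longrightarrow> \<forall>\<^sub>F p in W. \<forall>q\<in>S. q < p"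
  by (intro eventually_ball_finite ballI filter_leD[OF W(2)] eventually_gt_at_top)

context
  fixes k :: nat
  assumes Lipschitz: "\<And>s t. length s = k \<Longrightarrow> length t = k \<Longrightarrow> sorted_wrt (<) s \<Longrightarrow> sorted_wrt (<) t \<Longrightarrow>
      card {j. j < k \<and> s ! j \<noteq> t ! j} \<le> 1 \<Longrightarrow> norm (F s - F t) \<le> 1"
begin

text \<open>Both lists are continued by the same large \<open>p\<close>, which keeps them increasing
  and adds no differing position; the norm is weakly lower semicontinuous.\<close>

lemma weak_tree_Lipschitz:
  assumes "length s + n = k" "length t = length s" "sorted_wrt (<) s" "sorted_wrt (<) t"
    "card {j. j < length s \<and> s ! j \<noteq> t ! j} \<le> 1"
  shows "norm (weak_tree W F n s - weak_tree W F n t) \<le> 1"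
  using assms
proof (induction n arbitrary: s t)
  case 0
  then show ?case using Lipschitz by simp
next
  case (Suc n)
  have "\<forall>\<^sub>F p in W. \<forall>q\<in>set s \<union> set t. q < p" by (rule eventually_greater) simp
  then have "\<forall>\<^sub>F p in W. norm (weak_tree W F n (s @ [p]) - weak_tree W F n (t @ [p])) \<le> 1"
  proof eventually_elim
    case (elim p)
    have "{j. j < length (s @ [p]) \<and> (s @ [p]) ! j \<noteq> (t @ [p]) ! j} = {j. j < length s \<and> s ! j \<noteq> t ! j}"
      using Suc.prems(2) by (auto simp: nth_append less_Suc_eq)
    then show ?case
      using Suc.prems elim by (intro Suc.IH) (auto simp: sorted_wrt_append)
  qed
  then show ?case
    by (rule weak_limit_norm_le[OF ultra_not_bot[OF W(1)], rotated])
      (simp add: blinfun.diff_right tendsto_diff weak_tree_tendsto)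
qed

lemma weak_tree_increment_le:
  assumes "Suc (length s) + n = k" "sorted_wrt (<) (s @ [p])"
  shows "norm (weak_tree W F n (s @ [p]) - weak_tree W F (Suc n) s) \<le> 1"
proof (rule weak_limit_norm_le[OF ultra_not_bot[OF W(1)]])
  fix f :: "'a \<Rightarrow>\<^sub>L real"
  show "((\<lambda>q. blinfun_apply f (weak_tree W F n (s @ [p]) - weak_tree W F n (s @ [q]))) \<longlongrightarrow>
      blinfun_apply f (weak_tree W F n (s @ [p]) - weak_tree W F (Suc n) s)) W"
    by (simp add: blinfun.diff_right tendsto_diff weak_tree_tendsto)
  have "\<forall>\<^sub>F q in W. \<forall>r\<in>set s. r < q" by (rule eventually_greater) simp
  then show "\<forall>\<^sub>F q in W. norm (weak_tree W F n (s @ [p]) - weak_tree W F n (s @ [q])) \<le> 1"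
  proof eventually_elim
    case (elim q)
    have "{j. j < length (s @ [p]) \<and> (s @ [p]) ! j \<noteq> (s @ [q]) ! j} \<subseteq> {length s}"
      by (auto simp: nth_append less_Suc_eq)
    from card_mono[OF _ this] show ?case
      using assms elim by (intro weak_tree_Lipschitz) (auto simp: sorted_wrt_append)
  qed
qed

text \<open>Since the vector player does not win, after every position there is a label
  \<open>\<Phi>\<close> that keeps the play losing for him. Answering with approximations of the
  weakly null increments makes \<open>F m\<close> follow such a play, which ends with a sum of norm
  at most \<open>C\<close>. The lower bound \<open>b\<close> serves to place a second branch beyond
  the first.\<close>

lemma small_branch_aux:
  assumes "\<delta> > 0" "length s + n = k" "sorted_wrt (<) s" "\<forall>q\<in>set s. b \<le> q"
    and "norm (weak_tree W F n s - weak_tree W F k [] - sum_list ys) \<le> \<delta> * real (length s)"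
    and "\<not> game (\<lambda>ys. C < norm (sum_list ys)) (\<lambda>\<Phi>. common_kernel \<Phi> \<inter> cball (0::'a) 1) ys n"
  shows "\<exists>m. length m = k \<and> sorted_wrt (<) m \<and> (\<forall>q\<in>set m. b \<le> q) \<and>
      norm (F m - weak_tree W F k []) \<le> C + \<delta> * real k"
  using assms(2-)
proof (induction n arbitrary: s ys)
  case 0
  have "norm (F s - weak_tree W F k []) \<le> norm (sum_list ys) + norm (F s - weak_tree W F k [] - sum_list ys)"
    using norm_triangle_ineq[of "sum_list ys" "F s - weak_tree W F k [] - sum_list ys"] by simp
  then show ?case using 0 by (intro exI[of _ s]) auto
next
  case (Suc n)
  let ?S = "\<lambda>\<Phi>. common_kernel \<Phi> \<inter> cball (0::'a) 1"
  let ?v = "\<lambda>p. weak_tree W F n (s @ [p]) - weak_tree W F (Suc n) s"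
  have "\<exists>\<Phi>. \<forall>y\<in>?S \<Phi>. \<not> game (\<lambda>ys. C < norm (sum_list ys)) ?S (ys @ [y]) n"
    using Suc.prems(5) by simp
  then obtain \<Phi> where \<Phi>: "\<forall>y\<in>?S \<Phi>. \<not> game (\<lambda>ys. C < norm (sum_list ys)) ?S (ys @ [y]) n"
    by (rule exE)
  obtain K where K: "\<And>z. \<exists>y\<in>common_kernel \<Phi>. norm (z - y) \<le> K * (\<Sum>f\<leftarrow>\<Phi>. \<bar>blinfun_apply f z\<bar>)"
    using common_kernel_approx[of \<Phi>] by blast
  have "((\<lambda>p. \<bar>blinfun_apply f (?v p)\<bar>) \<longlongrightarrow> 0) W" for f :: "'a \<Rightarrow>\<^sub>L real"
  proof -
    have "((\<lambda>p. blinfun_apply f (?v p)) \<longlongrightarrow> 0) W"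
      using tendsto_diff[OF weak_tree_tendsto[of f n s] tendsto_const[of "blinfun_apply f (weak_tree W F (Suc n) s)"]]
      by (simp add: blinfun.diff_right)
    then show ?thesis by (rule tendsto_rabs_zero)
  qed
  then have "((\<lambda>p. \<Sum>f\<leftarrow>\<Phi>. \<bar>blinfun_apply f (?v p)\<bar>) \<longlongrightarrow> 0) W"
    by (induction \<Phi>) (auto intro: tendsto_add_zero)
  then have "((\<lambda>p. K * (\<Sum>f\<leftarrow>\<Phi>. \<bar>blinfun_apply f (?v p)\<bar>)) \<longlongrightarrow> 0) W"
    by (rule tendsto_mult_right_zero)
  then have "\<forall>\<^sub>F p in W. K * (\<Sum>f\<leftarrow>\<Phi>. \<bar>blinfun_apply f (?v p)\<bar>) < \<delta> / 2"
    using assms(1) by (auto dest: order_tendstoD(2)[of _ _ _ "\<delta> / 2"])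
  moreover have "\<forall>\<^sub>F p in W. \<forall>q\<in>set s. q < p" by (rule eventually_greater) simp
  moreover have "\<forall>\<^sub>F p in W. b \<le> p" by (rule filter_leD[OF W(2) eventually_ge_at_top])
  ultimately have "\<forall>\<^sub>F p in W. K * (\<Sum>f\<leftarrow>\<Phi>. \<bar>blinfun_apply f (?v p)\<bar>) < \<delta> / 2 \<and> (\<forall>q\<in>set s. q < p) \<and> b \<le> p"
    by eventually_elim simp
  then obtain p where p: "K * (\<Sum>f\<leftarrow>\<Phi>. \<bar>blinfun_apply f (?v p)\<bar>) < \<delta> / 2" "\<forall>q\<in>set s. q < p" "b \<le> p"
    using eventually_ex_ultra[OF W(1)] by blast
  obtain y where y: "y \<in> common_kernel \<Phi>" "norm (?v p - y) \<le> \<delta> / 2" using K[of "?v p"] p(1) by force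
  have sorted: "sorted_wrt (<) (s @ [p])" using Suc.prems(2) p(2) by (simp add: sorted_wrt_append)
  have v1: "norm (?v p) \<le> 1" using weak_tree_increment_le[OF _ sorted, of n] Suc.prems(1) by simp
  \<comment> \<open>Dividing by this bound for \<open>norm y\<close> returns to the unit ball;
    approximation and rescaling cost \<open>\<delta> / 2\<close> each.\<close>
  define r where "r = 1 + \<delta> / 2"
  have r: "r > 0" using assms(1) by (simp add: r_def)
  define y' where "y' = (1 / r) *\<^sub>R y"
  have yy: "y = r *\<^sub>R y'" using r by (simp add: y'_def)
  have "norm y \<le> r" using norm_triangle_ineq2[of y "?v p"] v1 y(2) by (simp add: r_def norm_minus_commute)
  then have y'1: "norm y' \<le> 1" using r by (simp add: y'_def)
  have "norm (?v p - y') \<le> norm (?v p - y) + norm (y - y')"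
    using norm_triangle_ineq[of "?v p - y" "y - y'"] by simp
  also have "y - y' = (\<delta> / 2) *\<^sub>R y'" by (simp add: yy r_def algebra_simps)
  also have "norm \<dots> \<le> \<delta> / 2 * 1" using assms(1) y'1 by simp
  finally have vy: "norm (?v p - y') \<le> \<delta>" using y(2) by simp
  have "y' \<in> ?S \<Phi>" using y(1) y'1 by (auto simp: y'_def intro: subspace_scale[OF subspace_common_kernel])
  then have "\<not> game (\<lambda>ys. C < norm (sum_list ys)) ?S (ys @ [y']) n" by (rule bspec[OF \<Phi>])
  moreover have "norm (weak_tree W F n (s @ [p]) - weak_tree W F k [] - sum_list (ys @ [y'])) \<le> \<delta> * real (length (s @ [p]))"
  proof -
    have "weak_tree W F n (s @ [p]) - weak_tree W F k [] - sum_list (ys @ [y']) =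
        (weak_tree W F (Suc n) s - weak_tree W F k [] - sum_list ys) + (?v p - y')"
      by simp
    also have "norm \<dots> \<le> \<delta> * real (length s) + \<delta>"
      by (rule order_trans[OF norm_triangle_ineq add_mono[OF Suc.prems(4) vy]])
    finally show ?thesis by (simp add: algebra_simps)
  qed
  ultimately show ?case using Suc.prems sorted p(3) by (intro Suc.IH[of "s @ [p]" "ys @ [y']"]) auto
qed

end

end

section \<open>Diameter and concentration on k-subsets\<close>

lemma norm_1supp_unc_zero:
  assumes "norm_1supp_unc N"
  shows "N (\<lambda>_. 0) = 0"
proof -
  have "\<forall>a c. fin_supp a \<longrightarrow> N (\<lambda>j. c * a j) = \<bar>c\<bar> * N a"
    using assms unfolding norm_1supp_unc_def by (elim conjE)
  moreover have "fin_supp (\<lambda>_. 0)" by (simp add: fin_supp_def)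
  ultimately have "N (\<lambda>j. 0 * 0) = \<bar>0\<bar> * N (\<lambda>_. 0)" by blast
  then show ?thesis by simp
qed

text \<open>If \<open>norm_1supp_unc N\<close>, then \<open>N (ones k)\<close> is the diameter,
  attained at any two points that differ in every coordinate.\<close>

definition ones :: "nat \<Rightarrow> nat \<Rightarrow> real" where
  "ones k j = (if j < k then 1 else 0)"

lemma dk_le_ones:
  assumes "norm_1supp_unc N"
  shows "dk N k m n \<le> N (ones k)"
proof -
  have "fin_supp (ones k)" by (simp add: fin_supp_def ones_def)
  then have "N (\<lambda>j. if j \<in> {j. sorted_list_of_set m ! j \<noteq> sorted_list_of_set n ! j} then ones k j else 0) \<le> N (ones k)"
    using assms unfolding norm_1supp_unc_def by blast
  moreover have "(\<lambda>j. if j \<in> {j. sorted_list_of_set m ! j \<noteq> sorted_list_of_set n ! j} then ones k j else 0) =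
      (\<lambda>j. if j < k \<and> sorted_list_of_set m ! j \<noteq> sorted_list_of_set n ! j then 1 else 0)"
    by (auto simp: ones_def)
  ultimately show ?thesis by (simp add: dk_def)
qed

lemma dk_eq_ones:
  assumes "\<And>j. j < k \<Longrightarrow> sorted_list_of_set m ! j \<noteq> sorted_list_of_set n ! j"
  shows "dk N k m n = N (ones k)"
proof -
  have "(\<lambda>j. if j < k \<and> sorted_list_of_set m ! j \<noteq> sorted_list_of_set n ! j then 1 else 0) = ones k"
    using assms by (auto simp: ones_def)
  then show ?thesis by (simp add: dk_def)
qed

lemma kset_nonempty: "{..<k} \<in> kset k"
  by (simp add: kset_def)

lemma diam_k_le:
  assumes "norm_1supp_unc N"
  shows "diam_k N k \<le> N (ones k)"
  unfolding diam_k_def by (rule cSUP_least) (use kset_nonempty[of k] dk_le_ones[OF assms] in auto)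

lemma sorted_list_of_set_strict: "sorted_wrt (<) s \<Longrightarrow> sorted_list_of_set (set s) = s" for s :: "nat list"
  by (simp add: strict_sorted_iff sorted_list_of_set.idem_if_sorted_distinct)

lemma set_in_kset: "sorted_wrt (<) s \<Longrightarrow> length s = k \<Longrightarrow> set s \<in> kset k" for s :: "nat list"
  by (simp add: kset_def strict_sorted_iff distinct_card)

lemma concentration:
  fixes f :: "nat set \<Rightarrow> 'a::banach"
  assumes refl: "reflexive_X TYPE('a)"
    and game: "\<not> game (\<lambda>ys. C < norm (sum_list ys)) (\<lambda>\<Phi>. common_kernel \<Phi> \<inter> cball (0::'a) 1) [] k"
    and N: "norm_1supp_unc N"
    and f: "\<And>m n. m \<in> kset k \<Longrightarrow> n \<in> kset k \<Longrightarrow> dist (f m) (f n) \<le> dk N k m n"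
  shows "\<exists>m\<in>kset k. \<exists>n\<in>kset k. dk N k m n = N (ones k) \<and> dist (f m) (f n) \<le> 2 * (C + 1)"
proof -
  obtain W :: "nat filter" where W: "W \<le> sequentially" "ultra W"
    using ultra_exists[of "sequentially"] by auto
  \<comment> \<open>The default value keeps \<open>F\<close> bounded on all lists, so that every
    weak limit exists.\<close>
  define F where "F s = (if set s \<in> kset k then f (set s) else f {..<k})" for s
  have "norm (F s) \<le> norm (f {..<k}) + N (ones k)" for s
  proof -
    have N0: "N (ones k) \<ge> 0"
      using dk_le_ones[OF N, of k "{}" "{}"] norm_1supp_unc_zero[OF N] by (simp add: dk_def)
    have "norm (f (set s)) \<le> norm (f {..<k}) + N (ones k)" if "set s \<in> kset k"
      using f[OF that kset_nonempty] dk_le_ones[OF N, of k "set s" "{..<k}"]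
        norm_triangle_ineq2[of "f (set s)" "f {..<k}"] by (simp add: dist_norm)
    then show ?thesis using N0 by (simp add: F_def)
  qed
  note bound = this
  have Lip: "norm (F s - F t) \<le> 1"
    if "length s = k" "length t = k" "sorted_wrt (<) s" "sorted_wrt (<) t" "card {j. j < k \<and> s ! j \<noteq> t ! j} \<le> 1"
    for s t
  proof -
    have "norm (F s - F t) \<le> dk N k (set s) (set t)"
      using that f[of "set s" "set t"] by (simp add: F_def set_in_kset dist_norm)
    also have "\<dots> = N (\<lambda>j. if j < k \<and> s ! j \<noteq> t ! j then 1 else 0)"
      using that by (simp add: dk_def sorted_list_of_set_strict)
    also have "\<dots> \<le> 1"
    proof (cases "{j. j < k \<and> s ! j \<noteq> t ! j} = {}")
      case True
      then have "(\<lambda>j. if j < k \<and> s ! j \<noteq> t ! j then 1 else 0) = (\<lambda>_. 0::real)" by (auto simp: fun_eq_iff)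
      then show ?thesis using norm_1supp_unc_zero[OF N] by simp
    next
      case False
      then have "card {j. j < k \<and> s ! j \<noteq> t ! j} \<noteq> 0" by simp
      then have "card {j. j < k \<and> s ! j \<noteq> t ! j} = 1" using that(5) by linarith
      then obtain i where "{j. j < k \<and> s ! j \<noteq> t ! j} = {i}" by (rule card_1_singletonE)
      then have "(\<lambda>j. if j < k \<and> s ! j \<noteq> t ! j then 1 else 0) = unitv i"
        by (auto simp: unitv_def fun_eq_iff)
      then show ?thesis using N by (simp add: norm_1supp_unc_def)
    qed
    finally show ?thesis .
  qed
  \<comment> \<open>The error per entry is \<open>1 / (real k + 1)\<close>, so that \<open>k\<close>
    entries together cost at most 1.\<close>
  have *: "\<exists>m. length m = k \<and> sorted_wrt (<) m \<and> (\<forall>q\<in>set m. b \<le> q) \<and>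
      norm (F m - weak_tree W F k []) \<le> C + 1 / (real k + 1) * real k" for b
    by (rule small_branch_aux[OF refl W(2) W(1) bound Lip, where s = "[]" and ys = "[]" and n = k and b = b])
      (use game in auto)
  have "C + 1 / (real k + 1) * real k \<le> C + 1" by (simp add: field_simps)
  then have ex: "\<exists>m. length m = k \<and> sorted_wrt (<) m \<and> (\<forall>q\<in>set m. b \<le> q) \<and>
      norm (F m - weak_tree W F k []) \<le> C + 1" for b
    using *[of b] by (elim exE conjE) (intro exI conjI, assumption+, rule order_trans)
  obtain m where m: "length m = k" "sorted_wrt (<) m" "norm (F m - weak_tree W F k []) \<le> C + 1"
    using ex[of 0] by (elim exE conjE)
  obtain n where n: "length n = k" "sorted_wrt (<) n" "norm (F n - weak_tree W F k []) \<le> C + 1"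
    "\<forall>q\<in>set n. Suc (Max (set m)) \<le> q"
    using ex[of "Suc (Max (set m))"] by (elim exE conjE)
  have "m ! j \<noteq> n ! j" if "j < k" for j
  proof -
    have "m ! j \<le> Max (set m)" "n ! j \<in> set n" using that m(1) n(1) by auto
    then show ?thesis using n(4) by force
  qed
  then have "dk N k (set m) (set n) = N (ones k)"
    using m n by (intro dk_eq_ones) (simp add: sorted_list_of_set_strict)
  moreover have "dist (f (set m)) (f (set n)) \<le> 2 * (C + 1)"
    using m n norm_triangle_ineq4[of "F m - weak_tree W F k []" "F n - weak_tree W F k []"]
    by (simp add: F_def set_in_kset dist_norm)
  ultimately have "dk N k (set m) (set n) = N (ones k) \<and> dist (f (set m)) (f (set n)) \<le> 2 * (C + 1)" ..
  then have "\<exists>n\<in>kset k. dk N k (set m) n = N (ones k) \<and> dist (f (set m)) (f n) \<le> 2 * (C + 1)"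
    by (rule bexI[OF _ set_in_kset[OF n(2,1)]])
  then show ?thesis by (rule bexI[OF _ set_in_kset[OF m(2,1)]])
qed

text \<open>Dividing an embedding by \<open>s * D\<close> makes it 1-Lipschitz;
  \<open>concentration\<close> then provides two points at distance equal to the diameter whose
  images are \<open>2 * (C + 1)\<close>-close, which bounds \<open>D\<close> from below by a
  multiple of the diameter.\<close>

lemma distortion_infinite:
  assumes refl: "reflexive_X TYPE('a::banach)" and C: "C > 0"
    and game: "\<And>k. \<not> game (\<lambda>ys. C < norm (sum_list ys)) (\<lambda>\<Phi>. common_kernel \<Phi> \<inter> cball (0::'a) 1) [] k"
    and N: "norm_1supp_unc N" "filterlim (diam_k N) at_top sequentially"
  shows "(SUP k. distortion (UNIV::'a set) (kset k) (dk N k)) = \<infinity>"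
proof -
  let ?C = "2 * (C + 1)"
  have lower: "ereal (diam_k N k / ?C) \<le> distortion (UNIV::'a set) (kset k) (dk N k)" for k
    unfolding distortion_def
  proof (rule Inf_greatest)
    fix r assume "r \<in> {ereal D |D. 1 \<le> D \<and> embeds_with (kset k) (dk N k) (UNIV::'a set) D}"
    then obtain D where r: "r = ereal D" and D: "1 \<le> D" "embeds_with (kset k) (dk N k) (UNIV::'a set) D"
      by blast
    from D(2) obtain s and f :: "nat set \<Rightarrow> 'a" where s: "s > 0" and
      f: "\<And>x y. x \<in> kset k \<Longrightarrow> y \<in> kset k \<Longrightarrow> s * dk N k x y \<le> dist (f x) (f y) \<and> dist (f x) (f y) \<le> s * D * dk N k x y"
      unfolding embeds_with_def by blast
    define g where "g x = (1 / (s * D)) *\<^sub>R f x" for x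
    have sD: "s * D > 0" using s D by simp
    have dg: "dist (g x) (g y) = dist (f x) (f y) / (s * D)" for x y
      using s D by (simp add: g_def dist_norm scaleR_diff_right[symmetric])
    have "dist (g x) (g y) \<le> dk N k x y" if "x \<in> kset k" "y \<in> kset k" for x y
      using f[OF that] sD by (simp add: dg divide_le_eq mult.commute)
    from concentration[OF refl game N(1) this]
    obtain m n where mn: "m \<in> kset k" "n \<in> kset k" "dk N k m n = N (ones k)" "dist (g m) (g n) \<le> ?C" by blast
    have "s * diam_k N k \<le> s * dk N k m n" using s diam_k_le[OF N(1), of k] mn(3) by simp
    also have "\<dots> \<le> dist (f m) (f n)" using f[OF mn(1,2)] by simp
    also have "\<dots> \<le> ?C * (s * D)" using mn(4) sD by (simp add: dg divide_le_eq)
    finally have "s * diam_k N k \<le> s * (D * ?C)" by (simp add: mult_ac)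
    then have "diam_k N k \<le> D * ?C" using s by simp
    then have "diam_k N k / ?C \<le> D" using C by (simp add: divide_le_eq)
    then show "ereal (diam_k N k / ?C) \<le> r" by (simp add: r)
  qed
  show ?thesis
  proof (rule ereal_top)
    fix B
    have "\<forall>\<^sub>F k in sequentially. B * ?C \<le> diam_k N k" using N(2) by (simp add: filterlim_at_top)
    then obtain k where "B * ?C \<le> diam_k N k" by (auto simp: eventually_sequentially)
    then have "B \<le> diam_k N k / ?C" using C by (simp add: le_divide_eq)
    then have "ereal B \<le> ereal (diam_k N k / ?C)" by simp
    also have "\<dots> \<le> distortion (UNIV::'a set) (kset k) (dk N k)" by (rule lower)
    also have "\<dots> \<le> (SUP k. distortion (UNIV::'a set) (kset k) (dk N k))" by (rule SUP_upper) simp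
    finally show "ereal B \<le> (SUP k. distortion (UNIV::'a set) (kset k) (dk N k))" .
  qed
qed

section \<open>Iterated limits of arrays\<close>

text \<open>Weak-star compactness of the dual ball, stated for any ultrafilter as it is applied to
  both \<open>U\<close> and its powers.\<close>

lemma functional_limit:
  fixes h :: "'s \<Rightarrow> 'a::real_normed_vector \<Rightarrow>\<^sub>L real"
  assumes V: "ultra V" and h: "\<And>s u. \<bar>blinfun_apply (h s) u\<bar> \<le> norm u"
  shows "\<exists>f :: 'a \<Rightarrow>\<^sub>L real. (\<forall>u. \<bar>blinfun_apply f u\<bar> \<le> norm u) \<and>
      (\<forall>u. ((\<lambda>s. blinfun_apply (h s) u) \<longlongrightarrow> blinfun_apply f u) V)"
proof -
  note V0 = ultra_not_bot[OF V]
  define \<phi> where "\<phi> u = Lim V (\<lambda>s. blinfun_apply (h s) u)" for u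
  have lim: "((\<lambda>s. blinfun_apply (h s) u) \<longlongrightarrow> \<phi> u) V" for u
    unfolding \<phi>_def by (rule ultra_tendsto_Lim[OF V, where B = "norm u"]) (simp add: h)
  have bound: "\<bar>\<phi> u\<bar> \<le> norm u" for u
    by (rule tendsto_upperbound[OF tendsto_rabs[OF lim] _ V0]) (simp add: h)
  have "bounded_linear \<phi>"
  proof (rule bounded_linear_intro)
    fix u v
    show "\<phi> (u + v) = \<phi> u + \<phi> v"
      by (rule tendsto_unique[OF V0 lim]) (simp add: blinfun.add_right tendsto_add lim)
  next
    fix r u
    show "\<phi> (r *\<^sub>R u) = r *\<^sub>R \<phi> u"
      by (rule tendsto_unique[OF V0 lim]) (simp add: blinfun.scaleR_right tendsto_mult_left lim)
  next
    fix u
    show "norm (\<phi> u) \<le> norm u * 1" using bound by simp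
  qed
  then show ?thesis
    using lim bound by (intro exI[of _ "Blinfun \<phi>"]) (simp add: bounded_linear_Blinfun_apply)
qed

context null_ultrafilter
begin

definition bounded_row :: "('j \<Rightarrow> 'a) \<Rightarrow> bool" where
  "bounded_row r \<longleftrightarrow> (\<exists>B. \<forall>\<sigma>. norm (r \<sigma>) \<le> B)"

text \<open>Values are required to vanish exactly for almost all indices, not merely to tend to 0.
  Vectors taken in the kernels of the labels have this property, and it removes error terms from the
  limits below.\<close>

definition null_row :: "('j \<Rightarrow> 'a) \<Rightarrow> bool" where
  "null_row r \<longleftrightarrow> bounded_row r \<and> (\<forall>f :: 'a \<Rightarrow>\<^sub>L real. \<forall>\<^sub>F \<sigma> in U. blinfun_apply f (r \<sigma>) = 0)"

lemma null_row_bounded: "null_row r \<Longrightarrow> bounded_row r"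
  by (simp add: null_row_def)

lemma bounded_row_scale: "bounded_row r \<Longrightarrow> bounded_row (\<lambda>\<sigma>. c *\<^sub>R r \<sigma>)"
proof -
  assume "bounded_row r"
  then obtain B where "\<And>\<sigma>. norm (r \<sigma>) \<le> B" by (auto simp: bounded_row_def)
  then have "norm (c *\<^sub>R r \<sigma>) \<le> \<bar>c\<bar> * B" for \<sigma> by (simp add: mult_left_mono)
  then show ?thesis by (auto simp: bounded_row_def)
qed

lemma null_row_scale: "null_row r \<Longrightarrow> null_row (\<lambda>\<sigma>. c *\<^sub>R r \<sigma>)"
  unfolding null_row_def by (auto simp: bounded_row_scale blinfun.scaleR_right elim: eventually_mono)

fun row_sum :: "('j \<Rightarrow> 'a) list \<Rightarrow> 'j list \<Rightarrow> 'a" where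
  "row_sum (r # rs) (\<sigma> # s) = r \<sigma> + row_sum rs s"
| "row_sum _ _ = 0"

text \<open>The vector \<open>v\<close> collects the entries already fixed, so that inductions can
  remove the outermost row.\<close>

definition row_lim :: "'a \<Rightarrow> ('j \<Rightarrow> 'a) list \<Rightarrow> real" where
  "row_lim v rs = Lim (iter U (length rs)) (\<lambda>s. norm (v + row_sum rs s))"

lemma row_sum_nth: "length s = length rs \<Longrightarrow> row_sum rs s = (\<Sum>q<length rs. (rs ! q) (s ! q))"
  by (induction rs s rule: list_induct2') (simp_all add: sum.lessThan_Suc_shift del: sum.lessThan_Suc)

lemma row_sum_bounded: "(\<And>r. r \<in> set rs \<Longrightarrow> bounded_row r) \<Longrightarrow> \<exists>B. \<forall>s. norm (row_sum rs s) \<le> B"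
proof (induction rs)
  case Nil
  then show ?case by (intro exI[of _ 0]) simp
next
  case (Cons r rs)
  then obtain B where B: "\<And>s. norm (row_sum rs s) \<le> B" by auto
  obtain B' where B': "\<And>\<sigma>. norm (r \<sigma>) \<le> B'" using Cons.prems[of r] by (auto simp: bounded_row_def)
  have "norm (row_sum (r # rs) s) \<le> \<bar>B'\<bar> + \<bar>B\<bar>" for s
  proof (cases s)
    case (Cons \<sigma> s')
    then show ?thesis
      using norm_triangle_mono[of "r \<sigma>" "\<bar>B'\<bar>" "row_sum rs s'" "\<bar>B\<bar>"] B[of s'] B'[of \<sigma>] by simp
  qed simp
  then show ?case by blast
qed

lemma row_lim_tendsto:
  assumes "\<And>r. r \<in> set rs \<Longrightarrow> bounded_row r"
  shows "((\<lambda>s. norm (v + row_sum rs s)) \<longlongrightarrow> row_lim v rs) (iter U (length rs))"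
proof -
  obtain B where B: "\<And>s. norm (row_sum rs s) \<le> B" using row_sum_bounded[OF assms] by blast
  have "norm (v + row_sum rs s) \<le> norm v + B" for s
    using norm_triangle_ineq[of v "row_sum rs s"] B[of s] by simp
  then show ?thesis
    unfolding row_lim_def by (intro ultra_tendsto_Lim[OF ultra_it, where B = "norm v + B"]) simp
qed

lemma row_lim_Nil [simp]: "row_lim v [] = norm v"
  using tendsto_unique[OF ultra_not_bot[OF ultra_it] row_lim_tendsto[of "[]" v]] by simp

lemma row_lim_Cons_tendsto:
  assumes "\<And>r'. r' \<in> set (r # rs) \<Longrightarrow> bounded_row r'"
  shows "((\<lambda>\<sigma>. row_lim (v + r \<sigma>) rs) \<longlongrightarrow> row_lim v (r # rs)) U"
proof (rule tendsto_iter_Suc[OF ultra])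
  show "((\<lambda>s. norm (v + row_sum (r # rs) s)) \<longlongrightarrow> row_lim v (r # rs)) (iter U (Suc (length rs)))"
    using row_lim_tendsto[of "r # rs" v, OF assms] by simp
  show "((\<lambda>s. norm (v + row_sum (r # rs) (\<sigma> # s))) \<longlongrightarrow> row_lim (v + r \<sigma>) rs) (iter U (length rs))" for \<sigma>
    using row_lim_tendsto[of rs "v + r \<sigma>"] assms by (simp add: add.assoc)
qed

text \<open>The source of unconditionality. The functionals norming \<open>v + row_sum rs s\<close>
  have a weak-star limit \<open>f\<close> that is independent of \<open>r\<close>; evaluated at the
  sum enlarged by \<open>r \<sigma>\<close> they give \<open>row_lim v rs + f (r \<sigma>)\<close>
  in the limit, and \<open>f\<close> annihilates almost all \<open>r \<sigma>\<close>.\<close>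

lemma eventually_row_lim_drop:
  assumes r: "null_row r" and rs: "\<And>r'. r' \<in> set rs \<Longrightarrow> bounded_row r'"
  shows "\<forall>\<^sub>F \<sigma> in U. row_lim v rs \<le> row_lim (v + r \<sigma>) rs"
proof -
  have "\<exists>h :: 'j list \<Rightarrow> 'a \<Rightarrow>\<^sub>L real. \<forall>s. blinfun_apply (h s) (v + row_sum rs s) = norm (v + row_sum rs s) \<and>
      (\<forall>u. \<bar>blinfun_apply (h s) u\<bar> \<le> norm u)"
    by (rule choice) (intro allI norming_functional)
  then obtain h :: "'j list \<Rightarrow> 'a \<Rightarrow>\<^sub>L real" where
    h: "\<And>s. blinfun_apply (h s) (v + row_sum rs s) = norm (v + row_sum rs s)"
    "\<And>s u. \<bar>blinfun_apply (h s) u\<bar> \<le> norm u" by blast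
  obtain f :: "'a \<Rightarrow>\<^sub>L real" where
    f: "\<And>u. ((\<lambda>s. blinfun_apply (h s) u) \<longlongrightarrow> blinfun_apply f u) (iter U (length rs))"
    using functional_limit[OF ultra_it, of h "length rs"] h(2) by blast
  have "\<forall>\<^sub>F \<sigma> in U. blinfun_apply f (r \<sigma>) = 0" using r by (simp add: null_row_def)
  then show ?thesis
  proof eventually_elim
    case (elim \<sigma>)
    have "row_lim v rs + blinfun_apply f (r \<sigma>) \<le> row_lim (v + r \<sigma>) rs"
    proof (rule tendsto_le[OF ultra_not_bot[OF ultra_it] row_lim_tendsto[OF rs] tendsto_add[OF row_lim_tendsto[OF rs] f]])
      have "norm (v + row_sum rs s) + blinfun_apply (h s) (r \<sigma>) \<le> norm (v + r \<sigma> + row_sum rs s)" for s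
      proof -
        have "norm (v + row_sum rs s) + blinfun_apply (h s) (r \<sigma>) = blinfun_apply (h s) (v + r \<sigma> + row_sum rs s)"
          unfolding h(1)[symmetric] by (simp add: blinfun.add_right)
        then show ?thesis using h(2)[of s "v + r \<sigma> + row_sum rs s"] by simp
      qed
      then show "\<forall>\<^sub>F s in iter U (length rs). norm (v + row_sum rs s) + blinfun_apply (h s) (r \<sigma>) \<le> norm (v + r \<sigma> + row_sum rs s)"
        by simp
    qed
    then show ?case using elim by simp
  qed
qed

lemma row_lim_drop:
  assumes r: "null_row r" and rs: "\<And>r'. r' \<in> set rs \<Longrightarrow> bounded_row r'"
  shows "row_lim v rs \<le> row_lim v (r # rs)"
  by (rule tendsto_lowerbound[OF row_lim_Cons_tendsto eventually_row_lim_drop[OF assms] ultra_not_bot[OF ultra]])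
    (use assms null_row_bounded in auto)

lemma row_lim_Cons_mono:
  assumes "\<And>w. row_lim w rs \<le> row_lim w rs'" "bounded_row r"
    "\<And>r. r \<in> set rs \<Longrightarrow> bounded_row r" "\<And>r. r \<in> set rs' \<Longrightarrow> bounded_row r"
  shows "row_lim v (r # rs) \<le> row_lim v (r # rs')"
  by (rule tendsto_le[OF ultra_not_bot[OF ultra] row_lim_Cons_tendsto row_lim_Cons_tendsto]) (use assms in auto)

text \<open>Rows may repeat and may carry signs. The lower estimate of the embedding needs
  both.\<close>

lemma row_lim_subseq:
  assumes "subseq rs rs'" "\<And>r. r \<in> set rs' \<Longrightarrow> null_row r"
  shows "row_lim v rs \<le> row_lim v rs'"
  using assms
proof (induction arbitrary: v rule: list_emb.induct)
  case (list_emb_Nil ys)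
  then show ?case
  proof (induction ys arbitrary: v)
    case (Cons r ys)
    then show ?case using row_lim_drop[of r ys v] null_row_bounded by (force intro: order_trans)
  qed simp
next
  case (list_emb_Cons xs ys y)
  then show ?case using row_lim_drop[of y ys v] null_row_bounded by (force intro: order_trans)
next
  case (list_emb_Cons2 x y xs ys)
  have "set xs \<subseteq> set ys" using list_emb_Cons2(2) by (metis set_nths_subset subseq_conv_nths)
  then show ?case
    using list_emb_Cons2 by (auto intro!: row_lim_Cons_mono null_row_bounded)
qed

lemma row_lim_Cons_zero:
  assumes "\<And>r. r \<in> set rs \<Longrightarrow> bounded_row r"
  shows "row_lim v ((\<lambda>_. 0) # rs) = row_lim v rs"
proof -
  have "((\<lambda>\<sigma>::'j. row_lim (v + 0) rs) \<longlongrightarrow> row_lim v ((\<lambda>_. 0) # rs)) U"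
    by (rule row_lim_Cons_tendsto) (use assms in \<open>auto simp: bounded_row_def\<close>)
  then show ?thesis using tendsto_unique[OF ultra_not_bot[OF ultra] _ tendsto_const] by auto
qed

lemma row_lim_filter:
  assumes "\<And>j. j \<in> set js \<Longrightarrow> bounded_row (R j)" "\<And>j. j \<in> set js \<Longrightarrow> \<not> P j \<Longrightarrow> R j = (\<lambda>_. 0)"
  shows "row_lim v (map R (filter P js)) = row_lim v (map R js)"
  using assms
proof (induction js arbitrary: v)
  case (Cons j js)
  show ?case
  proof (cases "P j")
    case True
    have "row_lim w (map R (filter P js)) = row_lim w (map R js)" for w
      by (rule Cons.IH) (use Cons.prems in auto)
    then have "row_lim v (R j # map R (filter P js)) = row_lim v (R j # map R js)"
      by (intro antisym row_lim_Cons_mono) (use Cons.prems in auto)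
    then show ?thesis using True by simp
  next
    case False
    have "row_lim v (map R (filter P js)) = row_lim v (map R js)"
      by (rule Cons.IH) (use Cons.prems in auto)
    moreover have "row_lim v ((\<lambda>_. 0) # map R js) = row_lim v (map R js)"
      by (rule row_lim_Cons_zero) (use Cons.prems in auto)
    moreover have "R j = (\<lambda>_. 0)" using Cons.prems(2)[of j] False by simp
    ultimately show ?thesis using False by simp
  qed
qed simp

lemma row_lim_convex:
  assumes rs: "\<And>r. r \<in> set rs \<Longrightarrow> bounded_row r" and c: "0 \<le> c" "c \<le> 1"
  shows "row_lim ((1 - c) *\<^sub>R v + c *\<^sub>R w) rs \<le> (1 - c) * row_lim v rs + c * row_lim w rs"
proof (rule tendsto_le[OF ultra_not_bot[OF ultra_it]])
  show "((\<lambda>s. (1 - c) * norm (v + row_sum rs s) + c * norm (w + row_sum rs s)) \<longlongrightarrow>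
      (1 - c) * row_lim v rs + c * row_lim w rs) (iter U (length rs))"
    by (intro tendsto_intros row_lim_tendsto rs)
  show "((\<lambda>s. norm ((1 - c) *\<^sub>R v + c *\<^sub>R w + row_sum rs s)) \<longlongrightarrow> row_lim ((1 - c) *\<^sub>R v + c *\<^sub>R w) rs) (iter U (length rs))"
    by (intro row_lim_tendsto rs)
  have "norm ((1 - c) *\<^sub>R v + c *\<^sub>R w + row_sum rs s) \<le> (1 - c) * norm (v + row_sum rs s) + c * norm (w + row_sum rs s)" for s
  proof -
    have "(1 - c) *\<^sub>R v + c *\<^sub>R w + row_sum rs s = (1 - c) *\<^sub>R (v + row_sum rs s) + c *\<^sub>R (w + row_sum rs s)"
      by (simp add: algebra_simps)
    also have "norm \<dots> \<le> norm ((1 - c) *\<^sub>R (v + row_sum rs s)) + norm (c *\<^sub>R (w + row_sum rs s))"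
      by (rule norm_triangle_ineq)
    finally show ?thesis using c by simp
  qed
  then show "\<forall>\<^sub>F s in iter U (length rs). norm ((1 - c) *\<^sub>R v + c *\<^sub>R w + row_sum rs s)
      \<le> (1 - c) * norm (v + row_sum rs s) + c * norm (w + row_sum rs s)" by simp
qed

section \<open>The sequence norm defined by an array\<close>

definition row_comb :: "(nat \<Rightarrow> 'j \<Rightarrow> 'a) \<Rightarrow> (nat \<Rightarrow> real) \<Rightarrow> nat list \<Rightarrow> real" where
  "row_comb x a js = row_lim 0 (map (\<lambda>j \<sigma>. a j *\<^sub>R x j \<sigma>) js)"

lemma row_comb_tendsto:
  assumes x: "\<forall>j. null_row (x j)"
  shows "((\<lambda>s. norm (row_sum (map (\<lambda>j \<sigma>. a j *\<^sub>R x j \<sigma>) js) s)) \<longlongrightarrow> row_comb x a js) (iter U (length js))"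
proof -
  have b: "bounded_row r" if "r \<in> set (map (\<lambda>j \<sigma>. a j *\<^sub>R x j \<sigma>) js)" for r
    using that x by (auto simp: bounded_row_scale null_row_bounded)
  show ?thesis using row_lim_tendsto[of "map (\<lambda>j \<sigma>. a j *\<^sub>R x j \<sigma>) js" 0, OF b] by (simp add: row_comb_def)
qed

lemma row_sum_map_add:
  "row_sum (map (\<lambda>j \<sigma>. (a j + b j) *\<^sub>R x j \<sigma>) js) s =
    row_sum (map (\<lambda>j \<sigma>. a j *\<^sub>R x j \<sigma>) js) s + row_sum (map (\<lambda>j \<sigma>. b j *\<^sub>R x j \<sigma>) js) s"
  by (induction js s rule: list_induct2') (auto simp: scaleR_add_left)

lemma row_sum_map_scale:
  "row_sum (map (\<lambda>j \<sigma>. (c * a j) *\<^sub>R x j \<sigma>) js) s = c *\<^sub>R row_sum (map (\<lambda>j \<sigma>. a j *\<^sub>R x j \<sigma>) js) s"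
  by (induction js s rule: list_induct2') (auto simp: scaleR_add_right)

lemma row_comb_triangle:
  assumes x: "\<forall>j. null_row (x j)"
  shows "row_comb x (\<lambda>j. a j + b j) js \<le> row_comb x a js + row_comb x b js"
  by (rule tendsto_le[OF ultra_not_bot[OF ultra_it]
        tendsto_add[OF row_comb_tendsto[OF x] row_comb_tendsto[OF x]] row_comb_tendsto[OF x]])
    (simp add: row_sum_map_add norm_triangle_ineq)

lemma row_comb_scale:
  assumes x: "\<forall>j. null_row (x j)"
  shows "row_comb x (\<lambda>j. c * a j) js = \<bar>c\<bar> * row_comb x a js"
  by (rule tendsto_unique[OF ultra_not_bot[OF ultra_it] row_comb_tendsto[OF x]])
    (simp add: row_sum_map_scale tendsto_mult_left row_comb_tendsto[OF x])

lemma row_comb_cong: "(\<And>j. j \<in> set js \<Longrightarrow> a j = b j) \<Longrightarrow> row_comb x a js = row_comb x b js"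
  by (simp add: row_comb_def cong: map_cong)

lemma row_comb_filter:
  assumes x: "\<forall>j. null_row (x j)" and "\<And>j. j \<in> set js \<Longrightarrow> \<not> P j \<Longrightarrow> a j = 0"
  shows "row_comb x a (filter P js) = row_comb x a js"
  unfolding row_comb_def
  by (rule row_lim_filter) (use assms in \<open>auto simp: bounded_row_scale null_row_bounded\<close>)

lemma row_comb_subseq:
  assumes x: "\<forall>j. null_row (x j)" and "subseq js js'"
  shows "row_comb x a js \<le> row_comb x a js'"
  unfolding row_comb_def
proof (rule row_lim_subseq)
  show "subseq (map (\<lambda>j \<sigma>. a j *\<^sub>R x j \<sigma>) js) (map (\<lambda>j \<sigma>. a j *\<^sub>R x j \<sigma>) js')"
    by (rule subseq_map[OF assms(2)])
  show "null_row r" if "r \<in> set (map (\<lambda>j \<sigma>. a j *\<^sub>R x j \<sigma>) js')" for r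
    using that x by (auto simp: null_row_scale)
qed

text \<open>The least bound of the support makes the value depend on \<open>a\<close> alone; by
  \<open>row_norm_eq\<close> any other bound gives the same value, as zero rows do not change an
  iterated limit.\<close>

definition row_norm :: "(nat \<Rightarrow> 'j \<Rightarrow> 'a) \<Rightarrow> (nat \<Rightarrow> real) \<Rightarrow> real" where
  "row_norm x a = row_comb x a [0..<LEAST K. \<forall>j\<ge>K. a j = 0]"

lemma row_norm_eq:
  assumes x: "\<forall>j. null_row (x j)" and K: "\<And>j. j \<ge> K \<Longrightarrow> a j = 0"
  shows "row_norm x a = row_comb x a [0..<K]"
proof -
  define L where "L = (LEAST K. \<forall>j\<ge>K. a j = 0)"
  have L: "\<forall>j\<ge>L. a j = 0" unfolding L_def by (rule LeastI[of _ K]) (use K in auto)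
  have "L \<le> K" unfolding L_def by (rule Least_le) (use K in auto)
  then have "[0..<K] = [0..<L] @ [L..<K]" using upt_add_eq_append[of 0 L "K - L"] by simp
  moreover have "filter (\<lambda>j. j < L) [0..<L] = [0..<L]" "filter (\<lambda>j. j < L) [L..<K] = []"
    by (auto simp: filter_empty_conv filter_id_conv)
  ultimately have "filter (\<lambda>j. j < L) [0..<K] = [0..<L]" by simp
  moreover have "row_comb x a (filter (\<lambda>j. j < L) [0..<K]) = row_comb x a [0..<K]"
    by (rule row_comb_filter[OF x]) (use L in auto)
  ultimately show ?thesis by (simp add: row_norm_def L_def)
qed

lemma fin_supp_bound:
  assumes "fin_supp a"
  shows "\<exists>K. \<forall>j\<ge>K. a j = 0"
proof -
  obtain K where K: "{j. a j \<noteq> 0} \<subseteq> {..<K}"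
    using assms finite_nat_iff_bounded unfolding fin_supp_def by blast
  have "a j = 0" if "j \<ge> K" for j
  proof (rule ccontr)
    assume "a j \<noteq> 0"
    then have "j \<in> {..<K}" using K by auto
    then show False using that by simp
  qed
  then show ?thesis by blast
qed

lemma row_norm_suppression:
  assumes x: "\<forall>j. null_row (x j)" and "fin_supp a"
  shows "row_norm x (\<lambda>j. if j \<in> A then a j else 0) \<le> row_norm x a"
proof -
  obtain K where K: "\<And>j. j \<ge> K \<Longrightarrow> a j = 0" using fin_supp_bound[OF assms(2)] by blast
  let ?b = "\<lambda>j. if j \<in> A then a j else 0"
  have "row_norm x ?b = row_comb x ?b [0..<K]" by (rule row_norm_eq[OF x]) (simp add: K)
  also have "\<dots> = row_comb x ?b (filter (\<lambda>j. j \<in> A) [0..<K])" by (rule row_comb_filter[OF x, symmetric]) simp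
  also have "\<dots> = row_comb x a (filter (\<lambda>j. j \<in> A) [0..<K])" by (rule row_comb_cong) simp
  also have "\<dots> \<le> row_comb x a [0..<K]" by (rule row_comb_subseq[OF x]) simp
  also have "\<dots> = row_norm x a" by (rule row_norm_eq[OF x, symmetric]) (rule K)
  finally show ?thesis .
qed

lemma row_norm_scale:
  assumes x: "\<forall>j. null_row (x j)" and "fin_supp a"
  shows "row_norm x (\<lambda>j. c * a j) = \<bar>c\<bar> * row_norm x a"
proof -
  obtain K where K: "\<And>j. j \<ge> K \<Longrightarrow> a j = 0" using fin_supp_bound[OF assms(2)] by blast
  have "row_norm x (\<lambda>j. c * a j) = row_comb x (\<lambda>j. c * a j) [0..<K]"
    by (rule row_norm_eq[OF x]) (simp add: K)
  moreover have "row_norm x a = row_comb x a [0..<K]" by (rule row_norm_eq[OF x]) (rule K)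
  ultimately show ?thesis by (simp add: row_comb_scale[OF x])
qed

lemma row_norm_unitv:
  assumes x: "\<forall>j. null_row (x j)" and x1: "\<forall>j \<sigma>. norm (x j \<sigma>) = 1"
  shows "row_norm x (unitv j) = 1"
proof -
  have "row_norm x (unitv j) = row_comb x (unitv j) [0..<Suc j]"
    by (rule row_norm_eq[OF x]) (simp add: unitv_def)
  also have "\<dots> = row_comb x (unitv j) (filter (\<lambda>i. i = j) [0..<Suc j])"
    by (rule row_comb_filter[OF x, symmetric]) (simp add: unitv_def)
  also have "filter (\<lambda>i. i = j) [0..<Suc j] = [j]" by (simp add: filter_empty_conv)
  also have "row_comb x (unitv j) [j] = row_lim 0 [x j]" by (simp add: row_comb_def unitv_def)
  also have "\<dots> = 1"
  proof (rule tendsto_unique[OF ultra_not_bot[OF ultra] row_lim_Cons_tendsto])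
    show "((\<lambda>\<sigma>. row_lim (0 + x j \<sigma>) []) \<longlongrightarrow> 1) U" using x1 by simp
  qed (use x null_row_bounded in auto)
  finally show ?thesis .
qed

lemma coord_le_row_norm:
  assumes x: "\<forall>j. null_row (x j)" and x1: "\<forall>j \<sigma>. norm (x j \<sigma>) = 1" and a: "fin_supp a"
  shows "\<bar>a j\<bar> \<le> row_norm x a"
proof -
  have e: "(\<lambda>i. if i \<in> {j} then a i else 0) = (\<lambda>i. a j * unitv j i)" by (auto simp: unitv_def)
  have "fin_supp (unitv j)" by (simp add: fin_supp_def unitv_def)
  then have "row_norm x (\<lambda>i. a j * unitv j i) = \<bar>a j\<bar>"
    by (simp add: row_norm_scale[OF x] row_norm_unitv[OF x x1])
  then show ?thesis using row_norm_suppression[OF x a, where A = "{j}"] unfolding e by simp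
qed

lemma norm_1supp_unc_row_norm:
  assumes x: "\<forall>j. null_row (x j)" and x1: "\<forall>j \<sigma>. norm (x j \<sigma>) = 1"
  shows "norm_1supp_unc (row_norm x)"
  unfolding norm_1supp_unc_def
proof (intro conjI allI impI)
  fix a b assume ab: "fin_supp a" "fin_supp b"
  obtain K where K: "\<And>j. j \<ge> K \<Longrightarrow> a j = 0" using fin_supp_bound[OF ab(1)] by blast
  obtain L where L: "\<And>j. j \<ge> L \<Longrightarrow> b j = 0" using fin_supp_bound[OF ab(2)] by blast
  have "row_norm x (\<lambda>j. a j + b j) = row_comb x (\<lambda>j. a j + b j) [0..<max K L]"
    "row_norm x a = row_comb x a [0..<max K L]" "row_norm x b = row_comb x b [0..<max K L]"
    by (rule row_norm_eq[OF x]; simp add: K L)+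
  then show "row_norm x (\<lambda>j. a j + b j) \<le> row_norm x a + row_norm x b"
    by (simp add: row_comb_triangle[OF x])
next
  fix a assume a: "fin_supp a" "row_norm x a = 0"
  show "a = (\<lambda>_. 0)"
  proof
    fix j show "a j = 0" using coord_le_row_norm[OF x x1 a(1), of j] a(2) by simp
  qed
qed (simp_all add: row_norm_scale[OF x] row_norm_suppression[OF x] row_norm_unitv[OF x x1])

end

section \<open>Embedding the metric spaces along an array\<close>

context null_ultrafilter
begin

text \<open>A diagonal choice of one index for each time, such that every short increasing list of
  times behaves as almost all lists of indices do for the corresponding rows.\<close>

lemma eventually_selection:
  fixes Q :: "'r list \<Rightarrow> 'j list \<Rightarrow> bool" and rt :: "nat \<Rightarrow> 'r"
  assumes R: "finite R" and Q: "\<And>rs. set rs \<subseteq> R \<Longrightarrow> length rs \<le> n \<Longrightarrow> \<forall>\<^sub>F s in iter U (length rs). Q rs s"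
    and rt: "\<And>t. rt t \<in> R"
  shows "\<exists>\<sigma>. \<forall>ts. sorted_wrt (<) ts \<longrightarrow> length ts \<le> n \<longrightarrow> Q (map rt ts) (map \<sigma> ts)"
proof -
  \<comment> \<open>Invariant after \<open>t\<close> choices: every increasing list of chosen times
    can be continued by almost all indices, whichever rows follow. Finiteness of \<open>R\<close>
    and the length bound \<open>n\<close> leave finitely many conditions for the next
    choice.\<close>
  define H where "H t \<sigma> \<longleftrightarrow> (\<forall>ts rs. sorted_wrt (<) ts \<longrightarrow> set ts \<subseteq> {..<t} \<longrightarrow> set rs \<subseteq> R \<longrightarrow> length ts + length rs \<le> n \<longrightarrow>
     (\<forall>\<^sub>F u in iter U (length rs). Q (map rt ts @ rs) (map \<sigma> ts @ u)))" for t :: nat and \<sigma>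
  have HD: "\<forall>\<^sub>F u in iter U (length rs). Q (map rt ts @ rs) (map \<sigma> ts @ u)"
    if "H t \<sigma>" "sorted_wrt (<) ts" "set ts \<subseteq> {..<t}" "set rs \<subseteq> R" "length ts + length rs \<le> n" for t \<sigma> ts rs
    by (rule that(1)[unfolded H_def, THEN spec[of _ ts], THEN spec[of _ rs], THEN mp, THEN mp, THEN mp, THEN mp, OF that(2-)])
  have H0: "H 0 undefined" unfolding H_def using Q by simp
  have step: "\<exists>\<sigma>'. H (Suc t) \<sigma>' \<and> (\<forall>i<t. \<sigma>' i = \<sigma> i)" if H: "H t \<sigma>" for t \<sigma>
  proof -
    define T where "T = {(ts, rs). set ts \<subseteq> {..<t} \<and> set rs \<subseteq> R \<and> sorted_wrt (<) ts \<and> length ts + Suc (length rs) \<le> n}"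
    have "T \<subseteq> {ts. set ts \<subseteq> {..<t} \<and> length ts \<le> n} \<times> {rs. set rs \<subseteq> R \<and> length rs \<le> n}"
      by (auto simp: T_def)
    then have fin: "finite T"
      by (rule finite_subset) (intro finite_cartesian_product finite_lists_length_le R finite_lessThan)
    have "\<forall>\<^sub>F y in U. \<forall>p\<in>T. \<forall>\<^sub>F u in iter U (length (snd p)). Q (map rt (fst p) @ rt t # snd p) (map \<sigma> (fst p) @ y # u)"
    proof (rule eventually_ball_finite[OF fin], rule ballI)
      fix p assume "p \<in> T"
      then have "\<forall>\<^sub>F u in iter U (length (rt t # snd p)). Q (map rt (fst p) @ rt t # snd p) (map \<sigma> (fst p) @ u)"
        by (intro HD[OF H]) (auto simp: T_def rt)
      then show "\<forall>\<^sub>F y in U. \<forall>\<^sub>F u in iter U (length (snd p)). Q (map rt (fst p) @ rt t # snd p) (map \<sigma> (fst p) @ y # u)"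
        by (simp add: eventually_iter_Suc)
    qed
    from eventually_ex_ultra[OF ultra this] obtain y where
      y: "\<forall>p\<in>T. \<forall>\<^sub>F u in iter U (length (snd p)). Q (map rt (fst p) @ rt t # snd p) (map \<sigma> (fst p) @ y # u)" ..
    define \<sigma>' where "\<sigma>' = \<sigma>(t := y)"
    have same: "map \<sigma>' ts = map \<sigma> ts" if "set ts \<subseteq> {..<t}" for ts
      using that by (auto simp: \<sigma>'_def)
    have "H (Suc t) \<sigma>'"
      unfolding H_def
    proof (intro allI impI)
      fix ts rs assume a: "sorted_wrt (<) ts" "set ts \<subseteq> {..<Suc t}" "set rs \<subseteq> R" "length ts + length rs \<le> n"
      show "\<forall>\<^sub>F u in iter U (length rs). Q (map rt ts @ rs) (map \<sigma>' ts @ u)"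
      proof (cases "t \<in> set ts")
        case False
        then have sub: "set ts \<subseteq> {..<t}" using a(2) by (auto simp: less_Suc_eq)
        show ?thesis unfolding same[OF sub] by (rule HD[OF H a(1) sub a(3,4)])
      next
        case True
        \<comment> \<open>An increasing list below \<open>Suc t\<close> that contains
          \<open>t\<close> ends with it, so only the last entry is new.\<close>
        then have "ts \<noteq> []" by auto
        then obtain us l where ts: "ts = us @ [l]" by (cases ts rule: rev_cases) auto
        have lt: "\<forall>q\<in>set us. q < l" using a(1) by (simp add: ts sorted_wrt_append)
        have "l \<le> t" using a(2) by (simp add: ts)
        moreover have "t \<le> l" using True lt by (auto simp: ts)
        ultimately have l: "l = t" by simp
        have sub: "set us \<subseteq> {..<t}" using lt l by auto
        have "(us, rs) \<in> T" using a sub by (simp add: T_def ts sorted_wrt_append)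
        from bspec[OF y this] have "\<forall>\<^sub>F u in iter U (length rs). Q (map rt us @ rt t # rs) (map \<sigma> us @ y # u)"
          by simp
        then show ?thesis unfolding ts l map_append same[OF sub] by (simp add: \<sigma>'_def)
      qed
    qed
    then show ?thesis by (intro exI[of _ \<sigma>']) (simp add: \<sigma>'_def)
  qed
  have "\<exists>F. \<forall>t. H t (F t) \<and> (\<forall>i<t. F (Suc t) i = F t i)"
    by (rule dependent_nat_choice) (rule exI, rule H0, rule step)
  then obtain F where F0: "\<forall>t. H t (F t) \<and> (\<forall>i<t. F (Suc t) i = F t i)" ..
  have F: "H t (F t)" "i < t \<Longrightarrow> F (Suc t) i = F t i" for t i
    using spec[OF F0, of t] by auto
  have stable: "F (Suc i + d) i = F (Suc i) i" for i d
  proof (induction d)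
    case (Suc d)
    then show ?case using F(2)[of i "Suc i + d"] by simp
  qed simp
  define \<sigma> where "\<sigma> i = F (Suc i) i" for i
  have agree: "F t i = \<sigma> i" if "i < t" for i t
    using stable[of i "t - Suc i"] that by (simp add: \<sigma>_def)
  show ?thesis
  proof (intro exI[of _ \<sigma>] allI impI)
    fix ts :: "nat list" assume ts: "sorted_wrt (<) ts" "length ts \<le> n"
    obtain t where t: "set ts \<subseteq> {..<t}" using finite_nat_iff_bounded[of "set ts"] by auto
    have eq: "map (F t) ts = map \<sigma> ts" using t agree by auto
    have "Q (map rt ts) (map (F t) ts)"
      using HD[OF F(1) ts(1) t, of "[]"] ts(2) by (simp add: eventually_iter_0)
    then show "Q (map rt ts) (map \<sigma> ts)" unfolding eq .
  qed
qed

text \<open>Row \<open>t mod k\<close> is used at time \<open>t\<close>, so every row recurs. The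
  signs are needed for differences of two images, and there are finitely many sign patterns for each
  length.\<close>

lemma row_norm_selection:
  fixes x :: "nat \<Rightarrow> 'j \<Rightarrow> 'a" and k :: nat
  assumes x: "\<forall>j. null_row (x j)" and e: "e > 0" and k: "k > 0"
  shows "\<exists>\<sigma>. \<forall>ts c. sorted_wrt (<) ts \<longrightarrow> length ts \<le> n \<longrightarrow> (\<forall>t. c t = 1 \<or> c t = - 1) \<longrightarrow>
    \<bar>norm (\<Sum>t\<in>set ts. c t *\<^sub>R x (t mod k) (\<sigma> t)) - row_lim 0 (map (\<lambda>t \<sigma>. c t *\<^sub>R x (t mod k) \<sigma>) ts)\<bar> \<le> e"
proof -
  let ?rows = "\<lambda>rs cs. map2 (\<lambda>r c \<sigma>. c *\<^sub>R x r \<sigma>) rs cs"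
  let ?C = "\<lambda>m. {cs :: real list. set cs \<subseteq> {-1, 1} \<and> length cs = m}"
  define Q where "Q rs s \<longleftrightarrow> (\<forall>cs\<in>?C (length rs).
      dist (norm (0 + row_sum (?rows rs cs) s)) (row_lim 0 (?rows rs cs)) < e)" for rs s
  have "\<exists>\<sigma>. \<forall>ts. sorted_wrt (<) ts \<longrightarrow> length ts \<le> n \<longrightarrow> Q (map (\<lambda>t. t mod k) ts) (map \<sigma> ts)"
  proof (rule eventually_selection[where R = "{..<k}" and Q = Q and rt = "\<lambda>t :: nat. t mod k" and n = n])
    show "finite {..<k}" by simp
    show "t mod k \<in> {..<k}" for t using k by simp
    fix rs :: "nat list" assume "set rs \<subseteq> {..<k}" "length rs \<le> n"
    show "\<forall>\<^sub>F s in iter U (length rs). Q rs s"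
      unfolding Q_def
    proof (rule eventually_ball_finite)
      show "finite (?C (length rs))" by (rule finite_lists_length_eq) simp
      show "\<forall>cs\<in>?C (length rs). \<forall>\<^sub>F s in iter U (length rs).
          dist (norm (0 + row_sum (?rows rs cs) s)) (row_lim 0 (?rows rs cs)) < e"
      proof
        fix cs assume cs: "cs \<in> ?C (length rs)"
        have b: "bounded_row r" if "r \<in> set (?rows rs cs)" for r
          using that x by (auto simp: bounded_row_scale null_row_bounded)
        have "((\<lambda>s. norm (0 + row_sum (?rows rs cs) s)) \<longlongrightarrow> row_lim 0 (?rows rs cs)) (iter U (length (?rows rs cs)))"
          by (rule row_lim_tendsto) (rule b)
        moreover have "length (?rows rs cs) = length rs" using cs by simp
        ultimately have "((\<lambda>s. norm (0 + row_sum (?rows rs cs) s)) \<longlongrightarrow> row_lim 0 (?rows rs cs)) (iter U (length rs))"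
          by simp
        then show "\<forall>\<^sub>F s in iter U (length rs). dist (norm (0 + row_sum (?rows rs cs) s)) (row_lim 0 (?rows rs cs)) < e"
          by (rule tendstoD[OF _ e])
      qed
    qed
  qed
  then obtain \<sigma> where \<sigma>: "\<And>ts. sorted_wrt (<) ts \<Longrightarrow> length ts \<le> n \<Longrightarrow> Q (map (\<lambda>t. t mod k) ts) (map \<sigma> ts)"
    by blast
  show ?thesis
  proof (intro exI[of _ \<sigma>] allI impI)
    fix ts :: "nat list" and c :: "nat \<Rightarrow> real"
    assume ts: "sorted_wrt (<) ts" "length ts \<le> n" and c: "\<forall>t. c t = 1 \<or> c t = - 1"
    have rows: "?rows (map (\<lambda>t. t mod k) ts) (map c ts) = map (\<lambda>t \<sigma>. c t *\<^sub>R x (t mod k) \<sigma>) ts"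
      by (induction ts) auto
    have sum: "row_sum (map (\<lambda>t \<sigma>. c t *\<^sub>R x (t mod k) \<sigma>) ts) (map \<sigma> ts) = (\<Sum>t\<in>set ts. c t *\<^sub>R x (t mod k) (\<sigma> t))"
    proof -
      have "distinct ts" using ts(1) by (simp add: strict_sorted_iff)
      then show ?thesis by (induction ts) auto
    qed
    have cs: "map c ts \<in> ?C (length (map (\<lambda>t. t mod k) ts))" using c by auto
    have "dist (norm (0 + row_sum (?rows (map (\<lambda>t. t mod k) ts) (map c ts)) (map \<sigma> ts)))
       (row_lim 0 (?rows (map (\<lambda>t. t mod k) ts) (map c ts))) < e"
      using \<sigma>[OF ts] unfolding Q_def by (rule bspec[OF _ cs])
    then show "\<bar>norm (\<Sum>t\<in>set ts. c t *\<^sub>R x (t mod k) (\<sigma> t)) - row_lim 0 (map (\<lambda>t \<sigma>. c t *\<^sub>R x (t mod k) \<sigma>) ts)\<bar> \<le> e"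
      unfolding rows sum by (simp add: dist_real_def)
  qed
qed

lemma filter_sorted_list_of_set:
  fixes T :: "'b::linorder set"
  assumes "finite T" "D \<subseteq> T"
  shows "filter (\<lambda>j. j \<in> D) (sorted_list_of_set T) = sorted_list_of_set D"
proof -
  have "finite D" using assms finite_subset by blast
  moreover have "sorted (filter (\<lambda>j. j \<in> D) (sorted_list_of_set T))"
    using sorted_filter[of "\<lambda>x. x" "sorted_list_of_set T"] by simp
  ultimately show ?thesis
    using assms by (intro sorted_distinct_set_unique) auto
qed

lemma row_norm_indicator:
  assumes x: "\<forall>j. null_row (x j)" and D: "finite D"
  shows "row_norm x (\<lambda>j. if j \<in> D then 1 else 0) = row_lim 0 (map x (sorted_list_of_set D))"
proof -
  let ?a = "\<lambda>j. if j \<in> D then 1 else 0 :: real"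
  obtain k where k: "D \<subseteq> {..<k}" using D finite_nat_iff_bounded by blast
  have "row_norm x ?a = row_comb x ?a [0..<k]" by (rule row_norm_eq[OF x]) (use k in auto)
  also have "\<dots> = row_comb x ?a (filter (\<lambda>j. j \<in> D) [0..<k])"
    by (rule row_comb_filter[OF x, symmetric]) simp
  also have "[0..<k] = sorted_list_of_set {..<k}"
    by (simp add: lessThan_atLeast0 sorted_list_of_set_range)
  also have "filter (\<lambda>j. j \<in> D) \<dots> = sorted_list_of_set D" by (rule filter_sorted_list_of_set) (use k in auto)
  also have "row_comb x ?a (sorted_list_of_set D) = row_comb x (\<lambda>_. 1) (sorted_list_of_set D)"
    by (rule row_comb_cong) (simp add: D)
  finally show ?thesis by (simp add: row_comb_def)
qed

text \<open>The times of two points interleave arbitrarily and use the same rows, so the iterated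
  norm of the difference need not be a value of \<open>row_norm x\<close>. It is estimated from
  above by the triangle inequality and from below by dropping the rows of one point.\<close>

lemma row_norm_embeds:
  assumes x: "\<forall>j. null_row (x j)" and x1: "\<forall>j \<sigma>. norm (x j \<sigma>) = 1"
  shows "embeds_with (kset k) (dk (row_norm x) k) (UNIV::'a set) 3"
proof (cases "k = 0")
  case True
  have "dk (row_norm x) k m n = 0" for m n
    using norm_1supp_unc_zero[OF norm_1supp_unc_row_norm[OF x x1]] True by (simp add: dk_def)
  then show ?thesis unfolding embeds_with_def by (intro exI[of _ 1] conjI exI[of _ "\<lambda>_. 0"]) auto
next
  case False
  then have k: "k > 0" by simp
  \<comment> \<open>With error \<open>e\<close> and \<open>1 \<le> d\<close>, distances lie between
    \<open>(1 - e) * d\<close> and \<open>(2 + 2 * e) * d\<close>, with ratio 3 at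
    \<open>e = 1 / 5\<close>. A difference involves at most \<open>2 * k\<close> vectors.\<close>
  have "1 / 5 > (0::real)" by simp
  from row_norm_selection[OF x this k, of "2 * k"] obtain \<sigma> where
    \<sigma>: "\<forall>ts c. sorted_wrt (<) ts \<longrightarrow> length ts \<le> 2 * k \<longrightarrow> (\<forall>t. c t = 1 \<or> c t = - 1) \<longrightarrow>
      \<bar>norm (\<Sum>t\<in>set ts. c t *\<^sub>R x (t mod k) (\<sigma> t)) - row_lim 0 (map (\<lambda>t \<sigma>. c t *\<^sub>R x (t mod k) \<sigma>) ts)\<bar> \<le> 1 / 5" ..
  have \<sigma>_set: "\<bar>norm (\<Sum>t\<in>T. c t *\<^sub>R x (t mod k) (\<sigma> t)) - row_lim 0 (map (\<lambda>t \<sigma>. c t *\<^sub>R x (t mod k) \<sigma>) (sorted_list_of_set T))\<bar> \<le> 1 / 5"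
    if "finite T" "card T \<le> 2 * k" "\<forall>t. c t = 1 \<or> c t = - 1" for T c
    using spec[OF spec[OF \<sigma>, of "sorted_list_of_set T"], of c] that by simp
  define y where "y t = x (t mod k) (\<sigma> t)" for t
  \<comment> \<open>The array element with row \<open>j < k\<close> and index \<open>n\<close> is chosen at time \<open>n * k + j\<close>.\<close>
  define \<tau> where "\<tau> m j = sorted_list_of_set m ! j * k + j" for m and j :: nat
  define f where "f m = (\<Sum>j<k. y (\<tau> m j))" for m
  have main: "4 / 5 * dk (row_norm x) k m n \<le> dist (f m) (f n) \<and> dist (f m) (f n) \<le> 4 / 5 * 3 * dk (row_norm x) k m n"
    if m: "m \<in> kset k" and n: "n \<in> kset k" for m n
  proof -
    define D where "D = {j. j < k \<and> sorted_list_of_set m ! j \<noteq> sorted_list_of_set n ! j}"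
    have D: "D \<subseteq> {..<k}" "finite D" "card D \<le> k"
      using card_mono[of "{..<k}" D] by (auto simp: D_def)
    define d where "d = row_lim 0 (map x (sorted_list_of_set D))"
    have d: "dk (row_norm x) k m n = d"
      unfolding d_def row_norm_indicator[OF x D(2), symmetric] by (simp add: dk_def D_def)
    have Dk: "j < k" if "j \<in> D" for j using that by (simp add: D_def)
    have \<tau>_mod: "\<tau> l j mod k = j" if "j \<in> D" for l j using Dk[OF that] by (simp add: \<tau>_def)
    have \<tau>_div: "\<tau> l j div k = sorted_list_of_set l ! j" if "j \<in> D" for l j
      using Dk[OF that] by (simp add: \<tau>_def)
    have inj: "inj_on (\<tau> l) D" for l
    proof (rule inj_onI)
      fix i j assume ij: "i \<in> D" "j \<in> D" and eq: "\<tau> l i = \<tau> l j"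
      have "i = \<tau> l i mod k" by (rule \<tau>_mod[OF ij(1), symmetric])
      also have "\<dots> = j" unfolding eq by (rule \<tau>_mod[OF ij(2)])
      finally show "i = j" .
    qed
    \<comment> \<open>For a single point the order of times is the order of rows, so the iterated
      limit over its times is a value of \<open>row_norm x\<close>.\<close>
    have mono: "\<tau> l i < \<tau> l j" if l: "l \<in> kset k" and "i < j" "j \<in> D" for l i j
    proof -
      have "sorted_list_of_set l ! i \<le> sorted_list_of_set l ! j"
        using that(2) Dk[OF that(3)] l by (intro sorted_nth_mono) (simp_all add: kset_def)
      then have "sorted_list_of_set l ! i * k \<le> sorted_list_of_set l ! j * k" by (rule mult_le_mono1)
      then show ?thesis using that(2) unfolding \<tau>_def by linarith
    qed
    have sorted_\<tau>: "sorted_list_of_set (\<tau> l ` D) = map (\<tau> l) (sorted_list_of_set D)" if "l \<in> kset k" for l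
    proof -
      have "sorted_wrt (\<lambda>i j. \<tau> l i < \<tau> l j) (sorted_list_of_set D)"
        by (rule sorted_wrt_mono_rel[OF _ strict_sorted_list_of_set]) (use mono[OF that] D(2) in auto)
      then have "sorted_wrt (<) (map (\<tau> l) (sorted_list_of_set D))" by (simp add: sorted_wrt_map)
      from sorted_list_of_set_strict[OF this] show ?thesis using D(2) by simp
    qed
    have rows_\<tau>: "row_lim 0 (map (\<lambda>t. x (t mod k)) (sorted_list_of_set (\<tau> l ` D))) = d" if "l \<in> kset k" for l
    proof -
      have eq: "map (\<lambda>t. x (t mod k)) (map (\<tau> l) (sorted_list_of_set D)) = map x (sorted_list_of_set D)"
        using \<tau>_mod D(2) by auto
      show ?thesis unfolding sorted_\<tau>[OF that] d_def eq ..
    qed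
    have card: "card (\<tau> l ` D) \<le> k" for l by (rule order_trans[OF card_image_le[OF D(2)] D(3)])
    have half: "norm (\<Sum>j\<in>D. y (\<tau> l j)) \<le> d + 1 / 5" if "l \<in> kset k" for l
    proof -
      have eq: "(\<Sum>j\<in>D. y (\<tau> l j)) = (\<Sum>t\<in>\<tau> l ` D. x (t mod k) (\<sigma> t))"
        by (simp add: sum.reindex[OF inj] y_def)
      have "\<bar>norm (\<Sum>t\<in>\<tau> l ` D. x (t mod k) (\<sigma> t)) - d\<bar> \<le> 1 / 5"
        using \<sigma>_set[of "\<tau> l ` D" "\<lambda>_. 1"] card[of l] D(2) rows_\<tau>[OF that] by simp
      then show ?thesis unfolding eq by linarith
    qed
    define T where "T = \<tau> m ` D \<union> \<tau> n ` D"
    have T: "finite T" using D(2) by (simp add: T_def)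
    have T2: "card T \<le> 2 * k"
      using card[of m] card[of n] card_Un_le[of "\<tau> m ` D" "\<tau> n ` D"] unfolding T_def by linarith
    have disj: "\<tau> m ` D \<inter> \<tau> n ` D = {}"
    proof -
      have "\<tau> m i \<noteq> \<tau> n j" if "i \<in> D" "j \<in> D" for i j
      proof
        assume eq: "\<tau> m i = \<tau> n j"
        have "i = \<tau> m i mod k" by (rule \<tau>_mod[OF that(1), symmetric])
        also have "\<dots> = j" unfolding eq by (rule \<tau>_mod[OF that(2)])
        finally have "i = j" .
        then show False using \<tau>_div[OF that(1), of m] \<tau>_div[OF that(2), of n] eq that by (simp add: D_def)
      qed
      then show ?thesis by auto
    qed
    define c where "c t = (if t \<in> \<tau> m ` D then 1 else - 1 :: real)" for t
    have diff: "f m - f n = (\<Sum>j\<in>D. y (\<tau> m j)) - (\<Sum>j\<in>D. y (\<tau> n j))"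
    proof -
      have f: "f l = (\<Sum>j\<in>{..<k} - D. y (\<tau> l j)) + (\<Sum>j\<in>D. y (\<tau> l j))" for l
        unfolding f_def by (rule sum.subset_diff[OF D(1)]) simp
      have "(\<Sum>j\<in>{..<k} - D. y (\<tau> m j)) = (\<Sum>j\<in>{..<k} - D. y (\<tau> n j))"
        by (rule sum.cong) (auto simp: D_def \<tau>_def)
      then show ?thesis by (simp add: f)
    qed
    have "(\<Sum>t\<in>T. c t *\<^sub>R y t) = (\<Sum>t\<in>\<tau> m ` D. c t *\<^sub>R y t) + (\<Sum>t\<in>\<tau> n ` D. c t *\<^sub>R y t)"
      unfolding T_def by (rule sum.union_disjoint) (use D(2) disj in auto)
    also have "(\<Sum>t\<in>\<tau> m ` D. c t *\<^sub>R y t) = (\<Sum>t\<in>\<tau> m ` D. y t)"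
      by (rule sum.cong) (auto simp: c_def)
    also have "(\<Sum>t\<in>\<tau> n ` D. c t *\<^sub>R y t) = (\<Sum>t\<in>\<tau> n ` D. - y t)"
      using disj by (intro sum.cong) (auto simp: c_def)
    finally have diff_T: "f m - f n = (\<Sum>t\<in>T. c t *\<^sub>R y t)"
      by (simp add: diff sum.reindex[OF inj] sum_negf)
    have lower: "d - 1 / 5 \<le> norm (f m - f n)"
    proof -
      let ?r = "\<lambda>t \<sigma>. c t *\<^sub>R x (t mod k) \<sigma>"
      have sub: "filter (\<lambda>t. t \<in> \<tau> m ` D) (sorted_list_of_set T) = sorted_list_of_set (\<tau> m ` D)"
        by (rule filter_sorted_list_of_set) (use T in \<open>auto simp: T_def\<close>)
      have eq: "map (\<lambda>t. x (t mod k)) (sorted_list_of_set (\<tau> m ` D)) = map ?r (sorted_list_of_set (\<tau> m ` D))"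
        using D(2) by (intro map_cong) (auto simp: c_def)
      have "d = row_lim 0 (map ?r (sorted_list_of_set (\<tau> m ` D)))"
        using rows_\<tau>[OF m] unfolding eq by (rule sym)
      also have "\<dots> \<le> row_lim 0 (map ?r (sorted_list_of_set T))"
        unfolding sub[symmetric]
      proof (rule row_lim_subseq)
        show "subseq (map ?r (filter (\<lambda>t. t \<in> \<tau> m ` D) (sorted_list_of_set T))) (map ?r (sorted_list_of_set T))"
          by (intro subseq_map) simp
      qed (use x in \<open>auto simp: null_row_scale\<close>)
      finally have "d \<le> row_lim 0 (map ?r (sorted_list_of_set T))" .
      moreover have "\<bar>norm (\<Sum>t\<in>T. c t *\<^sub>R x (t mod k) (\<sigma> t)) - row_lim 0 (map ?r (sorted_list_of_set T))\<bar> \<le> 1 / 5"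
        by (rule \<sigma>_set[OF T T2]) (simp add: c_def)
      ultimately show ?thesis unfolding diff_T y_def by linarith
    qed
    have upper: "norm (f m - f n) \<le> 2 * (d + 1 / 5)"
    proof -
      have "norm (f m - f n) \<le> norm (\<Sum>j\<in>D. y (\<tau> m j)) + norm (\<Sum>j\<in>D. y (\<tau> n j))"
        unfolding diff by (rule norm_triangle_ineq4)
      also have "\<dots> \<le> (d + 1 / 5) + (d + 1 / 5)" by (intro add_mono half m n)
      finally show ?thesis by simp
    qed
    show ?thesis
    proof (cases "D = {}")
      case True
      then have "d = 0" by (simp add: d_def)
      moreover have "f m - f n = 0" using True by (simp add: diff)
      ultimately show ?thesis by (simp add: d)
    next
      case False
      then obtain j where j: "j \<in> D" by auto
      have "fin_supp (\<lambda>j. if j \<in> D then 1 else 0)" using D(2) by (simp add: fin_supp_def)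
      from coord_le_row_norm[OF x x1 this, of j] have "1 \<le> d"
        using j by (simp add: row_norm_indicator[OF x D(2)] d_def)
      moreover have "4 / 5 * d \<le> r \<and> r \<le> 4 / 5 * 3 * d"
        if "1 \<le> d" "d - 1 / 5 \<le> r" "r \<le> 2 * (d + 1 / 5)" for r
        using that by simp
      ultimately show ?thesis using lower upper unfolding d dist_norm by blast
    qed
  qed
  show ?thesis
    unfolding embeds_with_def
  proof (rule exI[of _ "4 / 5"], intro conjI exI[of _ f] ballI)
    fix m n assume "m \<in> kset k" "n \<in> kset k"
    note mn = main[OF this]
    show "4 / 5 * dk (row_norm x) k m n \<le> dist (f m) (f n)"
      "dist (f m) (f n) \<le> 4 / 5 * 3 * dk (row_norm x) k m n" using mn by blast+
  qed auto
qed

end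

section \<open>From trees to arrays\<close>

context null_ultrafilter
begin

definition unit_row :: "('j \<Rightarrow> 'a) \<Rightarrow> ('j \<Rightarrow> 'a) \<Rightarrow> 'j \<Rightarrow> 'a" where
  "unit_row e r \<sigma> = (if r \<sigma> = 0 then e \<sigma> else (1 / norm (r \<sigma>)) *\<^sub>R r \<sigma>)"

lemma null_row_kernel:
  assumes "\<And>\<sigma>. r \<sigma> \<in> common_kernel (lab \<sigma>)" "\<And>\<sigma>. norm (r \<sigma>) \<le> B"
  shows "null_row r"
  unfolding null_row_def bounded_row_def
proof (intro conjI allI exI)
  show "norm (r \<sigma>) \<le> B" for \<sigma> by (rule assms)
  fix f :: "'a \<Rightarrow>\<^sub>L real"
  show "\<forall>\<^sub>F \<sigma> in U. blinfun_apply f (r \<sigma>) = 0"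
    using lab[of f] by eventually_elim (use assms(1) in \<open>auto simp: common_kernel_def\<close>)
qed

lemma null_row_unit_row:
  assumes e: "null_row e" "\<And>\<sigma>. norm (e \<sigma>) = 1" and r: "null_row r"
  shows "null_row (unit_row e r)" "norm (unit_row e r \<sigma>) = 1"
proof -
  show n: "norm (unit_row e r \<sigma>) = 1" for \<sigma> using e(2) by (simp add: unit_row_def)
  show "null_row (unit_row e r)"
    unfolding null_row_def bounded_row_def
  proof (intro conjI allI exI)
    show "norm (unit_row e r \<sigma>) \<le> 1" for \<sigma> using n by simp
    fix f :: "'a \<Rightarrow>\<^sub>L real"
    have "\<forall>\<^sub>F \<sigma> in U. blinfun_apply f (e \<sigma>) = 0" "\<forall>\<^sub>F \<sigma> in U. blinfun_apply f (r \<sigma>) = 0"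
      using e(1) r unfolding null_row_def by blast+
    then show "\<forall>\<^sub>F \<sigma> in U. blinfun_apply f (unit_row e r \<sigma>) = 0"
      by eventually_elim (simp add: unit_row_def blinfun.scaleR_right)
  qed
qed

text \<open>The point \<open>v + r \<sigma>\<close> is a convex combination of \<open>v\<close> and
  \<open>v + unit_row e r \<sigma>\<close>. The limit norm is convex, and for almost all
  \<open>\<sigma>\<close> its value at the second point is at least that at
  \<open>v\<close>.\<close>

lemma row_lim_unit_row:
  assumes e: "null_row e" "\<And>\<sigma>. norm (e \<sigma>) = 1"
    and rs: "\<And>r. r \<in> set rs \<Longrightarrow> null_row r" "\<And>r \<sigma>. r \<in> set rs \<Longrightarrow> norm (r \<sigma>) \<le> 1"
  shows "row_lim v rs \<le> row_lim v (map (unit_row e) rs)"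
  using rs
proof (induction rs arbitrary: v)
  case (Cons r rs)
  let ?R = "map (unit_row e) rs"
  have r: "null_row r" "\<And>\<sigma>. norm (r \<sigma>) \<le> 1" using Cons.prems by auto
  have u: "null_row (unit_row e r)" by (rule null_row_unit_row[OF e r(1)])
  have R: "bounded_row r'" if "r' \<in> set ?R" for r'
    using that null_row_unit_row(1)[OF e] Cons.prems(1) by (auto simp: null_row_bounded)
  have "row_lim v (r # rs) \<le> row_lim v (r # ?R)"
    by (rule row_lim_Cons_mono)
      (use Cons.IH Cons.prems R r in \<open>auto simp: null_row_bounded\<close>)
  also have "\<dots> \<le> row_lim v (unit_row e r # ?R)"
  proof (rule tendsto_le[OF ultra_not_bot[OF ultra] row_lim_Cons_tendsto row_lim_Cons_tendsto])
    have "\<forall>\<^sub>F \<sigma> in U. row_lim v ?R \<le> row_lim (v + unit_row e r \<sigma>) ?R"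
      by (rule eventually_row_lim_drop[OF u]) (rule R)
    then show "\<forall>\<^sub>F \<sigma> in U. row_lim (v + r \<sigma>) ?R \<le> row_lim (v + unit_row e r \<sigma>) ?R"
    proof eventually_elim
      case (elim \<sigma>)
      let ?c = "norm (r \<sigma>)" and ?w = "v + unit_row e r \<sigma>"
      have "v + r \<sigma> = (1 - ?c) *\<^sub>R v + ?c *\<^sub>R ?w" by (simp add: unit_row_def algebra_simps)
      then have "row_lim (v + r \<sigma>) ?R \<le> (1 - ?c) * row_lim v ?R + ?c * row_lim ?w ?R"
        using row_lim_convex[of ?R ?c v ?w, OF R] r(2) by simp
      also have "\<dots> \<le> (1 - ?c) * row_lim ?w ?R + ?c * row_lim ?w ?R"
        using elim r(2)[of \<sigma>] by (intro add_mono mult_left_mono) auto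
      also have "\<dots> = row_lim ?w ?R" by (simp add: algebra_simps)
      finally show ?case .
    qed
  next
    fix r' assume "r' \<in> set (unit_row e r # ?R)"
    then show "bounded_row r'" using R null_row_bounded[OF u] by auto
  next
    fix r' assume "r' \<in> set (r # ?R)"
    then show "bounded_row r'" using R null_row_bounded[OF r(1)] by auto
  qed
  finally show ?case by simp
qed simp

lemma row_norm_ones: "\<forall>j. null_row (x j) \<Longrightarrow> row_norm x (ones k) = row_lim 0 (map x [0..<k])"
proof -
  assume x: "\<forall>j. null_row (x j)"
  have "ones k = (\<lambda>j. if j \<in> {..<k} then 1 else 0)" by (simp add: ones_def fun_eq_iff)
  moreover have "sorted_list_of_set {..<k} = [0..<k]"
    by (simp add: lessThan_atLeast0 sorted_list_of_set_range)
  ultimately show ?thesis using row_norm_indicator[OF x, of "{..<k}"] by simp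
qed

text \<open>As soon as \<open>[0..<k]\<close> reaches beyond the block \<open>R p\<close>, dropping
  all other rows shows that the sum of the first \<open>k\<close> unit vectors has norm above
  \<open>p\<close>.\<close>

lemma concat_rows:
  assumes R: "\<And>p r. r \<in> set (R p) \<Longrightarrow> null_row r" "\<And>p r \<sigma>. r \<in> set (R p) \<Longrightarrow> norm (r \<sigma>) = 1"
    and big: "\<And>p :: nat. row_lim 0 (R p) > real p"
  shows "\<exists>x. (\<forall>j. null_row (x j)) \<and> (\<forall>j \<sigma>. norm (x j \<sigma>) = 1) \<and>
    (\<forall>p. \<exists>L. \<forall>k\<ge>L. real p < row_norm x (ones k))"
proof -
  define W where "W p = concat (map R [0..<p])" for p
  have W_Suc: "W (Suc p) = W p @ R p" for p by (simp add: W_def)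
  have R_ne: "R p \<noteq> []" for p
  proof
    assume "R p = []"
    then show False using big[of p] by simp
  qed
  have len: "p \<le> length (W p)" for p
  proof (induction p)
    case (Suc p)
    have "length (R p) \<ge> 1" using R_ne[of p] by (cases "R p") auto
    then show ?case using Suc by (simp add: W_Suc)
  qed simp
  have ext: "j < length (W p) \<Longrightarrow> j < length (W (p + d)) \<and> W (p + d) ! j = W p ! j" for p d j
    by (induction d) (auto simp: W_Suc nth_append)
  define x where "x j = W (Suc j) ! j" for j
  have x_eq: "x j = W p ! j" if "j < length (W p)" for j p
  proof (cases "p \<le> Suc j")
    case True
    then show ?thesis using ext[OF that, of "Suc j - p"] by (simp add: x_def)
  next
    case False
    have "j < length (W (Suc j))" using len[of "Suc j"] by simp
    from ext[OF this, of "p - Suc j"] False show ?thesis by (simp add: x_def)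
  qed
  have "x j \<in> set (W (Suc j))" for j using len[of "Suc j"] by (simp add: x_def)
  then have x_in: "\<exists>p. x j \<in> set (R p)" for j by (fastforce simp: W_def)
  have null: "\<forall>j. null_row (x j)" using x_in R(1) by blast
  have unit: "\<forall>j \<sigma>. norm (x j \<sigma>) = 1" using x_in R(2) by blast
  have "real p < row_norm x (ones k)" if k: "k \<ge> length (W (Suc p))" for p k
  proof -
    let ?L = "length (W (Suc p))"
    have "map x [0..<?L] = W (Suc p)"
      by (rule nth_equalityI) (auto simp: x_eq)
    moreover have "[0..<k] = [0..<?L] @ [?L..<k]" using k upt_add_eq_append[of 0 ?L "k - ?L"] by simp
    ultimately have "map x [0..<k] = W p @ R p @ map x [?L..<k]" by (simp add: W_Suc)
    then have "subseq (R p) (map x [0..<k])" by (simp add: list_emb_append2 list_emb_prefix)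
    then have "row_lim 0 (R p) \<le> row_lim 0 (map x [0..<k])"
      by (rule row_lim_subseq) (use null in auto)
    then show ?thesis using big[of p] row_norm_ones[OF null, of k] by simp
  qed
  then show ?thesis using null unit by blast
qed

text \<open>Norming functionals at the leaves are pulled back towards the root by weak-star limits;
  \<open>d\<close> counts the levels already treated.\<close>

lemma branch_functionals:
  fixes v :: "('a \<Rightarrow>\<^sub>L real) list list \<Rightarrow> 'a"
  shows "\<exists>f :: ('a \<Rightarrow>\<^sub>L real) list list \<Rightarrow> 'a \<Rightarrow>\<^sub>L real. (\<forall>s u. \<bar>blinfun_apply (f s) u\<bar> \<le> norm u) \<and>
    (\<forall>s. length s = k \<longrightarrow> blinfun_apply (f s) (v s) = norm (v s)) \<and>
    (\<forall>s u. length s < k \<longrightarrow> ((\<lambda>\<sigma>. blinfun_apply (f (s @ [lab \<sigma>])) u) \<longlongrightarrow> blinfun_apply (f s) u) U)"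
proof -
  have "\<exists>f :: ('a \<Rightarrow>\<^sub>L real) list list \<Rightarrow> 'a \<Rightarrow>\<^sub>L real. (\<forall>s u. \<bar>blinfun_apply (f s) u\<bar> \<le> norm u) \<and>
    (\<forall>s. length s = k \<longrightarrow> blinfun_apply (f s) (v s) = norm (v s)) \<and>
    (\<forall>s u. length s < k \<longrightarrow> k \<le> length s + d \<longrightarrow> ((\<lambda>\<sigma>. blinfun_apply (f (s @ [lab \<sigma>])) u) \<longlongrightarrow> blinfun_apply (f s) u) U)" for d
  proof (induction d)
    case 0
    have "\<exists>f :: ('a \<Rightarrow>\<^sub>L real) list list \<Rightarrow> 'a \<Rightarrow>\<^sub>L real.
       \<forall>s. blinfun_apply (f s) (v s) = norm (v s) \<and> (\<forall>u. \<bar>blinfun_apply (f s) u\<bar> \<le> norm u)"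
      by (rule choice) (intro allI norming_functional)
    then obtain f :: "('a \<Rightarrow>\<^sub>L real) list list \<Rightarrow> 'a \<Rightarrow>\<^sub>L real" where
      f: "\<forall>s. blinfun_apply (f s) (v s) = norm (v s) \<and> (\<forall>u. \<bar>blinfun_apply (f s) u\<bar> \<le> norm u)" ..
    show ?case by (rule exI[of _ f]) (use f in simp)
  next
    case (Suc d)
    then obtain f :: "('a \<Rightarrow>\<^sub>L real) list list \<Rightarrow> 'a \<Rightarrow>\<^sub>L real" where
      f0: "(\<forall>s u. \<bar>blinfun_apply (f s) u\<bar> \<le> norm u) \<and>
        (\<forall>s. length s = k \<longrightarrow> blinfun_apply (f s) (v s) = norm (v s)) \<and>
        (\<forall>s u. length s < k \<longrightarrow> k \<le> length s + d \<longrightarrow> ((\<lambda>\<sigma>. blinfun_apply (f (s @ [lab \<sigma>])) u) \<longlongrightarrow> blinfun_apply (f s) u) U)" ..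
    have f: "\<And>s u. \<bar>blinfun_apply (f s) u\<bar> \<le> norm u"
        "\<And>s. length s = k \<Longrightarrow> blinfun_apply (f s) (v s) = norm (v s)"
        "\<And>s u. length s < k \<Longrightarrow> k \<le> length s + d \<Longrightarrow> ((\<lambda>\<sigma>. blinfun_apply (f (s @ [lab \<sigma>])) u) \<longlongrightarrow> blinfun_apply (f s) u) U"
      using f0 by simp_all
    have "\<exists>L :: ('a \<Rightarrow>\<^sub>L real) list list \<Rightarrow> 'a \<Rightarrow>\<^sub>L real. \<forall>s. (\<forall>u. \<bar>blinfun_apply (L s) u\<bar> \<le> norm u) \<and>
        (\<forall>u. ((\<lambda>\<sigma>. blinfun_apply (f (s @ [lab \<sigma>])) u) \<longlongrightarrow> blinfun_apply (L s) u) U)"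
      by (rule choice) (intro allI functional_limit[OF ultra] f(1))
    then obtain L :: "('a \<Rightarrow>\<^sub>L real) list list \<Rightarrow> 'a \<Rightarrow>\<^sub>L real" where
      L: "\<forall>s. (\<forall>u. \<bar>blinfun_apply (L s) u\<bar> \<le> norm u) \<and>
        (\<forall>u. ((\<lambda>\<sigma>. blinfun_apply (f (s @ [lab \<sigma>])) u) \<longlongrightarrow> blinfun_apply (L s) u) U)" ..
    \<comment> \<open>Only the nodes \<open>d + 1\<close> levels above the leaves are redefined;
      their children, and all limits found before, remain unchanged.\<close>
    define f' where "f' s = (if Suc (length s + d) = k then L s else f s)" for s
    show ?case
    proof (rule exI[of _ f'], intro conjI allI impI)
      show "\<bar>blinfun_apply (f' s) u\<bar> \<le> norm u" for s u using f(1) L by (simp add: f'_def)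
      show "blinfun_apply (f' s) (v s) = norm (v s)" if "length s = k" for s
        using f(2)[OF that] that by (simp add: f'_def)
      fix s :: "('a \<Rightarrow>\<^sub>L real) list list" and u
      assume s: "length s < k" "k \<le> length s + Suc d"
      have "f' (s @ [\<Phi>]) = f (s @ [\<Phi>])" for \<Phi> using s by (simp add: f'_def)
      then show "((\<lambda>\<sigma>. blinfun_apply (f' (s @ [lab \<sigma>])) u) \<longlongrightarrow> blinfun_apply (f' s) u) U"
        using s f(3)[of s u] L by (cases "Suc (length s + d) = k") (simp_all add: f'_def)
    qed
  qed
  from this[of k] show ?thesis by simp
qed

end

text \<open>An index also carries finite sets of tree nodes and of vectors, each of which eventually contains
  any given node or vector. So an array may sum over all nodes that belong to its index, and later functional
  increments can be made small on all vectors that were used earlier, without a recursive construction.\<close>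

locale null_ultrafilter_nodes = null_ultrafilter U lab
  for U :: "'j filter" and lab :: "'j \<Rightarrow> ('a::banach \<Rightarrow>\<^sub>L real) list" +
  fixes nod :: "'j \<Rightarrow> ('a \<Rightarrow>\<^sub>L real) list list set" and vec :: "'j \<Rightarrow> 'a set"
  assumes finite_nod: "\<And>\<sigma>. finite (nod \<sigma>)" and nod: "\<And>s. \<forall>\<^sub>F \<sigma> in U. s \<in> nod \<sigma>"
    and finite_vec: "\<And>\<sigma>. finite (vec \<sigma>)" and vec: "\<And>w. \<forall>\<^sub>F \<sigma> in U. w \<in> vec \<sigma>"

context null_ultrafilter_nodes
begin

text \<open>Constructs one array entry: a child \<open>y s\<close> for every node \<open>s\<close>
  of level \<open>i\<close> listed at \<open>\<sigma>\<close>, such that the functional increment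
  along \<open>y s\<close> hardly notices the sum of the other children. As each child depends on
  its own index, the children form a sum of null rows, and the hypothesis on \<open>C\<close> bounds
  it.\<close>

lemma biorthogonal_stage:
  fixes x :: "('a \<Rightarrow>\<^sub>L real) list list \<Rightarrow> 'a" and f :: "('a \<Rightarrow>\<^sub>L real) list list \<Rightarrow> 'a \<Rightarrow>\<^sub>L real"
  assumes C: "\<And>rs. (\<And>r. r \<in> set rs \<Longrightarrow> null_row r) \<Longrightarrow> (\<And>r \<sigma>. r \<in> set rs \<Longrightarrow> norm (r \<sigma>) \<le> 1) \<Longrightarrow> row_lim 0 rs \<le> C"
    and x: "\<And>s \<Phi>. length s < k \<Longrightarrow> x (s @ [\<Phi>]) \<in> common_kernel \<Phi> \<and> norm (x (s @ [\<Phi>])) \<le> 1"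
    and f: "\<And>s u. length s < k \<Longrightarrow> ((\<lambda>\<sigma>. blinfun_apply (f (s @ [lab \<sigma>])) u) \<longlongrightarrow> blinfun_apply (f s) u) U"
    and e: "e > 0" and i: "i < k"
  shows "\<exists>\<phi>. let A = {s \<in> nod \<sigma>. length s = i}; y = (\<lambda>s. x (s @ [lab (\<phi> s)])); z = (\<Sum>s\<in>A. y s) in
      norm z \<le> C + 1 \<and> (\<forall>s\<in>A. y s \<in> common_kernel (lab \<sigma>)) \<and>
      (\<forall>s\<in>A. \<forall>w\<in>insert (z - y s) (vec \<sigma>). \<bar>blinfun_apply (f (s @ [lab (\<phi> s)])) w - blinfun_apply (f s) w\<bar> \<le> e)"
proof -
  define A where "A = {s \<in> nod \<sigma>. length s = i}"
  have "finite A" unfolding A_def using finite_nod by simp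
  then obtain ss where ss: "set ss = A" "distinct ss" using finite_distinct_list by blast
  define M where "M = length ss"
  have len_ss: "length (ss ! q) = i" if "q < M" for q
    using nth_mem[of q ss] that ss(1) by (auto simp: M_def A_def)
  \<comment> \<open>The other children number fewer than \<open>M\<close>, so their errors add up to
    at most \<open>e\<close>.\<close>
  define e' where "e' = e / (real M + 1)"
  have e': "e' > 0" using e by (simp add: e'_def add_pos_nonneg)
  define rs where "rs = map (\<lambda>s \<tau>. x (s @ [lab \<tau>])) ss"
  have rs_len: "length rs = M" by (simp add: rs_def M_def)
  have rs_row: "null_row r" "norm (r \<tau>) \<le> 1" if "r \<in> set rs" for r \<tau>
  proof -
    obtain s where s: "s \<in> A" "r = (\<lambda>\<tau>. x (s @ [lab \<tau>]))" using \<open>r \<in> set rs\<close> ss(1) by (auto simp: rs_def)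
    have *: "r \<tau> \<in> common_kernel (lab \<tau>)" "norm (r \<tau>) \<le> 1" for \<tau>
      using x[of s "lab \<tau>"] s i by (simp_all add: A_def)
    show "null_row r" by (rule null_row_kernel[OF *])
    show "norm (r \<tau>) \<le> 1" by (rule *(2))
  qed
  have "((\<lambda>t. norm (0 + row_sum rs t)) \<longlongrightarrow> row_lim 0 rs) (iter U (length rs))"
    by (rule row_lim_tendsto) (simp add: null_row_bounded rs_row(1))
  moreover have "row_lim 0 rs \<le> C" by (rule C) (erule rs_row(1), erule rs_row(2))
  then have "row_lim 0 rs < C + 1" by simp
  ultimately have "\<forall>\<^sub>F t in iter U M. norm (0 + row_sum rs t) < C + 1"
    unfolding rs_len by (rule order_tendstoD(2))
  moreover
  \<comment> \<open>Children are chosen along the enumeration \<open>ss\<close>. The increment of a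
    new child is small on the earlier children by weak-star convergence, and the new child lies in
    the kernel of all earlier increments; so every pair is covered.\<close>
  define P where "P s \<tau> \<longleftrightarrow> (let q = length s; sq = ss ! q in
      x (sq @ [lab \<tau>]) \<in> common_kernel (lab \<sigma>) \<and>
      (\<forall>w\<in>vec \<sigma>. dist (blinfun_apply (f (sq @ [lab \<tau>])) w) (blinfun_apply (f sq) w) < e) \<and>
      (\<forall>p\<in>{..<q}. dist (blinfun_apply (f (sq @ [lab \<tau>])) (x (ss ! p @ [lab (s ! p)]))) (blinfun_apply (f sq) (x (ss ! p @ [lab (s ! p)]))) < e') \<and>
      (\<forall>p\<in>{..<q}. blinfun_apply (f (ss ! p @ [lab (s ! p)]) - f (ss ! p)) (x (sq @ [lab \<tau>])) = 0))" for s \<tau>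
  have "\<forall>\<^sub>F t in iter U M. length t = M \<and> (\<forall>q<M. P (take q t) (t ! q))"
  proof (rule eventually_iter_step)
    fix s :: "'j list" assume s: "length s < M"
    define sq where "sq = ss ! length s"
    have sq: "length sq < k" using len_ss[OF s] i by (simp add: sq_def)
    have "\<forall>\<^sub>F \<tau> in U. common_kernel (lab \<tau>) \<subseteq> common_kernel (lab \<sigma>)"
      by (rule eventually_kernel_le[OF cofin_subspace_common_kernel])
    then have 1: "\<forall>\<^sub>F \<tau> in U. x (sq @ [lab \<tau>]) \<in> common_kernel (lab \<sigma>)"
      by eventually_elim (use x[OF sq] in auto)
    have 2: "\<forall>\<^sub>F \<tau> in U. \<forall>w\<in>vec \<sigma>. dist (blinfun_apply (f (sq @ [lab \<tau>])) w) (blinfun_apply (f sq) w) < e"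
      by (intro eventually_ball_finite finite_vec ballI tendstoD[OF f[OF sq] e])
    have 3: "\<forall>\<^sub>F \<tau> in U. \<forall>p\<in>{..<length s}. dist (blinfun_apply (f (sq @ [lab \<tau>])) (x (ss ! p @ [lab (s ! p)])))
         (blinfun_apply (f sq) (x (ss ! p @ [lab (s ! p)]))) < e'"
      by (intro eventually_ball_finite finite_lessThan ballI tendstoD[OF f[OF sq] e'])
    have null: "null_row (\<lambda>\<tau>. x (sq @ [lab \<tau>]))"
      by (rule rs_row(1)) (use s in \<open>simp add: rs_def sq_def M_def\<close>)
    have 4: "\<forall>\<^sub>F \<tau> in U. \<forall>p\<in>{..<length s}. blinfun_apply (f (ss ! p @ [lab (s ! p)]) - f (ss ! p)) (x (sq @ [lab \<tau>])) = 0"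
      using null unfolding null_row_def by (intro eventually_ball_finite finite_lessThan ballI) simp
    from 1 2 3 4 show "\<forall>\<^sub>F \<tau> in U. P s \<tau>"
      by eventually_elim (simp add: P_def Let_def sq_def)
  qed
  ultimately have "\<forall>\<^sub>F t in iter U M. norm (0 + row_sum rs t) < C + 1 \<and> length t = M \<and> (\<forall>q<M. P (take q t) (t ! q))"
    by (rule eventually_conj)
  from eventually_ex_ultra[OF ultra_it this] obtain t where
    t: "norm (0 + row_sum rs t) < C + 1" "length t = M" and P: "\<And>q. q < M \<Longrightarrow> P (take q t) (t ! q)" by blast
  define \<phi> where "\<phi> s = t ! inv_into {..<M} ((!) ss) s" for s
  have inj: "inj_on ((!) ss) {..<M}" using ss(2) by (simp add: M_def inj_on_nth)
  have \<phi>: "\<phi> (ss ! q) = t ! q" if "q < M" for q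
    unfolding \<phi>_def using inv_into_f_f[OF inj, of q] that by simp
  define y where "y s = x (s @ [lab (\<phi> s)])" for s
  define z where "z = (\<Sum>s\<in>A. y s)"
  have bij: "bij_betw ((!) ss) {..<M} A" unfolding M_def by (rule bij_betw_nth) (use ss in auto)
  have z_eq: "z = (\<Sum>q<M. y (ss ! q))" unfolding z_def by (rule sum.reindex_bij_betw[OF bij, symmetric])
  have "row_sum rs t = (\<Sum>q<M. y (ss ! q))"
    unfolding row_sum_nth[of t rs, unfolded rs_len, OF t(2)]
    by (rule sum.cong) (simp_all add: rs_def M_def y_def \<phi>)
  then have 1: "norm z \<le> C + 1" using t(1) z_eq by simp
  have ex: "\<exists>q<M. s = ss ! q" if "s \<in> A" for s
    using that ss(1) unfolding M_def by (metis in_set_conv_nth)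
  have 2: "y s \<in> common_kernel (lab \<sigma>)" if "s \<in> A" for s
  proof -
    obtain q where q: "q < M" "s = ss ! q" using ex[OF \<open>s \<in> A\<close>] by blast
    then show ?thesis using P[OF q(1)] t(2) by (simp add: P_def Let_def y_def \<phi>)
  qed
  have 3: "\<bar>blinfun_apply (f (s @ [lab (\<phi> s)])) w - blinfun_apply (f s) w\<bar> \<le> e" if "s \<in> A" "w \<in> vec \<sigma>" for s w
  proof -
    obtain q where q: "q < M" "s = ss ! q" using ex[OF \<open>s \<in> A\<close>] by blast
    then have "dist (blinfun_apply (f (s @ [lab (\<phi> s)])) w) (blinfun_apply (f s) w) < e"
      using P[OF q(1)] t(2) that(2) by (simp add: P_def Let_def \<phi>)
    then show ?thesis by (simp add: dist_real_def)
  qed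
  have 4: "\<bar>blinfun_apply (f (s @ [lab (\<phi> s)])) (z - y s) - blinfun_apply (f s) (z - y s)\<bar> \<le> e" if "s \<in> A" for s
  proof -
    obtain q where q: "q < M" "s = ss ! q" using ex[OF \<open>s \<in> A\<close>] by blast
    define g where "g = f (s @ [lab (\<phi> s)]) - f s"
    have small: "\<bar>blinfun_apply g (y (ss ! p))\<bar> \<le> e'" if p: "p < M" "p \<noteq> q" for p
    proof (cases "p < q")
      case True
      then have "dist (blinfun_apply (f (s @ [lab (\<phi> s)])) (y (ss ! p))) (blinfun_apply (f s) (y (ss ! p))) < e'"
        using P[OF q(1)] t(2) q p by (simp add: P_def Let_def y_def \<phi>)
      then show ?thesis by (simp add: g_def dist_real_def blinfun.diff_left)
    next
      case False
      then have "q < p" using p by simp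
      then have "blinfun_apply g (y (ss ! p)) = 0"
        using P[OF p(1)] t(2) q p by (simp add: P_def Let_def y_def \<phi> g_def)
      then show ?thesis using e' by simp
    qed
    have "z - y s = (\<Sum>p\<in>{..<M} - {q}. y (ss ! p))"
      unfolding z_eq q(2) using q(1) by (simp add: sum_diff1)
    then have "\<bar>blinfun_apply g (z - y s)\<bar> \<le> (\<Sum>p\<in>{..<M} - {q}. \<bar>blinfun_apply g (y (ss ! p))\<bar>)"
      by (simp add: blinfun.sum_right sum_abs)
    also have "\<dots> \<le> (\<Sum>p\<in>{..<M} - {q}. e')" by (rule sum_mono) (use small in auto)
    also have "\<dots> \<le> (\<Sum>p\<in>{..<M}. e')" by (rule sum_mono2) (use e' in auto)
    also have "\<dots> = real M * e'" by simp
    also have "\<dots> \<le> e" using e by (simp add: e'_def field_simps)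
    finally show ?thesis by (simp add: g_def blinfun.diff_left)
  qed
  show ?thesis
    unfolding Let_def A_def[symmetric]
    by (rule exI[of _ \<phi>], unfold y_def[symmetric], unfold z_def[symmetric]) (use 1 2 3 4 in blast)
qed

text \<open>The bound \<open>C\<close> is used twice: for each stage, where the entries
  \<open>z i \<sigma>\<close> get norm at most \<open>C + 1\<close>, and for the array of these
  entries after division by \<open>C + 1\<close>. Along a suitable list of indices the last
  functional of a branch takes on the sum of entries the norm of the branch sum, up to 1.\<close>

lemma tree_bound:
  fixes x :: "('a \<Rightarrow>\<^sub>L real) list list \<Rightarrow> 'a"
  assumes C: "\<And>rs. (\<And>r. r \<in> set rs \<Longrightarrow> null_row r) \<Longrightarrow> (\<And>r \<sigma>. r \<in> set rs \<Longrightarrow> norm (r \<sigma>) \<le> 1) \<Longrightarrow> row_lim 0 rs \<le> C"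
    and x: "\<And>s \<Phi>. length s < k \<Longrightarrow> x (s @ [\<Phi>]) \<in> common_kernel \<Phi> \<and> norm (x (s @ [\<Phi>])) \<le> 1"
    and D: "\<And>s. length s = k \<Longrightarrow> D \<le> norm (\<Sum>j<k. tree_path x s ! j)"
  shows "D \<le> (C + 1)\<^sup>2 + 1"
proof -
  have C0: "C \<ge> 0" using C[of "[]"] by simp
  \<comment> \<open>There are \<open>k\<close> leftovers \<open>u i\<close>, and each meets at most
    \<open>k\<close> functional increments.\<close>
  define e where "e = 1 / (real k * real k + 1)"
  have e: "e > 0" by (simp add: e_def add_nonneg_pos)
  from branch_functionals[of k "\<lambda>s. \<Sum>j<k. tree_path x s ! j"]
  obtain f :: "('a \<Rightarrow>\<^sub>L real) list list \<Rightarrow> 'a \<Rightarrow>\<^sub>L real" where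
    f0: "(\<forall>s u. \<bar>blinfun_apply (f s) u\<bar> \<le> norm u) \<and>
      (\<forall>s. length s = k \<longrightarrow> blinfun_apply (f s) (\<Sum>j<k. tree_path x s ! j) = norm (\<Sum>j<k. tree_path x s ! j)) \<and>
      (\<forall>s u. length s < k \<longrightarrow> ((\<lambda>\<sigma>. blinfun_apply (f (s @ [lab \<sigma>])) u) \<longlongrightarrow> blinfun_apply (f s) u) U)" ..
  have f_le: "\<And>s u. \<bar>blinfun_apply (f s) u\<bar> \<le> norm u" and
    f_norm: "\<And>s. length s = k \<Longrightarrow> blinfun_apply (f s) (\<Sum>j<k. tree_path x s ! j) = norm (\<Sum>j<k. tree_path x s ! j)" and
    f_lim: "\<And>s u. length s < k \<Longrightarrow> ((\<lambda>\<sigma>. blinfun_apply (f (s @ [lab \<sigma>])) u) \<longlongrightarrow> blinfun_apply (f s) u) U"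
    using f0 by simp_all
  define A where "A i \<sigma> = {s \<in> nod \<sigma>. length s = i}" for i \<sigma>
  define good where "good i \<sigma> \<phi> \<longleftrightarrow> (let y = (\<lambda>s. x (s @ [lab (\<phi> s)])); z = (\<Sum>s\<in>A i \<sigma>. y s) in
      norm z \<le> C + 1 \<and> (\<forall>s\<in>A i \<sigma>. y s \<in> common_kernel (lab \<sigma>)) \<and>
      (\<forall>s\<in>A i \<sigma>. \<forall>w\<in>insert (z - y s) (vec \<sigma>). \<bar>blinfun_apply (f (s @ [lab (\<phi> s)])) w - blinfun_apply (f s) w\<bar> \<le> e))" for i \<sigma> \<phi>
  have ex_good: "\<exists>\<phi>. good i \<sigma> \<phi>" if "i < k" for i \<sigma>
    using biorthogonal_stage[OF C x f_lim e that, where \<sigma> = \<sigma>] unfolding good_def A_def Let_def .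
  define \<Phi> where "\<Phi> i \<sigma> = (SOME \<phi>. good i \<sigma> \<phi>)" for i \<sigma>
  have \<Phi>: "good i \<sigma> (\<Phi> i \<sigma>)" if "i < k" for i \<sigma>
    unfolding \<Phi>_def by (rule someI_ex[OF ex_good[OF that]])
  define y where "y i \<sigma> s = x (s @ [lab (\<Phi> i \<sigma> s)])" for i \<sigma> s
  define z where "z i \<sigma> = (\<Sum>s\<in>A i \<sigma>. y i \<sigma> s)" for i \<sigma>
  have z_norm: "norm (z i \<sigma>) \<le> C + 1"
    and y_ker: "s \<in> A i \<sigma> \<Longrightarrow> y i \<sigma> s \<in> common_kernel (lab \<sigma>)"
    and close: "s \<in> A i \<sigma> \<Longrightarrow> w \<in> insert (z i \<sigma> - y i \<sigma> s) (vec \<sigma>) \<Longrightarrow>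
       \<bar>blinfun_apply (f (s @ [lab (\<Phi> i \<sigma> s)])) w - blinfun_apply (f s) w\<bar> \<le> e"
    if "i < k" for i \<sigma> s w
    using \<Phi>[OF that, of \<sigma>] unfolding good_def Let_def y_def[symmetric] z_def[symmetric] by blast+
  have z_ker: "z i \<sigma> \<in> common_kernel (lab \<sigma>)" if "i < k" for i \<sigma>
    unfolding z_def by (rule subspace_sum[OF subspace_common_kernel y_ker[OF that]])
  define rs where "rs = map (\<lambda>i \<sigma>. (1 / (C + 1)) *\<^sub>R z i \<sigma>) [0..<k]"
  have rs_row: "null_row r" "norm (r \<tau>) \<le> 1" if "r \<in> set rs" for r \<tau>
  proof -
    obtain i where i: "i < k" "r = (\<lambda>\<sigma>. (1 / (C + 1)) *\<^sub>R z i \<sigma>)" using \<open>r \<in> set rs\<close> by (auto simp: rs_def)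
    have *: "r \<tau> \<in> common_kernel (lab \<tau>)" "norm (r \<tau>) \<le> 1" for \<tau>
      using subspace_scale[OF subspace_common_kernel z_ker[OF i(1)]] z_norm[OF i(1), of \<tau>] C0
      by (simp_all add: i(2) divide_le_eq)
    show "null_row r" by (rule null_row_kernel[OF *])
    show "norm (r \<tau>) \<le> 1" by (rule *(2))
  qed
  have rs_len: "length rs = k" by (simp add: rs_def)
  have "((\<lambda>t. norm (0 + row_sum rs t)) \<longlongrightarrow> row_lim 0 rs) (iter U (length rs))"
    by (rule row_lim_tendsto) (simp add: null_row_bounded rs_row(1))
  moreover have "row_lim 0 rs \<le> C" by (rule C) (erule rs_row(1), erule rs_row(2))
  then have "row_lim 0 rs < C + 1" by simp
  ultimately have ev1: "\<forall>\<^sub>F t in iter U k. norm (0 + row_sum rs t) < C + 1"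
    unfolding rs_len by (rule order_tendstoD(2))
  \<comment> \<open>The branch traced by a list of indices: at the node \<open>u\<close>, the index
    \<open>\<sigma>\<close> leads to the child of \<open>u\<close> that
    \<open>z (length u) \<sigma>\<close> uses when \<open>u \<in> nod \<sigma>\<close>.\<close>
  define b where "b = foldl (\<lambda>u \<sigma>. u @ [lab (\<Phi> (length u) \<sigma> u)]) []"
  have b_Nil: "b [] = []" by (simp add: b_def)
  have b_snoc: "b (s @ [\<sigma>]) = b s @ [lab (\<Phi> (length (b s)) \<sigma> (b s))]" for s \<sigma> by (simp add: b_def)
  have b_len: "length (b s) = length s" for s
    by (induction s rule: rev_induct) (simp_all add: b_Nil b_snoc)
  define w where "w s i = z i (s ! i) - x (b (take (Suc i) s))" for s i
  \<comment> \<open>The three conditions on the next index make the next child a summand of its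
    entry, make the current functional vanish on that entry and its summands, and make the next
    increment small on all earlier leftovers.\<close>
  define P where "P s \<sigma> \<longleftrightarrow> b s \<in> nod \<sigma> \<and> f (b s) \<in> set (lab \<sigma>) \<and> (\<forall>i\<in>{..<length s}. w s i \<in> vec \<sigma>)" for s \<sigma>
  have "\<forall>\<^sub>F t in iter U k. length t = k \<and> (\<forall>i<k. P (take i t) (t ! i))"
  proof (rule eventually_iter_step)
    fix s :: "'j list"
    have 1: "\<forall>\<^sub>F \<sigma> in U. \<forall>i\<in>{..<length s}. w s i \<in> vec \<sigma>"
      by (intro eventually_ball_finite finite_lessThan ballI vec)
    show "\<forall>\<^sub>F \<sigma> in U. P s \<sigma>"
      using nod[of "b s"] lab[of "f (b s)"] 1 unfolding P_def by eventually_elim blast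
  qed
  with ev1 have "\<forall>\<^sub>F t in iter U k. norm (0 + row_sum rs t) < C + 1 \<and> length t = k \<and> (\<forall>i<k. P (take i t) (t ! i))"
    by (rule eventually_conj)
  from eventually_ex_ultra[OF ultra_it this] obtain t where
    t: "norm (0 + row_sum rs t) < C + 1" "length t = k" and P: "\<And>q. q < k \<Longrightarrow> P (take q t) (t ! q)" by blast
  define B where "B i = b (take i t)" for i
  have B_len: "length (B i) = i" if "i \<le> k" for i using that t(2) by (simp add: B_def b_len)
  have B_Suc: "B (Suc i) = B i @ [lab (\<Phi> i (t ! i) (B i))]" if "i < k" for i
    using that t(2) by (simp add: B_def take_Suc_conv_app_nth b_snoc b_len)
  have B_take: "take i (B l) = B i" if "i \<le> l" "l \<le> k" for i l
    using that
  proof (induction l)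
    case (Suc l)
    show ?case
    proof (cases "i = Suc l")
      case True
      then show ?thesis using B_len[of i] Suc.prems by simp
    next
      case False
      then show ?thesis using Suc B_Suc[of l] B_len[of l] by simp
    qed
  qed (simp add: B_def b_Nil)
  have BA: "B i \<in> A i (t ! i)" if "i < k" for i
    using P[OF that] B_len[of i] that by (simp add: A_def P_def B_def)
  have xB: "x (B (Suc i)) = y i (t ! i) (B i)" if "i < k" for i
    by (simp add: B_Suc[OF that] y_def)
  define u where "u i = z i (t ! i) - x (B (Suc i))" for i
  \<comment> \<open>The functional at \<open>B i\<close> annihilates \<open>u i\<close>. The
    increment of step \<open>i\<close> is small on it as the sum of the other children, and the
    increments of later steps are small because \<open>u i\<close> belongs to \<open>vec\<close> of
    their indices.\<close>
  have u_small: "\<bar>blinfun_apply (f (B l)) (u i)\<bar> \<le> real (l - i) * e" if "i < k" "i \<le> l" "l \<le> k" for i l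
    using that(2,3)
  proof (induction l rule: dec_induct)
    case base
    have "u i \<in> common_kernel (lab (t ! i))"
      unfolding u_def xB[OF that(1)]
      by (rule subspace_diff[OF subspace_common_kernel z_ker[OF that(1)] y_ker[OF that(1) BA[OF that(1)]]])
    moreover have "f (B i) \<in> set (lab (t ! i))" using P[OF that(1)] by (simp add: P_def B_def)
    ultimately have "blinfun_apply (f (B i)) (u i) = 0" by (simp add: common_kernel_def)
    then show ?case by simp
  next
    case (step l)
    then have l: "l < k" by simp
    have "u i \<in> insert (z l (t ! l) - y l (t ! l) (B l)) (vec (t ! l))"
    proof (cases "l = i")
      case True
      then show ?thesis by (simp add: u_def xB[OF that(1)])
    next
      case False
      then have il: "i < l" using step by simp
      have "w (take l t) i \<in> vec (t ! l)" using P[OF l] il t(2) l by (simp add: P_def)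
      moreover have "w (take l t) i = u i" using il l t(2) by (simp add: w_def u_def B_def min_def)
      ultimately show ?thesis by simp
    qed
    from close[OF l BA[OF l] this]
    have "\<bar>blinfun_apply (f (B (Suc l))) (u i) - blinfun_apply (f (B l)) (u i)\<bar> \<le> e"
      by (simp add: B_Suc[OF l])
    moreover have "\<bar>blinfun_apply (f (B l)) (u i)\<bar> \<le> real (l - i) * e" using step by simp
    moreover have "real (Suc l - i) * e = real (l - i) * e + e" using step by (simp add: Suc_diff_le algebra_simps)
    ultimately show ?case by linarith
  qed
  let ?F = "blinfun_apply (f (B k))"
  have Bk: "length (B k) = k" by (rule B_len) simp
  have sum_path: "(\<Sum>j<k. tree_path x (B k) ! j) = (\<Sum>j<k. x (B (Suc j)))"
    by (rule sum.cong) (simp_all add: nth_tree_path Bk B_take)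
  have "(\<Sum>j<k. z j (t ! j)) = (\<Sum>j<k. tree_path x (B k) ! j) + (\<Sum>j<k. u j)"
    unfolding sum_path by (simp add: u_def sum_subtractf)
  then have "?F (\<Sum>j<k. z j (t ! j)) = ?F (\<Sum>j<k. tree_path x (B k) ! j) + ?F (\<Sum>j<k. u j)"
    by (simp only: blinfun.add_right)
  then have "?F (\<Sum>j<k. z j (t ! j)) = norm (\<Sum>j<k. tree_path x (B k) ! j) + (\<Sum>j<k. ?F (u j))"
    unfolding f_norm[OF Bk] blinfun.sum_right[of _ u] .
  moreover have "\<bar>\<Sum>j<k. ?F (u j)\<bar> \<le> 1"
  proof -
    have "\<bar>\<Sum>j<k. ?F (u j)\<bar> \<le> (\<Sum>j<k. \<bar>?F (u j)\<bar>)" by (rule sum_abs)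
    also have "\<dots> \<le> (\<Sum>j<k. real k * e)"
    proof (rule sum_mono)
      fix j assume "j \<in> {..<k}"
      then have "\<bar>?F (u j)\<bar> \<le> real (k - j) * e" by (intro u_small) auto
      also have "\<dots> \<le> real k * e" using e by (intro mult_right_mono) auto
      finally show "\<bar>?F (u j)\<bar> \<le> real k * e" .
    qed
    also have "\<dots> = real k * real k / (real k * real k + 1)" by (simp add: e_def)
    also have "\<dots> \<le> 1" by (simp add: divide_le_eq_1 add_nonneg_pos)
    finally show ?thesis .
  qed
  moreover have "norm (\<Sum>j<k. z j (t ! j)) \<le> (C + 1)\<^sup>2"
  proof -
    have "row_sum rs t = (\<Sum>j<k. (1 / (C + 1)) *\<^sub>R z j (t ! j))"
      unfolding row_sum_nth[of t rs, unfolded rs_len, OF t(2)]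
      by (rule sum.cong) (simp_all add: rs_def)
    also have "\<dots> = (1 / (C + 1)) *\<^sub>R (\<Sum>j<k. z j (t ! j))" by (rule scaleR_sum_right[symmetric])
    finally have "norm (\<Sum>j<k. z j (t ! j)) / (C + 1) < C + 1" using t(1) C0 by simp
    then show ?thesis using C0 by (simp add: divide_less_eq power2_eq_square)
  qed
  ultimately show ?thesis using D[OF Bk] f_le[of "B k" "\<Sum>j<k. z j (t ! j)"] by linarith
qed

end

section \<open>Trees with long branch sums, and their arrays\<close>

lemma diam_k_ge:
  assumes N: "norm_1supp_unc N"
  shows "N (ones k) \<le> diam_k N k"
proof -
  have sl: "sorted_list_of_set {..<k} = [0..<k]" "sorted_list_of_set {k..<2 * k} = [k..<2 * k]"
    by (simp_all add: lessThan_atLeast0 sorted_list_of_set_range)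
  have "dk N k {..<k} {k..<2 * k} = N (ones k)"
    by (rule dk_eq_ones) (simp add: sl)
  then have "N (ones k) = (\<lambda>p. dk N k (fst p) (snd p)) ({..<k}, {k..<2 * k})" by simp
  also have "\<dots> \<le> diam_k N k"
    unfolding diam_k_def
  proof (rule cSUP_upper)
    show "({..<k}, {k..<2 * k}) \<in> kset k \<times> kset k" by (simp add: kset_def)
    show "bdd_above ((\<lambda>p. dk N k (fst p) (snd p)) ` (kset k \<times> kset k))"
      by (rule bdd_aboveI2[where M = "N (ones k)"]) (rule dk_le_ones[OF N])
  qed
  finally show ?thesis .
qed

lemma norm_Rk_coord_le:
  assumes E: "norm_Rk_normalized_monotone k E" and a: "supp_in k a" and j: "j < k"
  shows "\<bar>a j\<bar> \<le> 2 * E a"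
  by (rule monotone_coord_le[OF _ _ _ _ a j])
    (use E j a in \<open>unfold norm_Rk_normalized_monotone_def, blast\<close>)+

text \<open>The sup norm is at most \<open>2 * E\<close> for every monotone normalized
  \<open>E\<close>, so a failure of \<open>c\<close>-equivalence must lie in the other estimate,
  with constant \<open>c / 2\<close>.\<close>

lemma not_equiv_linf_norm:
  assumes E: "norm_Rk_normalized_monotone k E" and c: "c > 0" and not: "\<not> fin_equiv k c E (linf_norm k)"
  shows "\<exists>a. (\<forall>j. \<bar>a j\<bar> \<le> 1) \<and> supp_in k a \<and> c / 2 < E a"
proof -
  have scale: "E (\<lambda>j. c * a j) = \<bar>c\<bar> * E a" if "supp_in k a" for a c
    using E that unfolding norm_Rk_normalized_monotone_def by blast
  have lower: "linf_norm k a \<le> 2 * E a" if a: "supp_in k a" for a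
  proof -
    have "E (\<lambda>j. if j < 0 then a j else 0) \<le> E a"
      using E a unfolding norm_Rk_normalized_monotone_def by blast
    then have "E (\<lambda>j. 0 * a j) \<le> E a" by simp
    then have "E a \<ge> 0" using scale[OF a, of 0] by simp
    then show ?thesis by (intro linf_norm_le norm_Rk_coord_le[OF E a]) auto
  qed
  have "\<exists>a. supp_in k a \<and> c / 2 * linf_norm k a < E a"
  proof (rule ccontr)
    assume "\<not> ?thesis"
    then have le: "E a \<le> c / 2 * linf_norm k a" if "supp_in k a" for a using that by (auto simp: not_less)
    have "fin_equiv k c E (linf_norm k)"
      unfolding fin_equiv_def
    proof (rule exI[of _ "c / 2"], rule exI[of _ 2], intro conjI allI impI)
      fix a assume a: "supp_in k a"
      show "E a / (c / 2) \<le> linf_norm k a" using le[OF a] c by (simp add: field_simps)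
      show "linf_norm k a \<le> 2 * E a" by (rule lower[OF a])
    qed (use c in auto)
    then show False using not by contradiction
  qed
  then obtain a where a: "supp_in k a" "c / 2 * linf_norm k a < E a" by blast
  have pos: "linf_norm k a > 0"
  proof (rule ccontr)
    assume "\<not> ?thesis"
    then have z: "linf_norm k a = 0" using linf_norm_nonneg[of k a] by simp
    have "a j = 0" for j
      using linf_norm_ge[of j k a] z a(1) by (cases "j < k") (auto simp: supp_in_def)
    then have "a = (\<lambda>j. 0 * a j)" by auto
    then have "E a = 0" using scale[OF a(1), of 0] by simp
    then show False using a(2) z by simp
  qed
  define b where "b j = (1 / linf_norm k a) * a j" for j
  have "\<bar>b j\<bar> \<le> 1" for j
    using linf_norm_ge[of j k a] pos a(1) by (cases "j < k") (auto simp: b_def abs_mult supp_in_def divide_le_eq_1)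
  moreover have "supp_in k b" using a(1) by (simp add: supp_in_def b_def)
  moreover have "E b = E a / linf_norm k a"
    unfolding b_def scale[OF a(1)] using pos by simp
  then have "c / 2 < E b" using a(2) pos by (simp add: less_divide_eq)
  ultimately show ?thesis by blast
qed

lemma asym_game_imp_game:
  fixes xs :: "'a::real_normed_vector list"
  assumes "asym_game E e k xs n"
  shows "game (\<lambda>xs. fin_equiv k (1 + e) E (\<lambda>a. norm (\<Sum>j<k. a j *\<^sub>R xs ! j)))
    (\<lambda>\<Phi>. {x \<in> common_kernel \<Phi>. norm x = 1}) xs n"
  using assms
proof (induction n arbitrary: xs)
  case (Suc n)
  show ?case
    unfolding game.simps
  proof
    fix \<Phi> :: "('a \<Rightarrow>\<^sub>L real) list"
    obtain x where "x \<in> common_kernel \<Phi>" "norm x = 1" "asym_game E e k (xs @ [x]) n"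
      using Suc.prems cofin_subspace_common_kernel[of \<Phi>] by auto
    then show "\<exists>y\<in>{x \<in> common_kernel \<Phi>. norm x = 1}.
        game (\<lambda>xs. fin_equiv k (1 + e) E (\<lambda>a. norm (\<Sum>j<k. a j *\<^sub>R xs ! j)))
        (\<lambda>\<Phi>. {x \<in> common_kernel \<Phi>. norm x = 1}) (xs @ [y]) n"
      using Suc.IH by (intro bexI[of _ x]) auto
  qed
qed simp

text \<open>The coefficients come from the norm \<open>E\<close>, hence are common to all branches.
  In \<open>4 * D\<close> one factor 2 is lost in \<open>not_equiv_linf_norm\<close>, the other by
  comparing a branch with \<open>E\<close> for \<epsilon> = 1.\<close>

lemma not_asymptotic_c0_trees:
  assumes "\<not> asymptotic_c0 TYPE('a::real_normed_vector)" and D: "D \<ge> 1"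
  shows "\<exists>k x. k > 0 \<and> (\<forall>s \<Phi>. length s < k \<longrightarrow> x (s @ [\<Phi>]) \<in> common_kernel \<Phi> \<and> norm (x (s @ [\<Phi>]) :: 'a) = 1) \<and>
    (\<exists>a. (\<forall>j. \<bar>a j\<bar> \<le> 1) \<and> (\<forall>s. length s = k \<longrightarrow> D \<le> norm (\<Sum>j<k. a j *\<^sub>R tree_path x s ! j)))"
proof -
  have "4 * D \<ge> 1" using D by simp
  then obtain k E where E: "E \<in> asym_struct TYPE('a) k" and not: "\<not> fin_equiv k (4 * D) E (linf_norm k)"
    using assms(1) unfolding asymptotic_c0_def by blast
  have E1: "norm_Rk_normalized_monotone k E" and g: "asym_game E 1 k ([] :: 'a list) k"
    using E by (auto simp: asym_struct_def)
  obtain a where a: "\<forall>j. \<bar>a j\<bar> \<le> 1" "supp_in k a" "4 * D / 2 < E a"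
    using not_equiv_linf_norm[OF E1 _ not] D by auto
  have k: "k > 0"
  proof (rule ccontr)
    assume "\<not> k > 0"
    then have "a = (\<lambda>j. 0 * a j)" using a(2) by (auto simp: supp_in_def)
    moreover have "E (\<lambda>j. 0 * a j) = \<bar>0\<bar> * E a"
      using E1 a(2) unfolding norm_Rk_normalized_monotone_def by blast
    ultimately show False using a(3) D by simp
  qed
  from game_strategy[OF asym_game_imp_game[OF g]] obtain x :: "('a \<Rightarrow>\<^sub>L real) list list \<Rightarrow> 'a" where
    x0: "(\<forall>s \<Phi>. length s < k \<longrightarrow> x (s @ [\<Phi>]) \<in> {x \<in> common_kernel \<Phi>. norm x = 1}) \<and>
      (\<forall>s. length s = k \<longrightarrow> fin_equiv k (1 + 1) E (\<lambda>a. norm (\<Sum>j<k. a j *\<^sub>R tree_path x s ! j)))" ..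
  have "D \<le> norm (\<Sum>j<k. a j *\<^sub>R tree_path x s ! j)" if s: "length s = k" for s
  proof -
    have "fin_equiv k (1 + 1) E (\<lambda>a. norm (\<Sum>j<k. a j *\<^sub>R tree_path x s ! j))" using x0 s by blast
    then obtain A B where AB: "A > 0" "B > 0" "A * B \<le> 2"
      "\<forall>a. supp_in k a \<longrightarrow> E a / A \<le> norm (\<Sum>j<k. a j *\<^sub>R tree_path x s ! j) \<and>
        norm (\<Sum>j<k. a j *\<^sub>R tree_path x s ! j) \<le> B * E a"
      unfolding fin_equiv_def by (elim exE conjE) (rule that, simp_all)
    have "tree_path x s ! 0 = x ([] @ [hd s])" using s k by (cases s) (auto simp: nth_tree_path)
    then have "norm (tree_path x s ! 0) = 1"
      using x0[THEN conjunct1, rule_format, of "[]" "hd s"] k by simp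
    moreover have "(\<Sum>j<k. unitv 0 j *\<^sub>R tree_path x s ! j) = tree_path x s ! 0"
    proof -
      have "(\<Sum>j<k. unitv 0 j *\<^sub>R tree_path x s ! j) = (\<Sum>j<k. if j = 0 then tree_path x s ! j else 0)"
        by (intro sum.cong) (auto simp: unitv_def)
      then show ?thesis using k by simp
    qed
    moreover have "supp_in k (unitv 0)" using k by (simp add: supp_in_def unitv_def)
    moreover have "E (unitv 0) = 1" using E1 k unfolding norm_Rk_normalized_monotone_def by blast
    ultimately have "1 \<le> B" using AB(4)[rule_format, of "unitv 0"] by simp
    then have "A * 1 \<le> A * B" using AB(1) by (intro mult_left_mono) auto
    then have "A \<le> 2" using AB(3) by simp
    then have "E a / 2 \<le> E a / A" using AB(1) a(3) D by (intro divide_left_mono) auto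
    have "D \<le> E a / 2" using a(3) by simp
    also have "\<dots> \<le> E a / A" by fact
    also have "\<dots> \<le> norm (\<Sum>j<k. a j *\<^sub>R tree_path x s ! j)" using AB(4) a(2) by blast
    finally show ?thesis .
  qed
  then show ?thesis using k a(1) x0 by (intro exI[of _ k] exI[of _ x] conjI exI[of _ a]) auto
qed

lemma (in null_ultrafilter_nodes) not_asymptotic_c0_rows:
  assumes not: "\<not> asymptotic_c0 TYPE('a)"
  shows "\<exists>x. (\<forall>j. null_row (x j)) \<and> (\<forall>j \<sigma>. norm (x j \<sigma>) = 1) \<and>
    (\<forall>p. \<exists>L. \<forall>k\<ge>L. real p < row_norm x (ones k))"
proof -
  \<comment> \<open>The first level of any nonempty tree gives unit vectors in all kernels; they
    replace zero entries in \<open>unit_row\<close>.\<close>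
  have "\<exists>e. null_row e \<and> (\<forall>\<sigma>. norm (e \<sigma>) = 1)"
  proof -
    obtain k x where k: "k > 0" and x: "\<forall>s \<Phi>. length s < k \<longrightarrow> x (s @ [\<Phi>]) \<in> common_kernel \<Phi> \<and> norm (x (s @ [\<Phi>]) :: 'a) = 1"
      using not_asymptotic_c0_trees[OF not order_refl] by (elim exE conjE) (rule that)
    have *: "x [\<Phi>] \<in> common_kernel \<Phi> \<and> norm (x [\<Phi>]) = 1" for \<Phi> using x[rule_format, of "[]" \<Phi>] k by simp
    then have "null_row (\<lambda>\<sigma>. x [lab \<sigma>])" by (intro null_row_kernel[of _ 1]) simp_all
    then show ?thesis using * by blast
  qed
  then obtain e where e: "null_row e" "\<And>\<sigma>. norm (e \<sigma>) = 1" by blast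
  have big: "\<exists>rs. (\<forall>r\<in>set rs. null_row r \<and> (\<forall>\<sigma>. norm (r \<sigma>) \<le> 1)) \<and> C < row_lim 0 rs" for C
  proof (rule ccontr)
    assume no: "\<not> ?thesis"
    have C: "row_lim 0 rs \<le> C" if "\<And>r. r \<in> set rs \<Longrightarrow> null_row r" "\<And>r \<sigma>. r \<in> set rs \<Longrightarrow> norm (r \<sigma>) \<le> 1" for rs
    proof (rule ccontr)
      assume "\<not> row_lim 0 rs \<le> C"
      then have "(\<forall>r\<in>set rs. null_row r \<and> (\<forall>\<sigma>. norm (r \<sigma>) \<le> 1)) \<and> C < row_lim 0 rs"
        by (intro conjI ballI allI that) simp_all
      then show False using no by (elim notE) (rule exI)
    qed
    have "(C + 1)\<^sup>2 + 2 \<ge> 1" using zero_le_power2[of "C + 1"] by linarith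
    from not_asymptotic_c0_trees[OF not this] obtain k x a where
      x: "\<forall>s \<Phi>. length s < k \<longrightarrow> x (s @ [\<Phi>]) \<in> common_kernel \<Phi> \<and> norm (x (s @ [\<Phi>]) :: 'a) = 1"
      and a: "\<forall>j. \<bar>a j\<bar> \<le> 1"
      and D: "\<forall>s. length s = k \<longrightarrow> (C + 1)\<^sup>2 + 2 \<le> norm (\<Sum>j<k. a j *\<^sub>R tree_path x s ! j)"
      by (elim exE conjE) (rule that)
    \<comment> \<open>The coefficients are absorbed into the nodes, which leaves vectors of norm at
      most 1. This is why the bounds concern the unit ball and rows are normalised only
      afterwards.\<close>
    define y where "y s = a (length s - 1) *\<^sub>R x s" for s
    have "(C + 1)\<^sup>2 + 2 \<le> (C + 1)\<^sup>2 + 1"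
    proof (rule tree_bound[OF C, where x = y and k = k])
      fix s :: "('a \<Rightarrow>\<^sub>L real) list list" and \<Phi> assume s: "length s < k"
      show "y (s @ [\<Phi>]) \<in> common_kernel \<Phi> \<and> norm (y (s @ [\<Phi>])) \<le> 1"
        using x s a by (auto simp: y_def intro: subspace_scale[OF subspace_common_kernel])
    next
      fix s :: "('a \<Rightarrow>\<^sub>L real) list list" assume s: "length s = k"
      have "(\<Sum>j<k. tree_path y s ! j) = (\<Sum>j<k. a j *\<^sub>R tree_path x s ! j)"
      proof (rule sum.cong)
        fix j assume "j \<in> {..<k}"
        then show "tree_path y s ! j = a j *\<^sub>R tree_path x s ! j"
          by (simp add: nth_tree_path s y_def min_absorb2)
      qed simp
      then show "(C + 1)\<^sup>2 + 2 \<le> norm (\<Sum>j<k. tree_path y s ! j)" using D s by simp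
    qed
    then show False by simp
  qed
  have "\<exists>rs. (\<forall>r\<in>set rs. null_row r \<and> (\<forall>\<sigma>. norm (r \<sigma>) = 1)) \<and> C < row_lim 0 rs" for C
  proof -
    from big[of C] obtain rs where
      rs0: "(\<forall>r\<in>set rs. null_row r \<and> (\<forall>\<sigma>. norm (r \<sigma>) \<le> 1)) \<and> C < row_lim 0 rs" ..
    then have rs: "\<And>r. r \<in> set rs \<Longrightarrow> null_row r" "\<And>r \<sigma>. r \<in> set rs \<Longrightarrow> norm (r \<sigma>) \<le> 1" "C < row_lim 0 rs"
      by simp_all
    have "row_lim 0 rs \<le> row_lim 0 (map (unit_row e) rs)"
      by (rule row_lim_unit_row[OF e]) (erule rs(1), erule rs(2))
    then have lt: "C < row_lim 0 (map (unit_row e) rs)" using rs(3) by simp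
    have unit: "null_row r \<and> (\<forall>\<sigma>. norm (r \<sigma>) = 1)" if "r \<in> set (map (unit_row e) rs)" for r
    proof -
      obtain r' where "r' \<in> set rs" "r = unit_row e r'"
        using \<open>r \<in> set (map (unit_row e) rs)\<close> by auto
      then show ?thesis using null_row_unit_row[OF e rs(1)] by blast
    qed
    show ?thesis by (rule exI[of _ "map (unit_row e) rs"], rule conjI, rule ballI, erule unit, rule lt)
  qed
  then have "\<exists>R. \<forall>p. (\<forall>r\<in>set (R p). null_row r \<and> (\<forall>\<sigma>. norm (r \<sigma>) = 1)) \<and> real p < row_lim 0 (R p)"
    by (intro choice) blast
  then obtain R where "\<forall>p. (\<forall>r\<in>set (R p). null_row r \<and> (\<forall>\<sigma>. norm (r \<sigma>) = 1)) \<and> real p < row_lim 0 (R p)" ..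
  then show ?thesis by (intro concat_rows[of R]) blast+
qed

section \<open>Existence of the ultrafilter and conclusion\<close>

lemma null_ultrafilter_nodes_exists:
  "\<exists>(U :: (('a::banach \<Rightarrow>\<^sub>L real) list list \<times> 'a \<times> ('a \<Rightarrow>\<^sub>L real)) set filter)
    (lab :: _ \<Rightarrow> ('a \<Rightarrow>\<^sub>L real) list) nod vec. null_ultrafilter_nodes U lab nod vec"
proof -
  \<comment> \<open>An index is a finite set of triples and eventually contains any given triple;
    its three projections are the nodes, the vectors and the functionals it carries.\<close>
  let ?F = "finite_subsets_at_top UNIV :: (('a \<Rightarrow>\<^sub>L real) list list \<times> 'a \<times> ('a \<Rightarrow>\<^sub>L real)) set filter"
  obtain U where U: "U \<le> ?F" "ultra U" using ultra_exists[of ?F] by auto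
  have ev: "\<forall>\<^sub>F \<sigma> in U. finite \<sigma> \<and> p \<in> \<sigma>" for p
    by (rule filter_leD[OF U(1)]) (auto simp: eventually_finite_subsets_at_top intro!: exI[of _ "{p}"])
  define lab where "lab \<sigma> = (SOME l. finite \<sigma> \<longrightarrow> set l = (snd \<circ> snd) ` \<sigma>)"
    for \<sigma> :: "(('a \<Rightarrow>\<^sub>L real) list list \<times> 'a \<times> ('a \<Rightarrow>\<^sub>L real)) set"
  have lab: "set (lab \<sigma>) = (snd \<circ> snd) ` \<sigma>" if "finite \<sigma>" for \<sigma>
  proof -
    have "\<exists>l. finite \<sigma> \<longrightarrow> set l = (snd \<circ> snd) ` \<sigma>" using finite_list[of "(snd \<circ> snd) ` \<sigma>"] by blast
    from someI_ex[OF this] show ?thesis using that by (simp add: lab_def)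
  qed
  define nod where "nod \<sigma> = (if finite \<sigma> then fst ` \<sigma> else {})"
    for \<sigma> :: "(('a \<Rightarrow>\<^sub>L real) list list \<times> 'a \<times> ('a \<Rightarrow>\<^sub>L real)) set"
  define vec where "vec \<sigma> = (if finite \<sigma> then (fst \<circ> snd) ` \<sigma> else {})"
    for \<sigma> :: "(('a \<Rightarrow>\<^sub>L real) list list \<times> 'a \<times> ('a \<Rightarrow>\<^sub>L real)) set"
  have "null_ultrafilter_nodes U lab nod vec"
  proof
    show "ultra U" by (rule U(2))
    show "\<forall>\<^sub>F \<sigma> in U. f \<in> set (lab \<sigma>)" for f
      using ev[of "(undefined, undefined, f)"] by eventually_elim (force simp: lab)
    show "\<forall>\<^sub>F \<sigma> in U. s \<in> nod \<sigma>" for s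
      using ev[of "(s, undefined, undefined)"] by eventually_elim (force simp: nod_def)
    show "\<forall>\<^sub>F \<sigma> in U. w \<in> vec \<sigma>" for w
      using ev[of "(undefined, w, undefined)"] by eventually_elim (force simp: vec_def)
  qed (simp_all add: nod_def vec_def)
  then show ?thesis by blast
qed

lemma not_asymptotic_c0_embeds:
  assumes "\<not> asymptotic_c0 TYPE('a::banach)"
  shows "\<exists>N. norm_1supp_unc N \<and> filterlim (diam_k N) at_top sequentially \<and>
    (\<forall>k. embeds_with (kset k) (dk N k) (UNIV::'a set) 3)"
proof -
  obtain U :: "(('a \<Rightarrow>\<^sub>L real) list list \<times> 'a \<times> ('a \<Rightarrow>\<^sub>L real)) set filter"
      and lab :: "_ \<Rightarrow> ('a \<Rightarrow>\<^sub>L real) list" and nod vec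
    where "null_ultrafilter_nodes U lab nod vec" using null_ultrafilter_nodes_exists by blast
  then interpret null_ultrafilter_nodes U lab nod vec .
  obtain x where x: "\<forall>j. null_row (x j)" "\<forall>j \<sigma>. norm (x j \<sigma>) = 1"
    and big: "\<forall>p. \<exists>L. \<forall>k\<ge>L. real p < row_norm x (ones k)"
    using not_asymptotic_c0_rows[OF assms] by blast
  have N: "norm_1supp_unc (row_norm x)" by (rule norm_1supp_unc_row_norm[OF x])
  have "filterlim (diam_k (row_norm x)) at_top sequentially"
    unfolding filterlim_at_top
  proof
    fix Z :: real
    obtain p :: nat where p: "Z \<le> real p" using real_arch_simple by blast
    obtain L where L: "\<forall>k\<ge>L. real p < row_norm x (ones k)" using big by blast
    have "Z \<le> diam_k (row_norm x) k" if "k \<ge> L" for k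
      using L[rule_format, OF that] p diam_k_ge[OF N, of k] by linarith
    then show "\<forall>\<^sub>F k in sequentially. Z \<le> diam_k (row_norm x) k"
      unfolding eventually_sequentially by blast
  qed
  then show ?thesis using N row_norm_embeds[OF x] by blast
qed

lemma asymptotic_c0_distortion:
  assumes refl: "reflexive_X TYPE('a::banach)" and c0: "asymptotic_c0 TYPE('a)"
    and N: "norm_1supp_unc N" "filterlim (diam_k N) at_top sequentially"
  shows "(SUP k. distortion (UNIV::'a set) (kset k) (dk N k)) = \<infinity>"
proof -
  obtain U :: "(('a \<Rightarrow>\<^sub>L real) list list \<times> 'a \<times> ('a \<Rightarrow>\<^sub>L real)) set filter"
      and lab :: "_ \<Rightarrow> ('a \<Rightarrow>\<^sub>L real) list" and nod vec
    where "null_ultrafilter_nodes U lab nod vec" using null_ultrafilter_nodes_exists by blast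
  then interpret null_ultrafilter_nodes U lab nod vec .
  obtain c where c: "c \<ge> 1" "\<And>k E. E \<in> asym_struct TYPE('a) k \<Longrightarrow> fin_equiv k c E (linf_norm k)"
    using c0 unfolding asymptotic_c0_def by blast
  have "2 * c > 0" using c(1) by simp
  then show ?thesis
    by (rule distortion_infinite[OF refl _ asymptotic_c0_game[OF c] N])
qed

theorem theorem3p1:
  shows "(separable_X TYPE('a::banach) \<and> reflexive_X TYPE('a) \<longrightarrow>
            (asymptotic_c0 TYPE('a) \<longleftrightarrow>
              (\<forall>N. norm_1supp_unc N \<and> filterlim (diam_k N) at_top sequentially \<longrightarrow>
                 (SUP k. distortion (UNIV::'a set) (kset k) (dk N k)) = \<infinity>)))
       \<and> (separable_X TYPE('a) \<and> \<not> asymptotic_c0 TYPE('a) \<longrightarrow>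
            (\<exists>N. norm_1supp_unc N \<and> filterlim (diam_k N) at_top sequentially \<and>
               (\<forall>k. embeds_with (kset k) (dk N k) (UNIV::'a set) 3)))"
proof -
  have "asymptotic_c0 TYPE('a)"
    if inf: "\<forall>N. norm_1supp_unc N \<and> filterlim (diam_k N) at_top sequentially \<longrightarrow>
      (SUP k. distortion (UNIV::'a set) (kset k) (dk N k)) = \<infinity>"
  proof (rule ccontr)
    assume "\<not> asymptotic_c0 TYPE('a)"
    from not_asymptotic_c0_embeds[OF this] obtain N where N: "norm_1supp_unc N"
      "filterlim (diam_k N) at_top sequentially" "\<forall>k. embeds_with (kset k) (dk N k) (UNIV::'a set) 3"
      by blast
    have "distortion (UNIV::'a set) (kset k) (dk N k) \<le> ereal 3" for k
      unfolding distortion_def by (rule Inf_lower) (use N(3) in auto)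
    then have "(SUP k. distortion (UNIV::'a set) (kset k) (dk N k)) \<le> ereal 3" by (rule SUP_least)
    moreover have "(SUP k. distortion (UNIV::'a set) (kset k) (dk N k)) = \<infinity>" using inf N(1,2) by blast
    ultimately show False by simp
  qed
  then show ?thesis
    using asymptotic_c0_distortion not_asymptotic_c0_embeds by blast
qed

end
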